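(* In the linear-quadratic mean field control problem with delay described in the context, let $t\in[0,T]$ and $x\in\mathbb{R}$. For $q\in\mathbb{R}^2$ set $$u^*(q)=\frac{\langle q-\tilde\beta,(1,1)\rangle}{2(\gamma_0+\gamma_1)}.$$ Then the (deterministic) control $s\mapsto u^*(B^*a(s))$, $s\in[t,T]$, is optimal for $\overline V(t,x)$, i.e. $\overline V(t,x)=J\big(t,x;u^*(B^*a(\cdot))\big)$.
   Context: **Data.** $T>0$, $d>0$, $r\in\mathbb{R}$ (discount rate), $\sigma\in\mathbb{R}$; $a_0,a_1\in\mathbb{R}$; $b_0\ge0$; $b_1\in L^2([-d,0];\mathbb{R}^+)$; $\delta\in L^2([-d,0];\mathbb{R})$ (past of the control). $W$ is a real Brownian motion on a filtered probability space $(\Omega,\mathcal{F},(\mathcal{F}_t)_{t\ge0},\mathbb{P})$, with $(\Omega,\mathcal F,\mathbb P)$ complete and the filtration being the augmentation of the one generated by $W$. The control set is $U=\mathbb{R}$, and $\mathcal{U}=L^2_{\mathcal{P}}(\Omega\times[0,T];U)$ is the space of $U$-valued square integrable progressively measurable processes. **Mean field control problem.** For $t\in[0,T]$, $x\in\mathbb{R}$, $u\in\mathcal{U}$, $X^{t,x,u}$ is the unique strong solution of $$dX(s)=\Big[a_0X(s)+a_1\mathbb{E}[X(s)]+b_0u(s)+\int_{-d}^0b_1(\xi)u(s+\xi)\,d\xi\Big]ds+\sigma\,dW(s),\ s\in[t,T],\qquad X(t)=x,$$ where $u$ before time $t$ is given by $u(t+\xi)=\delta(\xi)$ for $\xi\in[-d,0]$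 (so only the restriction of $u$ to $[t,T]$ is a choice). With $\alpha_0,\alpha_1,\beta_0,\beta_1,\lambda_0,\lambda_1\in\mathbb{R}$ and $\gamma_0,\gamma_1>0$, put $$f(t,x,m,u,z)=\alpha_0x-\alpha_1m-\beta_0u-\gamma_0u^2-\beta_1z-\gamma_1z^2,\qquad g(x,m)=\lambda_0x-\lambda_1m,$$ $$J(t,x;u)=\mathbb{E}\Big[\int_t^Te^{-r(s-t)}f\big(s,X^{t,x,u}(s),\mathbb{E}[X^{t,x,u}(s)],u(s),\mathbb{E}[u(s)]\big)ds+e^{-r(T-t)}g\big(X^{t,x,u}(T),\mathbb{E}[X^{t,x,u}(T)]\big)\Big],$$ and $\overline V(t,x)=\sup_{u\in\mathcal{U}}J(t,x;u)$. A control $u^*$ is optimal for $\overline V(t,x)$ if $J(t,x;u^* )=\overline V(t,x)$. **Objects entering the optimal control.** $\tilde\alpha=(\alpha_0,-\alpha_1)$, $\tilde\beta=(\beta_0,\beta_1)$, $\tilde\lambda=(\lambda_0,-\lambda_1)$. $H=\mathbb{R}^2\times L^2([-d,0],\mathbb{R}^2)$, with elements $y=(y_0,y_1)$. $A_0=\begin{bmatrix}a_0&a_1\\0&a_0+a_1\end{bmatrix}$, with transpose $A_0^*$. $\{e^{tA^*}\}_{t\ge0}$ is the $C_0$-semigroup on $H$ $$e^{tA^*}y=\Big(e^{tA_0^*}y_0,\ e^{(\cdot+t)A_0^*}y_0\mathbf{1}_{[-t,0]}(\cdot)+y_1(\cdot+t)\mathbf{1}_{[-d,-t]}(\cdot)\Big),$$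 $e^{\tau(A^*-r)}:=e^{-r\tau}e^{\tau A^*}$, and $B^*\colon H\to\mathbb{R}^2$ is $B^*y=b_0y_0+\int_{-d}^0b_1(\xi)y_1(\xi)\,d\xi$. Finally, for $t\in[0,T]$, $$a(t)=e^{(T-t)(A^*-r)}(\tilde\lambda,0)+\int_t^Te^{(s-t)(A^*-r)}(\tilde\alpha,0)\,ds\in H.$$ *)

theory Defs
  imports "HOL-Probability.Probability"
begin

section \<open>Data of the problem\<close>

record lq_data =
  horizon :: real        \<comment> \<open>\<open>T\<close>\<close>
  delay :: real          \<comment> \<open>\<open>d\<close>\<close>
  rate :: real           \<comment> \<open>discount rate \<open>r\<close>\<close>
  \<sigma> :: real
  a\<^sub>0 :: real
  a\<^sub>1 :: real
  b\<^sub>0 :: real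
  b\<^sub>1 :: "real \<Rightarrow> real"
  \<delta> :: "real \<Rightarrow> real"     \<comment> \<open>past of the control\<close>
  \<alpha>\<^sub>0 :: real
  \<alpha>\<^sub>1 :: real
  \<beta>\<^sub>0 :: real
  \<beta>\<^sub>1 :: real
  \<gamma>\<^sub>0 :: real
  \<gamma>\<^sub>1 :: real
  l\<^sub>0 :: real             \<comment> \<open>the terminal coefficients \<open>\<lambda>\<^sub>0\<close>, \<open>\<lambda>\<^sub>1\<close>\<close>
  l\<^sub>1 :: real

text \<open>Square integrability on \<open>[-d, 0]\<close>. Elements of \<open>L\<^sup>2([-d, 0])\<close> are represented by functions
  on the real line, whose values outside \<open>[-d, 0]\<close> are never used.\<close>

definition L2_delay :: "real \<Rightarrow> (real \<Rightarrow> 'b::euclidean_space) \<Rightarrow> bool" where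
  "L2_delay d h \<longleftrightarrow> set_borel_measurable lborel {-d..0} h
     \<and> set_integrable lborel {-d..0} (\<lambda>\<xi>. (norm (h \<xi>))\<^sup>2)"

section \<open>Brownian motion and admissible controls\<close>

definition brownian_filtration :: "'w measure \<Rightarrow> (real \<Rightarrow> 'w \<Rightarrow> real) \<Rightarrow> real \<Rightarrow> 'w measure" where
  "brownian_filtration M W t = sigma (space M)
     ((\<Union>s\<in>{0..t}. {W s -` A \<inter> space M | A. A \<in> sets borel}) \<union> null_sets M)"

definition brownian_motion ::
  "'w measure \<Rightarrow> (real \<Rightarrow> 'w measure) \<Rightarrow> (real \<Rightarrow> 'w \<Rightarrow> real) \<Rightarrow> bool" where
  "brownian_motion M F W \<longleftrightarrow>
     (\<forall>s\<ge>0. W s \<in> borel_measurable M \<and> W s \<in> borel_measurable (F s))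
   \<and> (AE \<omega> in M. W 0 \<omega> = 0)
   \<and> (AE \<omega> in M. continuous_on {0..} (\<lambda>s. W s \<omega>))
   \<and> (\<forall>s v. 0 \<le> s \<and> s < v \<longrightarrow>
        distributed M lborel (\<lambda>\<omega>. W v \<omega> - W s \<omega>) (normal_density 0 (sqrt (v - s)))
      \<and> prob_space.indep_set M (sets (F s))
          (sets (vimage_algebra (space M) (\<lambda>\<omega>. W v \<omega> - W s \<omega>) borel)))"

definition progressively_measurable ::
  "(real \<Rightarrow> 'w measure) \<Rightarrow> real \<Rightarrow> (real \<Rightarrow> 'w \<Rightarrow> real) \<Rightarrow> bool" where
  "progressively_measurable F T u \<longleftrightarrow> (\<forall>s\<in>{0..T}.
     (\<lambda>(v, \<omega>). u v \<omega>) \<in> borel_measurable (restrict_space borel {0..s} \<Otimes>\<^sub>M F s))"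

definition controls ::
  "'w measure \<Rightarrow> (real \<Rightarrow> 'w \<Rightarrow> real) \<Rightarrow> lq_data \<Rightarrow> (real \<Rightarrow> 'w \<Rightarrow> real) set" where
  "controls M W P = {u. progressively_measurable (brownian_filtration M W) (horizon P) u
     \<and> integrable (restrict_space lborel {0..horizon P} \<Otimes>\<^sub>M M) (\<lambda>(s, \<omega>). (u s \<omega>)\<^sup>2)}"

section \<open>State equation and optimization problem\<close>

text \<open>The control started at time \<open>t\<close>, extended to the past of \<open>t\<close> by \<open>u(t + \<xi>) = \<delta>(\<xi>)\<close>.\<close>

definition with_past ::
  "lq_data \<Rightarrow> real \<Rightarrow> (real \<Rightarrow> 'w \<Rightarrow> real) \<Rightarrow> real \<Rightarrow> 'w \<Rightarrow> real" where
  "with_past P t u s \<omega> = (if s < t then \<delta> P (s - t) else u s \<omega>)"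

definition drift :: "'w measure \<Rightarrow> lq_data \<Rightarrow> real \<Rightarrow> (real \<Rightarrow> 'w \<Rightarrow> real) \<Rightarrow>
    (real \<Rightarrow> 'w \<Rightarrow> real) \<Rightarrow> real \<Rightarrow> 'w \<Rightarrow> real" where
  "drift M P t u X s \<omega> = a\<^sub>0 P * X s \<omega> + a\<^sub>1 P * integral\<^sup>L M (X s) + b\<^sub>0 P * u s \<omega>
     + (LINT \<xi>:{-delay P..0}|lborel. b\<^sub>1 P \<xi> * with_past P t u (s + \<xi>) \<omega>)"

text \<open>The noise is additive with constant \<open>\<sigma>\<close>, so its stochastic integral over \<open>[t, s]\<close> is
  \<open>\<sigma> (W s - W t)\<close>.\<close>

definition strong_solution :: "'w measure \<Rightarrow> (real \<Rightarrow> 'w \<Rightarrow> real) \<Rightarrow> lq_data \<Rightarrow> real \<Rightarrow> real \<Rightarrow>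
    (real \<Rightarrow> 'w \<Rightarrow> real) \<Rightarrow> (real \<Rightarrow> 'w \<Rightarrow> real) \<Rightarrow> bool" where
  "strong_solution M W P t x u X \<longleftrightarrow>
     (\<forall>s\<in>{t..horizon P}. X s \<in> borel_measurable (brownian_filtration M W s) \<and> integrable M (X s))
   \<and> (AE \<omega> in M. continuous_on {t..horizon P} (\<lambda>s. X s \<omega>)
        \<and> set_integrable lborel {t..horizon P} (\<lambda>s. drift M P t u X s \<omega>)
        \<and> (\<forall>s\<in>{t..horizon P}. X s \<omega> =
             x + (LINT v:{t..s}|lborel. drift M P t u X v \<omega>) + \<sigma> P * (W s \<omega> - W t \<omega>)))"

text \<open>For admissible \<open>u\<close> the solution exists and is unique up to indistinguishability; any
  representative may be chosen.\<close>

definition state :: "'w measure \<Rightarrow> (real \<Rightarrow> 'w \<Rightarrow> real) \<Rightarrow> lq_data \<Rightarrow> real \<Rightarrow> real \<Rightarrow>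
    (real \<Rightarrow> 'w \<Rightarrow> real) \<Rightarrow> real \<Rightarrow> 'w \<Rightarrow> real" where
  "state M W P t x u = (SOME X. strong_solution M W P t x u X)"

definition running_gain :: "lq_data \<Rightarrow> real \<Rightarrow> real \<Rightarrow> real \<Rightarrow> real \<Rightarrow> real \<Rightarrow> real" where
  "running_gain P s x m u z =
     \<alpha>\<^sub>0 P * x - \<alpha>\<^sub>1 P * m - \<beta>\<^sub>0 P * u - \<gamma>\<^sub>0 P * u\<^sup>2 - \<beta>\<^sub>1 P * z - \<gamma>\<^sub>1 P * z\<^sup>2"

definition terminal_gain :: "lq_data \<Rightarrow> real \<Rightarrow> real \<Rightarrow> real" where
  "terminal_gain P x m = l\<^sub>0 P * x - l\<^sub>1 P * m"

definition J :: "'w measure \<Rightarrow> (real \<Rightarrow> 'w \<Rightarrow> real) \<Rightarrow> lq_data \<Rightarrow> real \<Rightarrow> real \<Rightarrow>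
    (real \<Rightarrow> 'w \<Rightarrow> real) \<Rightarrow> real" where
  "J M W P t x u = (let X = state M W P t x u; T = horizon P; r = rate P in
     LINT \<omega>|M.
       (LINT s:{t..T}|lborel. exp (- r * (s - t)) *
          running_gain P s (X s \<omega>) (integral\<^sup>L M (X s)) (u s \<omega>) (integral\<^sup>L M (u s)))
       + exp (- r * (T - t)) * terminal_gain P (X T \<omega>) (integral\<^sup>L M (X T)))"

text \<open>Extended-real valued, so that no finiteness of the supremum is presupposed.\<close>

definition V :: "'w measure \<Rightarrow> (real \<Rightarrow> 'w \<Rightarrow> real) \<Rightarrow> lq_data \<Rightarrow> real \<Rightarrow> real \<Rightarrow> ereal" where
  "V M W P t x = (SUP u\<in>controls M W P. ereal (J M W P t x u))"

definition optimal_control :: "'w measure \<Rightarrow> (real \<Rightarrow> 'w \<Rightarrow> real) \<Rightarrow> lq_data \<Rightarrow> real \<Rightarrow> real \<Rightarrow>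
    (real \<Rightarrow> 'w \<Rightarrow> real) \<Rightarrow> bool" where
  "optimal_control M W P t x u \<longleftrightarrow> u \<in> controls M W P \<and> V M W P t x = ereal (J M W P t x u)"

section \<open>The space \<open>H = \<real>\<^sup>2 \<times> L\<^sup>2([-d, 0], \<real>\<^sup>2)\<close> and the adjoint curve\<close>

type_synonym H = "(real^2) \<times> (real \<Rightarrow> real^2)"

definition H_space :: "real \<Rightarrow> H set" where
  "H_space d = {y. L2_delay d (snd y)}"

definition H_inner :: "real \<Rightarrow> H \<Rightarrow> H \<Rightarrow> real" where
  "H_inner d y z = fst y \<bullet> fst z + (LINT \<xi>:{-d..0}|lborel. snd y \<xi> \<bullet> snd z \<xi>)"

definition H_add :: "H \<Rightarrow> H \<Rightarrow> H" where
  "H_add y z = (fst y + fst z, \<lambda>\<xi>. snd y \<xi> + snd z \<xi>)"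

definition H_scale :: "real \<Rightarrow> H \<Rightarrow> H" where
  "H_scale c y = (c *\<^sub>R fst y, \<lambda>\<xi>. c *\<^sub>R snd y \<xi>)"

text \<open>\<open>H\<close> has no type of its own here, so its integral is defined by duality: \<open>h\<close> is the integral
  of \<open>Y\<close> over \<open>[s, t]\<close> iff \<open>\<langle>h, k\<rangle> = \<integral> \<langle>Y(v), k\<rangle> dv\<close> for all \<open>k\<close> in \<open>H\<close>. For Bochner integrable \<open>Y\<close>
  this is the Bochner integral. Such \<open>h\<close> is unique as an element of \<open>H\<close>, that is, up to null sets in
  the second component.\<close>

definition has_H_integral :: "real \<Rightarrow> (real \<Rightarrow> H) \<Rightarrow> real \<Rightarrow> real \<Rightarrow> H \<Rightarrow> bool" where
  "has_H_integral d Y s t h \<longleftrightarrow> h \<in> H_space d \<and> (\<forall>k\<in>H_space d.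
     set_integrable lborel {s..t} (\<lambda>v. H_inner d (Y v) k)
   \<and> H_inner d h k = (LINT v:{s..t}|lborel. H_inner d (Y v) k))"

definition H_integral :: "real \<Rightarrow> (real \<Rightarrow> H) \<Rightarrow> real \<Rightarrow> real \<Rightarrow> H" where
  "H_integral d Y s t = (SOME h. has_H_integral d Y s t h)"

definition mat_exp :: "real^'n^'n \<Rightarrow> real^'n^'n" where
  "mat_exp A = (\<Sum>n. (1 / fact n) *\<^sub>R (((**) A ^^ n) (mat 1)))"

definition A\<^sub>0 :: "lq_data \<Rightarrow> real^2^2" where
  "A\<^sub>0 P = vector [vector [a\<^sub>0 P, a\<^sub>1 P], vector [0, a\<^sub>0 P + a\<^sub>1 P]]"

text \<open>\<open>e\<^sup>t\<^sup>A\<^sup>*\<close> for \<open>t \<ge> 0\<close>.\<close>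

definition adj_semigroup :: "lq_data \<Rightarrow> real \<Rightarrow> H \<Rightarrow> H" where
  "adj_semigroup P t y =
     (mat_exp (t *\<^sub>R transpose (A\<^sub>0 P)) *v fst y,
      \<lambda>\<xi>. indicator {-t..0} \<xi> *\<^sub>R (mat_exp ((\<xi> + t) *\<^sub>R transpose (A\<^sub>0 P)) *v fst y)
        + indicator {-delay P..-t} \<xi> *\<^sub>R snd y (\<xi> + t))"

text \<open>\<open>e\<^sup>t\<^sup>(\<^sup>A\<^sup>*\<^sup>-\<^sup>r\<^sup>)\<close> for \<open>t \<ge> 0\<close>.\<close>

definition disc_adj_semigroup :: "lq_data \<Rightarrow> real \<Rightarrow> H \<Rightarrow> H" where
  "disc_adj_semigroup P t y = H_scale (exp (- rate P * t)) (adj_semigroup P t y)"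

definition B_adj :: "lq_data \<Rightarrow> H \<Rightarrow> real^2" where
  "B_adj P y = b\<^sub>0 P *\<^sub>R fst y + (LINT \<xi>:{-delay P..0}|lborel. b\<^sub>1 P \<xi> *\<^sub>R snd y \<xi>)"

definition \<alpha>_tilde :: "lq_data \<Rightarrow> real^2" where "\<alpha>_tilde P = vector [\<alpha>\<^sub>0 P, - \<alpha>\<^sub>1 P]"
definition \<beta>_tilde :: "lq_data \<Rightarrow> real^2" where "\<beta>_tilde P = vector [\<beta>\<^sub>0 P, \<beta>\<^sub>1 P]"
definition l_tilde :: "lq_data \<Rightarrow> real^2" where "l_tilde P = vector [l\<^sub>0 P, - l\<^sub>1 P]"

definition a_curve :: "lq_data \<Rightarrow> real \<Rightarrow> H" where
  "a_curve P t = H_add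
     (disc_adj_semigroup P (horizon P - t) (l_tilde P, \<lambda>_. 0))
     (H_integral (delay P) (\<lambda>s. disc_adj_semigroup P (s - t) (\<alpha>_tilde P, \<lambda>_. 0)) t (horizon P))"

definition u_star :: "lq_data \<Rightarrow> real^2 \<Rightarrow> real" where
  "u_star P q = ((q - \<beta>_tilde P) \<bullet> vector [1, 1]) / (2 * (\<gamma>\<^sub>0 P + \<gamma>\<^sub>1 P))"

end

theory Submission
  imports Defs
begin

text \<open>The gain is affine in the state and in its mean, and quadratic only in the control and in the
  mean of the control. Taking expectations, \<open>J(u)\<close> therefore depends on \<open>u\<close> only through its first
  two moments: it is an affine functional of the mean state minus
  \<open>\<integral> e\<^bsup>-r(s-t)\<^esup> ((\<beta>\<^sub>0 + \<beta>\<^sub>1) E u + \<gamma>\<^sub>0 E u\<^sup>2 + \<gamma>\<^sub>1 (E u)\<^sup>2) ds\<close> (lemma \<open>J_eq\<close>).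

  The mean state solves a deterministic scalar linear equation with rate \<open>c = a\<^sub>0 + a\<^sub>1\<close>. If two
  controls have means differing by \<open>h\<close> on \<open>[t, T]\<close>, the mean states differ by
  \<open>\<integral>\<^sub>t\<^sup>s R(s - v) h(v) dv\<close>, where \<open>R\<close> is the response to a unit impulse of the control, felt at once with
  weight \<open>b\<^sub>0\<close> and again after each delay \<open>-\<xi>\<close> with weight \<open>b\<^sub>1(\<xi>)\<close>; the common past \<open>\<delta>\<close> cancels
  (\<open>mean_state_difference\<close>). Exchanging the order of integration moves the weights of the running
  and terminal gain from the state to the control, so the affine part varies by
  \<open>\<integral> e\<^bsup>-r(s-t)\<^esup> q(s) h(s) ds\<close> with
  \<open>q(s) = (\<lambda>\<^sub>0 - \<lambda>\<^sub>1) e\<^bsup>-r(T-s)\<^esup> R(T - s) + (\<alpha>\<^sub>0 - \<alpha>\<^sub>1) \<integral>\<^sub>s\<^sup>T e\<^bsup>-r(v-s)\<^esup> R(v - s) dv\<close> (\<open>duality\<close>).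

  This \<open>q(s)\<close> is exactly \<open>\<langle>B\<^sup>* a(s), (1, 1)\<rangle>\<close>: the vector \<open>(1, 1)\<close> is an eigenvector of \<open>A\<^sub>0\<close> for the
  eigenvalue \<open>c\<close>, so the matrix exponentials inside \<open>a(s)\<close> collapse to \<open>e\<^bsup>c\<tau>\<^esup>\<close> after pairing with it
  (\<open>B_adj_a_curve\<close>). What is left is a pointwise maximisation of
  \<open>(q - \<beta>\<^sub>0 - \<beta>\<^sub>1) E u - \<gamma>\<^sub>0 E u\<^sup>2 - \<gamma>\<^sub>1 (E u)\<^sup>2\<close>. Since \<open>E u\<^sup>2 \<ge> (E u)\<^sup>2\<close>, randomness only costs, and
  completing the square gives the value \<open>u\<^sup>*\<close> (\<open>J_le_maximiser\<close>).

  As the state is an arbitrarily chosen strong solution, one must also know that for every admissible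
  control a solution exists whose mean is the deterministic one above, and that any other solution
  is indistinguishable from it (\<open>closed_state_strong_solution\<close>, \<open>strong_solution_unique\<close>).\<close>

section \<open>Scalar linear integral equations\<close>

lemma (in pair_sigma_finite) integrable_mult_pair:
  fixes f :: "'a \<Rightarrow> real" and g :: "'b \<Rightarrow> real"
  assumes f: "integrable M1 f" and g: "integrable M2 g"
  shows "integrable (M1 \<Otimes>\<^sub>M M2) (\<lambda>(x, y). f x * g y)"
proof (rule Fubini_integrable)
  note [measurable] = borel_measurable_integrable[OF f] borel_measurable_integrable[OF g]
  show "(\<lambda>(x, y). f x * g y) \<in> borel_measurable (M1 \<Otimes>\<^sub>M M2)" by measurable
  show "integrable M1 (\<lambda>x. LINT y|M2. norm (case (x, y) of (x, y) \<Rightarrow> f x * g y))"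
    using f by (simp add: abs_mult)
  show "AE x in M1. integrable M2 (\<lambda>y. case (x, y) of (x, y) \<Rightarrow> f x * g y)"
    using g by simp
qed

lemma integrable_bounded_mult:
  fixes f g :: "'a \<Rightarrow> real"
  assumes f: "integrable N f" and g: "g \<in> borel_measurable N"
    and C: "\<And>x. x \<in> space N \<Longrightarrow> \<bar>g x\<bar> \<le> C"
  shows "integrable N (\<lambda>x. g x * f x)"
proof (rule Bochner_Integration.integrable_bound)
  show "integrable N (\<lambda>x. C * f x)" using f by simp
  show "(\<lambda>x. g x * f x) \<in> borel_measurable N"
    using borel_measurable_integrable[OF f] g by measurable
  show "AE x in N. norm (g x * f x) \<le> norm (C * f x)"
  proof (rule AE_I2)
    fix x assume "x \<in> space N"
    from mult_right_mono[OF order_trans[OF C[OF this] abs_ge_self] abs_ge_zero, of "f x"]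
    show "norm (g x * f x) \<le> norm (C * f x)" by (simp add: abs_mult)
  qed
qed

lemma set_integrable_bounded_mult:
  fixes f g :: "real \<Rightarrow> real"
  assumes f: "set_integrable lborel A f" and A: "A \<in> sets borel"
    and g: "g \<in> borel_measurable borel" and b: "\<And>v. v \<in> A \<Longrightarrow> \<bar>g v\<bar> \<le> C"
  shows "set_integrable lborel A (\<lambda>v. g v * f v)"
proof -
  have "integrable lborel (\<lambda>v. (indicator A v * g v) * (indicator A v * f v))"
  proof (rule integrable_bounded_mult[where C = "\<bar>C\<bar>"])
    show "integrable lborel (\<lambda>v. indicator A v * f v)" using f by (simp add: set_integrable_def)
    show "(\<lambda>v. indicator A v * g v) \<in> borel_measurable lborel" using A g by measurable
    show "\<bar>indicator A v * g v\<bar> \<le> \<bar>C\<bar>" for v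
      using b[of v] by (auto simp: indicator_def)
  qed
  moreover have "(indicator A v * g v) * (indicator A v * f v) = indicator A v * (g v * f v)" for v
    by (simp add: indicator_def)
  ultimately show ?thesis by (simp add: set_integrable_def)
qed

text \<open>Exchanging \<open>w \<le> v\<close> serves twice: in Duhamel's formula for an input that is merely integrable,
  and to turn a functional of the state into a functional of the control.\<close>
lemma triangle_fubini:
  fixes G :: "real \<Rightarrow> real \<Rightarrow> real" and \<psi> :: "real \<Rightarrow> real"
  assumes \<psi>: "set_integrable lborel {t..s} \<psi>"
    and G: "(\<lambda>(v, w). G v w) \<in> borel_measurable (borel \<Otimes>\<^sub>M borel)"
    and C: "\<And>v w. t \<le> w \<Longrightarrow> w \<le> v \<Longrightarrow> v \<le> s \<Longrightarrow> \<bar>G v w\<bar> \<le> C"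
  shows "set_integrable lborel {t..s} (\<lambda>v. LINT w:{t..v}|lborel. G v w * \<psi> w)"
    and "(LINT v:{t..s}|lborel. LINT w:{t..v}|lborel. G v w * \<psi> w)
       = (LINT w:{t..s}|lborel. (LINT v:{w..s}|lborel. G v w) * \<psi> w)"
proof -
  define F where "F v w = indicator {t..s} v * (indicator {t..v} w * (G v w * \<psi> w))" for v w :: real
  have i\<psi>: "integrable lborel (\<lambda>w. indicator {t..s} w * \<psi> w)"
    using \<psi> by (simp add: set_integrable_def)
  have F_eq: "F v w = indicator {(v, w). t \<le> w \<and> w \<le> v \<and> v \<le> s} (v, w) * G v w * (indicator {t..s} w * \<psi> w)" for v w
    by (auto simp: F_def indicator_def)
  have [measurable]: "(\<lambda>p. G (fst p) (snd p)) \<in> borel_measurable (lborel \<Otimes>\<^sub>M lborel)"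
    using G by (simp add: case_prod_beta' cong: measurable_cong_sets)
  have F_int: "integrable (lborel \<Otimes>\<^sub>M lborel) (\<lambda>(v, w). F v w)"
  proof (rule Bochner_Integration.integrable_bound)
    show "integrable (lborel \<Otimes>\<^sub>M lborel) (\<lambda>(v, w). (C * indicator {t..s} v) * (indicator {t..s} w * \<psi> w))"
      using i\<psi> by (intro lborel_pair.integrable_mult_pair integrable_mult_right integrable_real_indicator)
        (auto simp: emeasure_lborel_Icc_eq)
    note [measurable] = borel_measurable_integrable[OF i\<psi>]
    show "(\<lambda>(v, w). F v w) \<in> borel_measurable (lborel \<Otimes>\<^sub>M lborel)"
      unfolding F_eq case_prod_beta' by measurable
    have "\<bar>F v w\<bar> \<le> \<bar>(C * indicator {t..s} v) * (indicator {t..s} w * \<psi> w)\<bar>" for v w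
    proof (cases "t \<le> w \<and> w \<le> v \<and> v \<le> s")
      case True
      then have "\<bar>G v w * \<psi> w\<bar> \<le> \<bar>C * \<psi> w\<bar>"
        unfolding abs_mult
        by (intro mult_right_mono order_trans[OF C abs_ge_self]) auto
      then show ?thesis using True by (simp add: F_def)
    qed (auto simp: F_def indicator_def)
    then show "AE x in lborel \<Otimes>\<^sub>M lborel. norm (case x of (v, w) \<Rightarrow> F v w)
      \<le> norm (case x of (v, w) \<Rightarrow> C * indicator {t..s} v * (indicator {t..s} w * \<psi> w))"
      by (simp add: case_prod_beta')
  qed
  have in1: "(LINT w|lborel. F v w) = indicator {t..s} v * (LINT w:{t..v}|lborel. G v w * \<psi> w)" for v
    by (simp add: F_def set_lebesgue_integral_def)
  have in2: "(LINT v|lborel. F v w) = indicator {t..s} w * ((LINT v:{w..s}|lborel. G v w) * \<psi> w)" for w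
  proof -
    have "F v w = (indicator {w..s} v * G v w) * (indicator {t..s} w * \<psi> w)" for v
      by (auto simp: F_def indicator_def)
    then show ?thesis by (simp add: set_lebesgue_integral_def)
  qed
  show "set_integrable lborel {t..s} (\<lambda>v. LINT w:{t..v}|lborel. G v w * \<psi> w)"
    using lborel_pair.integrable_fst[OF F_int] by (simp add: in1 set_integrable_def)
  show "(LINT v:{t..s}|lborel. LINT w:{t..v}|lborel. G v w * \<psi> w)
       = (LINT w:{t..s}|lborel. (LINT v:{w..s}|lborel. G v w) * \<psi> w)"
    using lborel_pair.Fubini_integral[OF F_int] by (simp add: in1 in2 set_lebesgue_integral_def)
qed

text \<open>The right-hand side makes \<open>f\<close> differentiable, and then \<open>e\<^bsup>-ks\<^esup> f(s)\<close> has derivative zero. All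
  uniqueness statements about the state and its mean reduce to this one.\<close>
lemma linear_integral_equation_zero:
  fixes f :: "real \<Rightarrow> real"
  assumes f: "continuous_on {t..T} f"
    and eq: "\<And>s. s \<in> {t..T} \<Longrightarrow> f s = (LINT v:{t..s}|lborel. k * f v)"
    and s: "s \<in> {t..T}"
  shows "f s = 0"
proof -
  define I where "I s = integral {t..s} (\<lambda>v. k * f v)" for s
  have kf: "continuous_on {t..T} (\<lambda>v. k * f v)" by (intro continuous_intros f)
  have fI: "f s = I s" if "s \<in> {t..T}" for s
  proof -
    have "set_integrable lborel {t..s} (\<lambda>v. k * f v)"
      unfolding set_integrable_def using that
      by (intro borel_integrable_compact continuous_on_subset[OF kf]) auto
    from trans[OF eq[OF that] set_borel_integral_eq_integral(2)[OF this]]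
    show ?thesis unfolding I_def .
  qed
  have dI: "(I has_real_derivative k * f v) (at v within {t..T})" if "v \<in> {t..T}" for v
    unfolding has_real_derivative_iff_has_vector_derivative I_def
    by (rule integral_has_vector_derivative[OF kf that])
  have "\<exists>c. \<forall>v\<in>{t..T}. exp (- k * v) * I v = c"
  proof (rule has_field_derivative_zero_constant)
    fix v assume v: "v \<in> {t..T}"
    show "((\<lambda>v. exp (- k * v) * I v) has_real_derivative 0) (at v within {t..T})"
      by (rule derivative_eq_intros dI[OF v] refl | simp add: fI[OF v])+
  qed simp
  then obtain c where c: "\<And>v. v \<in> {t..T} \<Longrightarrow> exp (- k * v) * I v = c" by blast
  have "c = 0" using c[of t] s by (simp add: I_def)
  then show ?thesis using c[OF s] fI[OF s] by simp
qed

text \<open>Duhamel's formula for the solution of \<open>y' = k y + \<psi>\<close>, \<open>y(t) = x\<close>.\<close>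
definition linear_flow :: "real \<Rightarrow> real \<Rightarrow> real \<Rightarrow> (real \<Rightarrow> real) \<Rightarrow> real \<Rightarrow> real" where
  "linear_flow k t x \<psi> s = exp (k * (s - t)) * x + (LINT v:{t..s}|lborel. exp (k * (s - v)) * \<psi> v)"

lemma continuous_on_linear_flow:
  assumes \<psi>: "set_integrable lborel {t..T} \<psi>"
  shows "continuous_on {t..T} (linear_flow k t x \<psi>)"
proof -
  have i: "set_integrable lborel {t..T} (\<lambda>v. exp (- k * v) * \<psi> v)"
  proof (rule set_integrable_bounded_mult[OF \<psi>, where C = "exp (\<bar>k\<bar> * (\<bar>t\<bar> + \<bar>T\<bar>))"])
    fix v assume v: "v \<in> {t..T}"
    have "- k * v \<le> \<bar>k\<bar> * \<bar>v\<bar>" by (metis abs_ge_minus_self abs_mult minus_mult_left)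
    also have "\<dots> \<le> \<bar>k\<bar> * (\<bar>t\<bar> + \<bar>T\<bar>)" using v by (intro mult_left_mono) auto
    finally show "\<bar>exp (- k * v)\<bar> \<le> exp (\<bar>k\<bar> * (\<bar>t\<bar> + \<bar>T\<bar>))" by simp
  qed auto
  have eq: "linear_flow k t x \<psi> s = exp (k * s) * (exp (- k * t) * x + integral {t..s} (\<lambda>v. exp (- k * v) * \<psi> v))"
    if "s \<in> {t..T}" for s
  proof -
    have "set_integrable lborel {t..s} (\<lambda>v. exp (- k * v) * \<psi> v)"
      by (rule set_integrable_subset[OF i]) (use that in auto)
    from set_borel_integral_eq_integral(2)[OF this]
    have "integral {t..s} (\<lambda>v. exp (- k * v) * \<psi> v) = (LINT v:{t..s}|lborel. exp (- k * v) * \<psi> v)" by simp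
    moreover have "exp (k * s) * (LINT v:{t..s}|lborel. exp (- k * v) * \<psi> v)
      = (LINT v:{t..s}|lborel. exp (k * (s - v)) * \<psi> v)"
      unfolding set_integral_mult_right[symmetric]
      by (simp add: mult.assoc[symmetric] mult_exp_exp right_diff_distrib)
    moreover have "exp (k * s) * (exp (- k * t) * x) = exp (k * (s - t)) * x"
      by (simp add: mult.assoc[symmetric] mult_exp_exp right_diff_distrib)
    ultimately show ?thesis by (simp only: linear_flow_def distrib_left)
  qed
  have "continuous_on {t..T} (\<lambda>s. exp (k * s) * (exp (- k * t) * x + integral {t..s} (\<lambda>v. exp (- k * v) * \<psi> v)))"
    using set_borel_integral_eq_integral(1)[OF i]
    by (intro continuous_intros indefinite_integral_continuous_1) auto
  then show ?thesis using eq by (subst continuous_on_cong[OF refl eq])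
qed

text \<open>As \<open>\<psi>\<close> is only integrable, \<open>linear_flow\<close> need not be differentiable everywhere. Instead of
  differentiating, integrate \<open>k\<close> times the formula: by \<open>triangle_fubini\<close> the input \<open>\<psi>(w)\<close> then
  occurs with the weight \<open>\<integral>\<^sub>w\<^sup>s k e\<^bsup>k(v-w)\<^esup> dv = e\<^bsup>k(s-w)\<^esup> - 1\<close>.\<close>
lemma linear_flow_equation:
  assumes \<psi>: "set_integrable lborel {t..T} \<psi>" and s: "s \<in> {t..T}"
  shows "linear_flow k t x \<psi> s = x + (LINT v:{t..s}|lborel. k * linear_flow k t x \<psi> v + \<psi> v)"
proof -
  have \<psi>s: "set_integrable lborel {t..s} \<psi>"
    by (rule set_integrable_subset[OF \<psi>]) (use s in auto)
  have bound: "\<bar>k * exp (k * (v - w))\<bar> \<le> \<bar>k\<bar> * exp (\<bar>k\<bar> * (s - t))" if "t \<le> w" "w \<le> v" "v \<le> s" for v w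
  proof -
    have "k * (v - w) \<le> \<bar>k\<bar> * (s - t)" using that by (intro mult_mono) auto
    then show ?thesis by (simp add: abs_mult mult_left_mono)
  qed
  have exp_int: "set_integrable lborel {w..s} (\<lambda>v. k * exp (k * (v - w)))"
    "(LINT v:{w..s}|lborel. k * exp (k * (v - w))) = exp (k * (s - w)) - 1" if "w \<le> s" for w
  proof -
    have c: "continuous_on {w..s} (\<lambda>v. k * exp (k * (v - w)))" by (intro continuous_intros)
    show i: "set_integrable lborel {w..s} (\<lambda>v. k * exp (k * (v - w)))"
      unfolding set_integrable_def by (intro borel_integrable_compact c) auto
    have "((\<lambda>v. k * exp (k * (v - w))) has_integral exp (k * (s - w)) - exp (k * (w - w))) {w..s}"
      by (rule fundamental_theorem_of_calculus[OF that])
        (auto intro!: derivative_eq_intros simp: has_real_derivative_iff_has_vector_derivative[symmetric])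
    then show "(LINT v:{w..s}|lborel. k * exp (k * (v - w))) = exp (k * (s - w)) - 1"
      using integral_unique[of "\<lambda>v. k * exp (k * (v - w))"] unfolding set_borel_integral_eq_integral(2)[OF i] by simp
  qed
  note tri = triangle_fubini[OF \<psi>s, of "\<lambda>v w. k * exp (k * (v - w))", OF _ bound]
  have m: "(\<lambda>(v, w). k * exp (k * (v - w))) \<in> borel_measurable (borel \<Otimes>\<^sub>M borel)" by measurable
  have e\<psi>: "set_integrable lborel {t..s} (\<lambda>w. exp (k * (s - w)) * \<psi> w)"
  proof (rule set_integrable_bounded_mult[OF \<psi>s, where C = "exp (\<bar>k\<bar> * (s - t))"])
    fix w assume w: "w \<in> {t..s}"
    then have "k * (s - w) \<le> \<bar>k\<bar> * (s - t)" by (intro mult_mono) auto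
    then show "\<bar>exp (k * (s - w))\<bar> \<le> exp (\<bar>k\<bar> * (s - t))" by simp
  qed auto
  have flow_scaled: "k * linear_flow k t x \<psi> v = (k * exp (k * (v - t))) * x
           + (LINT w:{t..v}|lborel. (k * exp (k * (v - w))) * \<psi> w)" for v
    unfolding linear_flow_def distrib_left set_integral_mult_right[symmetric]
    by (simp only: mult.assoc)
  have "(LINT v:{t..s}|lborel. k * linear_flow k t x \<psi> v + \<psi> v)
      = (LINT v:{t..s}|lborel. (k * exp (k * (v - t))) * x
           + (LINT w:{t..v}|lborel. (k * exp (k * (v - w))) * \<psi> w) + \<psi> v)"
    by (simp only: flow_scaled)
  also have "\<dots> = (LINT v:{t..s}|lborel. (k * exp (k * (v - t))) * x)
      + (LINT v:{t..s}|lborel. LINT w:{t..v}|lborel. (k * exp (k * (v - w))) * \<psi> w)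
      + (LINT v:{t..s}|lborel. \<psi> v)"
    using exp_int(1)[of t] tri(1)[OF m] \<psi>s s by (simp add: set_integral_add set_integral_mult_left)
  also have "(LINT v:{t..s}|lborel. (k * exp (k * (v - t))) * x) = (exp (k * (s - t)) - 1) * x"
    using exp_int(2)[of t] s by (simp add: set_integral_mult_left)
  also have "(LINT v:{t..s}|lborel. LINT w:{t..v}|lborel. (k * exp (k * (v - w))) * \<psi> w)
      = (LINT w:{t..s}|lborel. (LINT v:{w..s}|lborel. k * exp (k * (v - w))) * \<psi> w)"
    by (rule tri(2)[OF m])
  also have "\<dots> = (LINT w:{t..s}|lborel. exp (k * (s - w)) * \<psi> w - \<psi> w)"
  proof (rule set_lebesgue_integral_cong)
    show "\<forall>w. w \<in> {t..s} \<longrightarrow>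
      (LINT v:{w..s}|lborel. k * exp (k * (v - w))) * \<psi> w = exp (k * (s - w)) * \<psi> w - \<psi> w"
    proof (intro allI impI)
      fix w assume "w \<in> {t..s}"
      then have w: "w \<le> s" by simp
      show "(LINT v:{w..s}|lborel. k * exp (k * (v - w))) * \<psi> w = exp (k * (s - w)) * \<psi> w - \<psi> w"
        by (simp only: exp_int(2)[OF w] left_diff_distrib mult_1_left)
    qed
  qed simp
  also have "\<dots> = (LINT w:{t..s}|lborel. exp (k * (s - w)) * \<psi> w) - (LINT w:{t..s}|lborel. \<psi> w)"
    by (rule set_integral_diff(2)[OF e\<psi> \<psi>s])
  finally show ?thesis by (simp add: linear_flow_def algebra_simps)
qed

lemma linear_flow_cong:
  assumes "\<And>v. t \<le> v \<Longrightarrow> v \<le> s \<Longrightarrow> \<phi> v = \<psi> v"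
  shows "linear_flow k t x \<phi> s = linear_flow k t x \<psi> s"
proof -
  have "(LINT v:{t..s}|lborel. exp (k * (s - v)) * \<phi> v) = (LINT v:{t..s}|lborel. exp (k * (s - v)) * \<psi> v)"
    by (rule set_lebesgue_integral_cong) (use assms in auto)
  then show ?thesis by (simp add: linear_flow_def)
qed

text \<open>Both the input and the evaluation time may depend on the parameter \<open>y\<close>. With \<open>N\<close> the Borel
  line, \<open>F s\<close> or a product this yields measurability in time, adaptedness and joint
  measurability.\<close>
lemma measurable_linear_flow:
  assumes \<psi>: "(\<lambda>p. \<psi> (snd p) (fst p)) \<in> borel_measurable (N \<Otimes>\<^sub>M borel)" and f: "f \<in> borel_measurable N"
  shows "(\<lambda>y. linear_flow k t x (\<lambda>v. \<psi> v y) (f y)) \<in> borel_measurable N"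
proof -
  note [measurable] = f
  have [measurable]: "(\<lambda>p. \<psi> (snd p) (fst p)) \<in> borel_measurable (N \<Otimes>\<^sub>M lborel)"
    using \<psi> by (simp cong: measurable_cong_sets)
  have [measurable]: "(\<lambda>p. indicator {t..f (fst p)} (snd p) :: real) \<in> borel_measurable (N \<Otimes>\<^sub>M lborel)"
    unfolding indicator_def atLeastAtMost_iff by measurable
  show ?thesis
    unfolding linear_flow_def set_lebesgue_integral_def by measurable
qed

section \<open>Weak integrals of curves in \<open>H\<close>\<close>

lemma L2_delay_set_integrable_mult:
  fixes f g :: "real \<Rightarrow> 'b::euclidean_space"
  assumes f: "L2_delay d f" and g: "L2_delay d g"
  shows "set_integrable lborel {-d..0} (\<lambda>\<xi>. norm (f \<xi>) * norm (g \<xi>))"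
  unfolding set_integrable_def
proof (rule Bochner_Integration.integrable_bound)
  show "integrable lborel (\<lambda>\<xi>. indicator {-d..0} \<xi> *\<^sub>R (norm (f \<xi>))\<^sup>2 + indicator {-d..0} \<xi> *\<^sub>R (norm (g \<xi>))\<^sup>2)"
    using f g by (auto simp: L2_delay_def set_integrable_def)
  have [measurable]: "(\<lambda>\<xi>. indicator {-d..0} \<xi> *\<^sub>R f \<xi>) \<in> borel_measurable lborel"
    "(\<lambda>\<xi>. indicator {-d..0} \<xi> *\<^sub>R g \<xi>) \<in> borel_measurable lborel"
    using f g by (auto simp: L2_delay_def set_borel_measurable_def)
  have "(\<lambda>\<xi>. norm (indicator {-d..0} \<xi> *\<^sub>R f \<xi>) * norm (indicator {-d..0} \<xi> *\<^sub>R g \<xi>)) \<in> borel_measurable lborel"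
    by measurable
  also have "(\<lambda>\<xi>. norm (indicator {-d..0} \<xi> *\<^sub>R f \<xi>) * norm (indicator {-d..0} \<xi> *\<^sub>R g \<xi>))
    = (\<lambda>\<xi>. indicator {-d..0} \<xi> *\<^sub>R (norm (f \<xi>) * norm (g \<xi>)))"
    by (auto simp: indicator_def)
  finally show "(\<lambda>\<xi>. indicator {-d..0} \<xi> *\<^sub>R (norm (f \<xi>) * norm (g \<xi>))) \<in> borel_measurable lborel" .
  have "a * b \<le> a\<^sup>2 + b\<^sup>2" if "0 \<le> a" "0 \<le> b" for a b :: real
    using sum_squares_bound[of a b] that mult_nonneg_nonneg[OF that] by linarith
  then show "AE \<xi> in lborel. norm (indicator {-d..0} \<xi> *\<^sub>R (norm (f \<xi>) * norm (g \<xi>)))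
    \<le> norm (indicator {-d..0} \<xi> *\<^sub>R (norm (f \<xi>))\<^sup>2 + indicator {-d..0} \<xi> *\<^sub>R (norm (g \<xi>))\<^sup>2)"
    by (simp add: indicator_def)
qed

lemma L2_delay_bounded:
  fixes f :: "real \<Rightarrow> 'b::euclidean_space"
  assumes f: "f \<in> borel_measurable borel" and C: "\<And>\<xi>. \<xi> \<in> {-d..0} \<Longrightarrow> norm (f \<xi>) \<le> C"
  shows "L2_delay d f"
  unfolding L2_delay_def set_borel_measurable_def set_integrable_def
proof safe
  note [measurable] = f
  show "(\<lambda>\<xi>. indicator {-d..0} \<xi> *\<^sub>R f \<xi>) \<in> borel_measurable lborel" by measurable
  show "integrable lborel (\<lambda>\<xi>. indicator {-d..0} \<xi> *\<^sub>R (norm (f \<xi>))\<^sup>2)"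
  proof (rule Bochner_Integration.integrable_bound)
    show "integrable lborel (\<lambda>\<xi>. C\<^sup>2 * indicator {-d..0} \<xi>)"
      by (intro integrable_mult_right integrable_real_indicator) (auto simp: emeasure_lborel_Icc_eq)
    show "(\<lambda>\<xi>. indicator {-d..0} \<xi> *\<^sub>R (norm (f \<xi>))\<^sup>2) \<in> borel_measurable lborel" by measurable
    show "AE \<xi> in lborel. norm (indicator {-d..0} \<xi> *\<^sub>R (norm (f \<xi>))\<^sup>2) \<le> norm (C\<^sup>2 * indicator {-d..0} \<xi>)"
      using C by (auto simp: indicator_def intro!: power_mono)
  qed
qed

lemma L2_delay_set_integrable:
  assumes "L2_delay d (f :: real \<Rightarrow> 'b::euclidean_space)"
  shows "set_integrable lborel {-d..0} f"
proof -
  \<comment> \<open>a constant function of norm \<open>1\<close>\<close>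
  have "L2_delay d (\<lambda>_. SOME b::'b. b \<in> Basis)"
    by (rule L2_delay_bounded[where C = 1]) (simp_all add: norm_some_Basis)
  from L2_delay_set_integrable_mult[OF assms this]
  have "set_integrable lborel {-d..0} (\<lambda>\<xi>. norm (f \<xi>))" by (simp add: norm_some_Basis)
  then have "integrable lborel (\<lambda>\<xi>. norm (indicator {-d..0} \<xi> *\<^sub>R f \<xi>))"
    by (simp add: set_integrable_def)
  then show ?thesis
    using assms unfolding set_integrable_def L2_delay_def set_borel_measurable_def
    by (subst (asm) integrable_norm_iff) auto
qed

lemma L2_delay_inner:
  fixes f g :: "real \<Rightarrow> 'b::euclidean_space"
  assumes f: "L2_delay d f" and g: "L2_delay d g"
  shows "set_integrable lborel {-d..0} (\<lambda>\<xi>. f \<xi> \<bullet> g \<xi>)"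
  unfolding set_integrable_def
proof (rule Bochner_Integration.integrable_bound)
  show "integrable lborel (\<lambda>\<xi>. indicator {-d..0} \<xi> *\<^sub>R (norm (f \<xi>) * norm (g \<xi>)))"
    using L2_delay_set_integrable_mult[OF f g] by (simp add: set_integrable_def)
  have [measurable]: "(\<lambda>\<xi>. indicator {-d..0} \<xi> *\<^sub>R f \<xi>) \<in> borel_measurable lborel"
    "(\<lambda>\<xi>. indicator {-d..0} \<xi> *\<^sub>R g \<xi>) \<in> borel_measurable lborel"
    using f g by (auto simp: L2_delay_def set_borel_measurable_def)
  have "(\<lambda>\<xi>. (indicator {-d..0} \<xi> *\<^sub>R f \<xi>) \<bullet> (indicator {-d..0} \<xi> *\<^sub>R g \<xi>)) \<in> borel_measurable lborel"
    by measurable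
  also have "(\<lambda>\<xi>. (indicator {-d..0} \<xi> *\<^sub>R f \<xi>) \<bullet> (indicator {-d..0} \<xi> *\<^sub>R g \<xi>))
    = (\<lambda>\<xi>. indicator {-d..0} \<xi> *\<^sub>R (f \<xi> \<bullet> g \<xi>))"
    by (auto simp: indicator_def)
  finally show "(\<lambda>\<xi>. indicator {-d..0} \<xi> *\<^sub>R (f \<xi> \<bullet> g \<xi>)) \<in> borel_measurable lborel" .
  show "AE \<xi> in lborel. norm (indicator {-d..0} \<xi> *\<^sub>R (f \<xi> \<bullet> g \<xi>))
    \<le> norm (indicator {-d..0} \<xi> *\<^sub>R (norm (f \<xi>) * norm (g \<xi>)))"
    by (auto simp: indicator_def Cauchy_Schwarz_ineq2)
qed

lemma L2_delay_scaleR_vector: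
  assumes "L2_delay d b"
  shows "L2_delay d (\<lambda>\<xi>. b \<xi> *\<^sub>R (w :: 'b::euclidean_space))"
proof -
  have "set_integrable lborel {-d..0} (\<lambda>\<xi>. (norm w)\<^sup>2 * (norm (b \<xi>))\<^sup>2)"
    using assms by (auto simp: L2_delay_def)
  moreover have [measurable]: "(\<lambda>\<xi>. indicator {-d..0} \<xi> *\<^sub>R b \<xi>) \<in> borel_measurable lborel"
    using assms by (simp add: L2_delay_def set_borel_measurable_def)
  have "(\<lambda>\<xi>. (indicator {-d..0} \<xi> *\<^sub>R b \<xi>) *\<^sub>R w) \<in> borel_measurable lborel"
    by measurable
  ultimately show ?thesis
    by (simp add: L2_delay_def set_borel_measurable_def power_mult_distrib mult.commute)
qed

lemma L2_delay_add:
  fixes f g :: "real \<Rightarrow> 'b::euclidean_space"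
  assumes f: "L2_delay d f" and g: "L2_delay d g"
  shows "L2_delay d (\<lambda>\<xi>. f \<xi> + g \<xi>)"
proof -
  have [measurable]: "(\<lambda>\<xi>. indicator {-d..0} \<xi> *\<^sub>R f \<xi>) \<in> borel_measurable lborel"
    "(\<lambda>\<xi>. indicator {-d..0} \<xi> *\<^sub>R g \<xi>) \<in> borel_measurable lborel"
    using f g by (auto simp: L2_delay_def set_borel_measurable_def)
  have "(\<lambda>\<xi>. indicator {-d..0} \<xi> *\<^sub>R f \<xi> + indicator {-d..0} \<xi> *\<^sub>R g \<xi>) \<in> borel_measurable lborel"
    by measurable
  moreover have "set_integrable lborel {-d..0} (\<lambda>\<xi>. f \<xi> \<bullet> f \<xi> + 2 * (f \<xi> \<bullet> g \<xi>) + g \<xi> \<bullet> g \<xi>)"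
    using L2_delay_inner[OF f f] L2_delay_inner[OF f g] L2_delay_inner[OF g g]
    by (intro set_integral_add) auto
  ultimately show ?thesis
    unfolding L2_delay_def set_borel_measurable_def power2_norm_eq_inner
    by (simp add: inner_add_left inner_add_right scaleR_add_right inner_commute[of "g _" "f _"] algebra_simps)
qed

lemma H_inner_add:
  assumes "y \<in> H_space d" "z \<in> H_space d" "k \<in> H_space d"
  shows "H_inner d (H_add y z) k = H_inner d y k + H_inner d z k"
proof -
  have "set_integrable lborel {-d..0} (\<lambda>\<xi>. snd y \<xi> \<bullet> snd k \<xi>)"
    "set_integrable lborel {-d..0} (\<lambda>\<xi>. snd z \<xi> \<bullet> snd k \<xi>)"
    using assms by (auto simp: H_space_def intro: L2_delay_inner)
  then show ?thesis
    by (simp add: H_inner_def H_add_def inner_add_left set_integral_add)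
qed

lemma H_add_H_space: "y \<in> H_space d \<Longrightarrow> z \<in> H_space d \<Longrightarrow> H_add y z \<in> H_space d"
  by (simp add: H_space_def H_add_def L2_delay_add)

text \<open>The integral entering the adjoint curve is selected by a choice operator, so it says nothing
  until some integral is known to exist. Integrating both components separately gives one:
  paired with a test element, the second component becomes a double integral over \<open>v\<close> and \<open>\<xi>\<close>,
  whose order can be exchanged because \<open>Y\<close> is bounded.\<close>
lemma has_H_integral_bounded:
  fixes Y :: "real \<Rightarrow> H"
  assumes m1[measurable]: "(\<lambda>v. fst (Y v)) \<in> borel_measurable borel"
    and m2: "(\<lambda>(v, \<xi>). snd (Y v) \<xi>) \<in> borel_measurable (borel \<Otimes>\<^sub>M borel)"
    and C1: "\<And>v. v \<in> {s..t} \<Longrightarrow> norm (fst (Y v)) \<le> C"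
    and C2: "\<And>v \<xi>. v \<in> {s..t} \<Longrightarrow> \<xi> \<in> {-d..0} \<Longrightarrow> norm (snd (Y v) \<xi>) \<le> C"
  shows "has_H_integral d Y s t
    (LINT v:{s..t}|lborel. fst (Y v), \<lambda>\<xi>. LINT v:{s..t}|lborel. snd (Y v) \<xi>)" (is "has_H_integral d Y s t ?h")
proof -
  have fin: "integrable lborel (\<lambda>v. C * indicator {s..t} v)"
    by (intro integrable_mult_right integrable_real_indicator) (auto simp: emeasure_lborel_Icc_eq)
  have [measurable]: "(\<lambda>p. snd (Y (fst p)) (snd p)) \<in> borel_measurable (borel \<Otimes>\<^sub>M borel)"
    using m2 by (simp add: case_prod_beta')
  have i1: "set_integrable lborel {s..t} (\<lambda>v. fst (Y v))"
    unfolding set_integrable_def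
    by (rule Bochner_Integration.integrable_bound[OF fin])
       (use C1 in \<open>auto simp: indicator_def intro: order_trans[OF _ abs_ge_self]\<close>)
  have i2: "set_integrable lborel {s..t} (\<lambda>v. snd (Y v) \<xi>)" if "\<xi> \<in> {-d..0}" for \<xi>
    unfolding set_integrable_def
  proof (rule Bochner_Integration.integrable_bound[OF fin])
    have [measurable]: "(\<lambda>v. snd (Y v) \<xi>) \<in> borel_measurable borel"
    proof -
      have "(\<lambda>v. (v, \<xi>)) \<in> borel \<rightarrow>\<^sub>M (borel \<Otimes>\<^sub>M borel)" by measurable
      from measurable_compose[OF this m2] show ?thesis by simp
    qed
    show "(\<lambda>v. indicator {s..t} v *\<^sub>R snd (Y v) \<xi>) \<in> borel_measurable lborel" by measurable
    show "AE v in lborel. norm (indicator {s..t} v *\<^sub>R snd (Y v) \<xi>) \<le> norm (C * indicator {s..t} v)"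
      using C2[OF _ that] by (auto simp: indicator_def intro: order_trans[OF _ abs_ge_self])
  qed
  have snd_bound: "norm (LINT v:{s..t}|lborel. snd (Y v) \<xi>) \<le> C * measure lborel {s..t}" if "\<xi> \<in> {-d..0}" for \<xi>
  proof -
    have "norm (LINT v:{s..t}|lborel. snd (Y v) \<xi>) \<le> (LINT v|lborel. C * indicator {s..t} v)"
      unfolding set_lebesgue_integral_def
      by (rule Bochner_Integration.integral_norm_bound_integral[OF i2[OF that, unfolded set_integrable_def] fin])
         (use C2[OF _ that] in \<open>auto simp: indicator_def\<close>)
    then show ?thesis by simp
  qed
  have h: "?h \<in> H_space d"
    unfolding H_space_def mem_Collect_eq snd_conv
  proof (rule L2_delay_bounded[OF _ snd_bound])
    have [measurable]: "(\<lambda>p. snd (Y (snd p)) (fst p)) \<in> borel_measurable (borel \<Otimes>\<^sub>M borel)"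
      using measurable_compose[OF measurable_pair_swap' m2] by (simp add: case_prod_beta')
    show "(\<lambda>\<xi>. LINT v:{s..t}|lborel. snd (Y v) \<xi>) \<in> borel_measurable borel"
      unfolding set_lebesgue_integral_def by measurable
  qed
  moreover have "set_integrable lborel {s..t} (\<lambda>v. H_inner d (Y v) k)
      \<and> H_inner d ?h k = (LINT v:{s..t}|lborel. H_inner d (Y v) k)" if k: "k \<in> H_space d" for k
  proof -
    have k2: "integrable lborel (\<lambda>\<xi>. indicator {-d..0} \<xi> *\<^sub>R snd k \<xi>)"
      using L2_delay_set_integrable k by (auto simp: H_space_def set_integrable_def)
    note [measurable] = borel_measurable_integrable[OF k2]
    define F where "F v \<xi> = indicator {s..t} v * (indicator {-d..0} \<xi> * (snd (Y v) \<xi> \<bullet> snd k \<xi>))" for v \<xi> :: real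
    have F_int: "integrable (lborel \<Otimes>\<^sub>M lborel) (\<lambda>(v, \<xi>). F v \<xi>)"
    proof (rule Bochner_Integration.integrable_bound)
      show "integrable (lborel \<Otimes>\<^sub>M lborel) (\<lambda>(v, \<xi>). (C * indicator {s..t} v) * norm (indicator {-d..0} \<xi> *\<^sub>R snd k \<xi>))"
        using k2 fin by (intro lborel_pair.integrable_mult_pair integrable_norm)
      have F_eq: "F v \<xi> = indicator {s..t} v * (snd (Y v) \<xi> \<bullet> (indicator {-d..0} \<xi> *\<^sub>R snd k \<xi>))" for v \<xi>
        by (simp add: F_def)
      show "(\<lambda>(v, \<xi>). F v \<xi>) \<in> borel_measurable (lborel \<Otimes>\<^sub>M lborel)"
        unfolding F_eq case_prod_beta' by measurable
      have "\<bar>F v \<xi>\<bar> \<le> \<bar>(C * indicator {s..t} v) * norm (indicator {-d..0} \<xi> *\<^sub>R snd k \<xi>)\<bar>" for v \<xi>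
      proof (cases "v \<in> {s..t} \<and> \<xi> \<in> {-d..0}")
        case True
        then have "\<bar>snd (Y v) \<xi> \<bullet> snd k \<xi>\<bar> \<le> \<bar>C\<bar> * norm (snd k \<xi>)"
          by (intro order_trans[OF Cauchy_Schwarz_ineq2] mult_right_mono order_trans[OF C2 abs_ge_self]) auto
        then show ?thesis using True by (simp add: F_def abs_mult)
      qed (auto simp: F_def)
      then show "AE p in lborel \<Otimes>\<^sub>M lborel. norm (case p of (v, \<xi>) \<Rightarrow> F v \<xi>)
        \<le> norm (case p of (v, \<xi>) \<Rightarrow> (C * indicator {s..t} v) * norm (indicator {-d..0} \<xi> *\<^sub>R snd k \<xi>))"
        by (simp add: case_prod_beta')
    qed
    have in1: "(LINT \<xi>|lborel. F v \<xi>) = indicator {s..t} v * (LINT \<xi>:{-d..0}|lborel. snd (Y v) \<xi> \<bullet> snd k \<xi>)" for v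
      by (simp add: F_def set_lebesgue_integral_def)
    have in2: "(LINT v|lborel. F v \<xi>) = indicator {-d..0} \<xi> * ((LINT v:{s..t}|lborel. snd (Y v) \<xi>) \<bullet> snd k \<xi>)" for \<xi>
    proof (cases "\<xi> \<in> {-d..0}")
      case True
      have "(LINT v|lborel. F v \<xi>) = (LINT v|lborel. (indicator {s..t} v *\<^sub>R snd (Y v) \<xi>) \<bullet> snd k \<xi>)"
        using True by (simp add: F_def)
      also have "\<dots> = (LINT v:{s..t}|lborel. snd (Y v) \<xi>) \<bullet> snd k \<xi>"
        unfolding set_lebesgue_integral_def
        by (rule integral_inner_left) (use i2[OF True] in \<open>simp add: set_integrable_def\<close>)
      finally show ?thesis using True by simp
    qed (simp add: F_def)
    have s1: "set_integrable lborel {s..t} (\<lambda>v. fst (Y v) \<bullet> fst k)"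
      and e1: "(LINT v:{s..t}|lborel. fst (Y v) \<bullet> fst k) = (LINT v:{s..t}|lborel. fst (Y v)) \<bullet> fst k"
    proof -
      have "integrable lborel (\<lambda>v. (indicator {s..t} v *\<^sub>R fst (Y v)) \<bullet> fst k)"
        using i1 by (intro integrable_inner_left) (simp add: set_integrable_def)
      then show "set_integrable lborel {s..t} (\<lambda>v. fst (Y v) \<bullet> fst k)"
        by (simp add: set_integrable_def)
      have "(LINT v|lborel. (indicator {s..t} v *\<^sub>R fst (Y v)) \<bullet> fst k) = (LINT v:{s..t}|lborel. fst (Y v)) \<bullet> fst k"
        unfolding set_lebesgue_integral_def
        by (rule integral_inner_left) (use i1 in \<open>simp add: set_integrable_def\<close>)
      then show "(LINT v:{s..t}|lborel. fst (Y v) \<bullet> fst k) = (LINT v:{s..t}|lborel. fst (Y v)) \<bullet> fst k"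
        by (simp add: set_lebesgue_integral_def)
    qed
    have s2: "set_integrable lborel {s..t} (\<lambda>v. LINT \<xi>:{-d..0}|lborel. snd (Y v) \<xi> \<bullet> snd k \<xi>)"
      using lborel_pair.integrable_fst[OF F_int] by (simp add: in1 set_integrable_def)
    have e2: "(LINT v:{s..t}|lborel. LINT \<xi>:{-d..0}|lborel. snd (Y v) \<xi> \<bullet> snd k \<xi>)
      = (LINT \<xi>:{-d..0}|lborel. (LINT v:{s..t}|lborel. snd (Y v) \<xi>) \<bullet> snd k \<xi>)"
      using lborel_pair.Fubini_integral[OF F_int] unfolding in1 in2 by (simp add: set_lebesgue_integral_def)
    show ?thesis
      unfolding H_inner_def fst_conv snd_conv
      using set_integral_add[OF s1 s2] e1 e2 by simp
  qed
  ultimately show ?thesis by (simp add: has_H_integral_def)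
qed

section \<open>The adjoint curve\<close>

text \<open>\<open>e\<^bsup>\<tau>A\<^sub>0\<^sup>*\<^esup> y\<close> in closed form, from the spectral decomposition of the triangular matrix \<open>A\<^sub>0\<^sup>*\<close>.
  The same formula holds for \<open>a\<^sub>1 = 0\<close>, when the two eigenvalues coincide.\<close>
definition expA :: "lq_data \<Rightarrow> real^2 \<Rightarrow> real \<Rightarrow> real^2" where
  "expA P y \<tau> = exp (\<tau> * a\<^sub>0 P) *\<^sub>R vector [y$1, - y$1] + exp (\<tau> * (a\<^sub>0 P + a\<^sub>1 P)) *\<^sub>R vector [0, y$1 + y$2]"

text \<open>With \<open>M1\<close>, \<open>M2\<close> below one has \<open>M1 + M2 = 1\<close>, \<open>A\<^sub>0\<^sup>* M1 = a\<^sub>0 M1\<close> and \<open>A\<^sub>0\<^sup>* M2 = (a\<^sub>0 + a\<^sub>1) M2\<close>, so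
  every power of \<open>A\<^sub>0\<^sup>*\<close>, and hence the exponential, is a combination of \<open>M1\<close> and \<open>M2\<close>.\<close>
lemma mat_exp_transpose_A0: "mat_exp (\<tau> *\<^sub>R transpose (A\<^sub>0 P)) *v y = expA P y \<tau>"
proof -
  define M1 M2 :: "real^2^2" where "M1 = vector [vector [1, 0], vector [-1, 0]]"
    and "M2 = vector [vector [0, 0], vector [1, 1]]"
  define p q where "p = \<tau> * a\<^sub>0 P" and "q = \<tau> * (a\<^sub>0 P + a\<^sub>1 P)"
  let ?A = "\<tau> *\<^sub>R transpose (A\<^sub>0 P)"
  have pow: "((**) ?A ^^ n) (mat 1) = p ^ n *\<^sub>R M1 + q ^ n *\<^sub>R M2" for n
  proof (induction n)
    case 0
    show ?case by (simp add: M1_def M2_def vec_eq_iff forall_2 mat_def)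
  next
    case (Suc n)
    have "?A ** (x *\<^sub>R M1 + z *\<^sub>R M2) = (p * x) *\<^sub>R M1 + (q * z) *\<^sub>R M2" for x z
      by (simp add: M1_def M2_def p_def q_def vec_eq_iff forall_2 matrix_matrix_mult_def sum_2
          A\<^sub>0_def transpose_def algebra_simps)
    then show ?case using Suc by simp
  qed
  have "(\<lambda>n. (p ^ n /\<^sub>R fact n) *\<^sub>R M1 + (q ^ n /\<^sub>R fact n) *\<^sub>R M2) sums (exp p *\<^sub>R M1 + exp q *\<^sub>R M2)"
    by (intro sums_add sums_scaleR_left exp_converges)
  then have "(\<lambda>n. (1 / fact n) *\<^sub>R ((**) ?A ^^ n) (mat 1)) sums (exp p *\<^sub>R M1 + exp q *\<^sub>R M2)"
    by (simp add: pow scaleR_add_right divide_inverse mult.commute)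
  then have "mat_exp ?A = exp p *\<^sub>R M1 + exp q *\<^sub>R M2"
    unfolding mat_exp_def by (rule sums_unique[symmetric])
  then have "mat_exp ?A *v y = exp p *\<^sub>R (M1 *v y) + exp q *\<^sub>R (M2 *v y)"
    by (simp add: matrix_vector_mult_add_rdistrib scaleR_matrix_vector_assoc)
  moreover have "M1 *v y = vector [y$1, - y$1]" "M2 *v y = vector [0, y$1 + y$2]"
    by (simp_all add: M1_def M2_def vec_eq_iff forall_2 matrix_vector_mult_def sum_2)
  ultimately show ?thesis by (simp add: expA_def p_def q_def)
qed

lemma continuous_on_expA[continuous_intros]:
  assumes "continuous_on S f" shows "continuous_on S (\<lambda>x. expA P y (f x))"
  unfolding expA_def by (intro continuous_intros assms)

lemma measurable_expA[measurable]: "expA P y \<in> borel_measurable borel"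
  by (rule borel_measurable_continuous_onI) (rule continuous_on_expA, rule continuous_on_id)

text \<open>\<open>(1, 1)\<close> is an eigenvector of \<open>A\<^sub>0\<close> for \<open>a\<^sub>0 + a\<^sub>1\<close>; this reduces the matrix problem to a scalar
  one.\<close>
lemma expA_inner_ones: "expA P y \<tau> \<bullet> vector [1, 1] = exp ((a\<^sub>0 P + a\<^sub>1 P) * \<tau>) * (y$1 + y$2)"
  by (simp add: expA_def inner_vec_def sum_2 mult.commute)

text \<open>Green's function of \<open>y' = (a\<^sub>0 + a\<^sub>1) y\<close>, the equation of the mean state.\<close>
definition fundamental :: "lq_data \<Rightarrow> real \<Rightarrow> real" where
  "fundamental P \<tau> = indicator {0..} \<tau> * exp ((a\<^sub>0 P + a\<^sub>1 P) * \<tau>)"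

text \<open>The mean state at time \<open>\<tau>\<close> after a unit impulse of the control: \<open>fundamental P (\<tau> + \<xi>)\<close> is the
  contribution of the impulse once it has been delayed by \<open>-\<xi>\<close>.\<close>
definition response :: "lq_data \<Rightarrow> real \<Rightarrow> real" where
  "response P \<tau> = b\<^sub>0 P * fundamental P \<tau>
     + (LINT \<xi>:{-delay P..0}|lborel. b\<^sub>1 P \<xi> * fundamental P (\<tau> + \<xi>))"

text \<open>The discounted effect of a unit impulse at time \<open>s\<close> on all later running gain and on the
  terminal gain.\<close>
definition costate :: "lq_data \<Rightarrow> real \<Rightarrow> real" where
  "costate P s = (l\<^sub>0 P - l\<^sub>1 P) * (exp (- rate P * (horizon P - s)) * response P (horizon P - s))
     + (\<alpha>\<^sub>0 P - \<alpha>\<^sub>1 P) * (LINT v:{s..horizon P}|lborel. exp (- rate P * (v - s)) * response P (v - s))"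

lemma disc_adj_semigroup_eq:
  "disc_adj_semigroup P \<tau> (y, \<lambda>_. 0) =
     (exp (- rate P * \<tau>) *\<^sub>R expA P y \<tau>,
      \<lambda>\<xi>. exp (- rate P * \<tau>) *\<^sub>R (indicator {-\<tau>..0} \<xi> *\<^sub>R expA P y (\<xi> + \<tau>)))"
  by (simp add: disc_adj_semigroup_def adj_semigroup_def H_scale_def mat_exp_transpose_A0)

lemma disc_adj_semigroup_bounded:
  obtains C where "\<And>\<tau>. \<tau> \<in> {0..T} \<Longrightarrow> norm (fst (disc_adj_semigroup P \<tau> (y, \<lambda>_. 0))) \<le> C"
    and "\<And>\<tau> \<xi>. \<tau> \<in> {0..T} \<Longrightarrow> norm (snd (disc_adj_semigroup P \<tau> (y, \<lambda>_. 0)) \<xi>) \<le> C"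
proof -
  have bdd: "\<exists>B\<ge>0. \<forall>\<tau>\<in>{0..T}. norm (f \<tau>) \<le> B" if "continuous_on {0..T} f" for f :: "real \<Rightarrow> 'b::real_normed_vector"
  proof -
    have "bounded (f ` {0..T})" by (intro compact_imp_bounded compact_continuous_image that) simp
    then show ?thesis by (auto simp: bounded_pos intro: less_imp_le)
  qed
  obtain B where B: "0 \<le> B" "\<And>\<tau>. \<tau> \<in> {0..T} \<Longrightarrow> norm (exp (- rate P * \<tau>)) \<le> B"
    using bdd[of "\<lambda>\<tau>. exp (- rate P * \<tau>)", OF continuous_on_exp[OF continuous_on_mult_left[OF continuous_on_id]]]
    by blast
  obtain D where D: "0 \<le> D" "\<And>\<tau>. \<tau> \<in> {0..T} \<Longrightarrow> norm (expA P y \<tau>) \<le> D"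
    using bdd[of "expA P y", OF continuous_on_expA[OF continuous_on_id]] by blast
  show ?thesis
  proof
    fix \<tau> assume \<tau>: "\<tau> \<in> {0..T}"
    show "norm (fst (disc_adj_semigroup P \<tau> (y, \<lambda>_. 0))) \<le> B * D"
      using B(2)[OF \<tau>] D(2)[OF \<tau>] B(1) D(1) by (auto simp: disc_adj_semigroup_eq intro!: mult_mono)
    fix \<xi>
    show "norm (snd (disc_adj_semigroup P \<tau> (y, \<lambda>_. 0)) \<xi>) \<le> B * D"
    proof (cases "\<xi> \<in> {-\<tau>..0}")
      case True
      then have "norm (expA P y (\<xi> + \<tau>)) \<le> D" using \<tau> by (intro D(2)) auto
      then show ?thesis using True B(2)[OF \<tau>] B(1) D(1) by (auto simp: disc_adj_semigroup_eq intro!: mult_mono)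
    qed (use B(1) D(1) in \<open>simp add: disc_adj_semigroup_eq\<close>)
  qed
qed

lemma disc_adj_semigroup_H_space:
  assumes "0 \<le> \<tau>" shows "disc_adj_semigroup P \<tau> (y, \<lambda>_. 0) \<in> H_space d"
proof -
  obtain C where C: "\<And>t \<xi>. t \<in> {0..\<tau>} \<Longrightarrow> norm (snd (disc_adj_semigroup P t (y, \<lambda>_. 0)) \<xi>) \<le> C"
    by (rule disc_adj_semigroup_bounded[of \<tau> P y]) blast
  have "snd (disc_adj_semigroup P \<tau> (y, \<lambda>_. 0)) \<in> borel_measurable borel"
    unfolding disc_adj_semigroup_eq snd_conv by measurable
  then show ?thesis
    unfolding H_space_def mem_Collect_eq by (rule L2_delay_bounded) (use assms in \<open>auto intro: C\<close>)
qed

text \<open>The second argument represents the functional \<open>y \<mapsto> \<langle>B\<^sup>* y, (1, 1)\<rangle>\<close>. The cut-off to \<open>[-\<tau>, 0]\<close> in the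
  semigroup is the cut-off \<open>\<tau> + \<xi> \<ge> 0\<close> in \<open>fundamental\<close>.\<close>
lemma disc_adj_semigroup_inner:
  assumes "0 \<le> \<tau>"
  shows "H_inner (delay P) (disc_adj_semigroup P \<tau> (y, \<lambda>_. 0)) (b\<^sub>0 P *\<^sub>R vector [1, 1], \<lambda>\<xi>. b\<^sub>1 P \<xi> *\<^sub>R vector [1, 1])
    = (y$1 + y$2) * (exp (- rate P * \<tau>) * response P \<tau>)"
proof -
  have "(LINT \<xi>:{-delay P..0}|lborel. (exp (- rate P * \<tau>) *\<^sub>R (indicator {-\<tau>..0} \<xi> *\<^sub>R expA P y (\<xi> + \<tau>))) \<bullet> (b\<^sub>1 P \<xi> *\<^sub>R vector [1, 1]))
    = (LINT \<xi>:{-delay P..0}|lborel. ((y$1 + y$2) * exp (- rate P * \<tau>)) * (b\<^sub>1 P \<xi> * fundamental P (\<tau> + \<xi>)))"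
    by (rule set_lebesgue_integral_cong)
       (auto simp: expA_inner_ones fundamental_def indicator_def add.commute)
  also have "\<dots> = ((y$1 + y$2) * exp (- rate P * \<tau>)) * (LINT \<xi>:{-delay P..0}|lborel. b\<^sub>1 P \<xi> * fundamental P (\<tau> + \<xi>))"
    by (rule set_integral_mult_right)
  finally show ?thesis
    using assms by (simp add: H_inner_def disc_adj_semigroup_eq response_def expA_inner_ones
        fundamental_def algebra_simps)
qed

lemma B_adj_inner:
  assumes b: "L2_delay (delay P) (b\<^sub>1 P)" and y: "y \<in> H_space (delay P)"
  shows "B_adj P y \<bullet> w = H_inner (delay P) y (b\<^sub>0 P *\<^sub>R w, \<lambda>\<xi>. b\<^sub>1 P \<xi> *\<^sub>R w)"
proof -
  have y2: "L2_delay (delay P) (snd y)" using y by (simp add: H_space_def)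
  have "integrable lborel (\<lambda>\<xi>. indicator {-delay P..0} \<xi> *\<^sub>R (b\<^sub>1 P \<xi> *\<^sub>R snd y \<xi>))"
  proof (rule Bochner_Integration.integrable_bound)
    \<comment> \<open>multiplying \<open>b\<^sub>1\<close> by a unit vector only adjusts its type\<close>
    have "L2_delay (delay P) (\<lambda>\<xi>. b\<^sub>1 P \<xi> *\<^sub>R (vector [1, 0] :: real^2))"
      by (rule L2_delay_scaleR_vector[OF b])
    from L2_delay_set_integrable_mult[OF this y2]
    show "integrable lborel (\<lambda>\<xi>. indicator {-delay P..0} \<xi> *\<^sub>R (norm (b\<^sub>1 P \<xi> *\<^sub>R (vector [1, 0] :: real^2)) * norm (snd y \<xi>)))"
      by (simp add: set_integrable_def)
    have [measurable]: "(\<lambda>\<xi>. indicator {-delay P..0} \<xi> *\<^sub>R b\<^sub>1 P \<xi>) \<in> borel_measurable lborel"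
      "(\<lambda>\<xi>. indicator {-delay P..0} \<xi> *\<^sub>R snd y \<xi>) \<in> borel_measurable lborel"
      using b y2 by (auto simp: L2_delay_def set_borel_measurable_def)
    have "(\<lambda>\<xi>. (indicator {-delay P..0} \<xi> *\<^sub>R b\<^sub>1 P \<xi>) *\<^sub>R (indicator {-delay P..0} \<xi> *\<^sub>R snd y \<xi>)) \<in> borel_measurable lborel"
      by measurable
    also have "(\<lambda>\<xi>. (indicator {-delay P..0} \<xi> *\<^sub>R b\<^sub>1 P \<xi>) *\<^sub>R (indicator {-delay P..0} \<xi> *\<^sub>R snd y \<xi>))
       = (\<lambda>\<xi>. indicator {-delay P..0} \<xi> *\<^sub>R (b\<^sub>1 P \<xi> *\<^sub>R snd y \<xi>))"
      by (auto simp: indicator_def)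
    finally show "(\<lambda>\<xi>. indicator {-delay P..0} \<xi> *\<^sub>R (b\<^sub>1 P \<xi> *\<^sub>R snd y \<xi>)) \<in> borel_measurable lborel" .
    have "norm (vector [1, 0] :: real^2) = 1" by (simp add: norm_vec_def L2_set_def sum_2)
    then show "AE \<xi> in lborel. norm (indicator {-delay P..0} \<xi> *\<^sub>R (b\<^sub>1 P \<xi> *\<^sub>R snd y \<xi>))
      \<le> norm (indicator {-delay P..0} \<xi> *\<^sub>R (norm (b\<^sub>1 P \<xi> *\<^sub>R (vector [1, 0] :: real^2)) * norm (snd y \<xi>)))"
      by (simp add: abs_mult)
  qed
  from integral_inner_left[OF this, of w] show ?thesis
    by (simp add: B_adj_def H_inner_def set_lebesgue_integral_def inner_add_left inner_add_right inner_commute mult.commute ac_simps)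
qed

text \<open>\<open>H_integral\<close> is known only through its pairings with elements of \<open>H\<close>. That is enough, as
  \<open>\<langle>B\<^sup>* y, (1, 1)\<rangle>\<close> is such a pairing.\<close>
lemma B_adj_a_curve:
  assumes b: "L2_delay (delay P) (b\<^sub>1 P)" and s: "s \<le> horizon P"
  shows "B_adj P (a_curve P s) \<bullet> vector [1, 1] = costate P s"
proof -
  let ?Y = "\<lambda>v. disc_adj_semigroup P (v - s) (\<alpha>_tilde P, \<lambda>_. 0)"
  let ?k = "(b\<^sub>0 P *\<^sub>R vector [1, 1], \<lambda>\<xi>. b\<^sub>1 P \<xi> *\<^sub>R vector [1, 1]) :: H"
  let ?Z = "disc_adj_semigroup P (horizon P - s) (l_tilde P, \<lambda>_. 0)"
  obtain C where C: "\<And>\<tau>. \<tau> \<in> {0..horizon P - s} \<Longrightarrow> norm (fst (disc_adj_semigroup P \<tau> (\<alpha>_tilde P, \<lambda>_. 0))) \<le> C"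
    "\<And>\<tau> \<xi>. \<tau> \<in> {0..horizon P - s} \<Longrightarrow> norm (snd (disc_adj_semigroup P \<tau> (\<alpha>_tilde P, \<lambda>_. 0)) \<xi>) \<le> C"
    by (rule disc_adj_semigroup_bounded[of "horizon P - s" P "\<alpha>_tilde P"]) blast
  have ex: "\<exists>h. has_H_integral (delay P) ?Y s (horizon P) h"
  proof (rule exI, rule has_H_integral_bounded[where C = C])
    show "(\<lambda>v. fst (?Y v)) \<in> borel_measurable borel"
      unfolding disc_adj_semigroup_eq fst_conv by measurable
    have [measurable]: "(\<lambda>p. indicator {- (fst p - s)..0} (snd p) :: real) \<in> borel_measurable (borel \<Otimes>\<^sub>M borel)"
      unfolding indicator_def atLeastAtMost_iff by measurable
    show "(\<lambda>(v, \<xi>). snd (?Y v) \<xi>) \<in> borel_measurable (borel \<Otimes>\<^sub>M borel)"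
      unfolding disc_adj_semigroup_eq snd_conv case_prod_beta' by measurable
  qed (use C in auto)
  define h where "h = H_integral (delay P) ?Y s (horizon P)"
  have h: "has_H_integral (delay P) ?Y s (horizon P) h"
    unfolding h_def H_integral_def by (rule someI_ex[OF ex])
  then have hH: "h \<in> H_space (delay P)" by (simp add: has_H_integral_def)
  have Z: "?Z \<in> H_space (delay P)" using s by (intro disc_adj_semigroup_H_space) simp
  have k: "?k \<in> H_space (delay P)"
    using L2_delay_scaleR_vector[OF b] by (simp add: H_space_def)
  have a: "a_curve P s = H_add ?Z h" by (simp add: a_curve_def h_def)
  have "B_adj P (a_curve P s) \<bullet> vector [1, 1] = H_inner (delay P) ?Z ?k + H_inner (delay P) h ?k"
    unfolding a using B_adj_inner[OF b H_add_H_space[OF Z hH]] H_inner_add[OF Z hH k] by simp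
  also have "H_inner (delay P) h ?k = (LINT v:{s..horizon P}|lborel. H_inner (delay P) (?Y v) ?k)"
    using h k unfolding has_H_integral_def by blast
  also have "\<dots> = (LINT v:{s..horizon P}|lborel. (\<alpha>\<^sub>0 P - \<alpha>\<^sub>1 P) * (exp (- rate P * (v - s)) * response P (v - s)))"
    by (rule set_lebesgue_integral_cong) (simp_all add: disc_adj_semigroup_inner \<alpha>_tilde_def)
  also have "H_inner (delay P) ?Z ?k = (l\<^sub>0 P - l\<^sub>1 P) * (exp (- rate P * (horizon P - s)) * response P (horizon P - s))"
    using s by (simp add: disc_adj_semigroup_inner l_tilde_def)
  finally show ?thesis by (simp add: costate_def)
qed

lemma u_star_a_curve:
  assumes "L2_delay (delay P) (b\<^sub>1 P)" and "s \<le> horizon P"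
  shows "u_star P (B_adj P (a_curve P s)) = (costate P s - (\<beta>\<^sub>0 P + \<beta>\<^sub>1 P)) / (2 * (\<gamma>\<^sub>0 P + \<gamma>\<^sub>1 P))"
  using B_adj_a_curve[OF assms] by (simp add: u_star_def inner_diff_left \<beta>_tilde_def inner_vec_def sum_2)

section \<open>The Brownian filtration\<close>

text \<open>Approximate \<open>v\<close> from below by \<open>\<lfloor>(n+1) v\<rfloor> / (n+1)\<close>, which takes countably many values.\<close>
lemma borel_measurable_continuous_in_first:
  fixes g :: "real \<Rightarrow> 'a \<Rightarrow> real"
  assumes cont: "\<And>\<omega>. \<omega> \<in> space N \<Longrightarrow> continuous_on UNIV (\<lambda>v. g v \<omega>)"
    and meas: "\<And>v. g v \<in> borel_measurable N"
  shows "(\<lambda>(v, \<omega>). g v \<omega>) \<in> borel_measurable (borel \<Otimes>\<^sub>M N)"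
proof -
  define q where "q n v = real_of_int \<lfloor>real (Suc n) * v\<rfloor> / real (Suc n)" for n :: nat and v :: real
  have q: "(\<lambda>n. q n v) \<longlonglongrightarrow> v" for v
  proof (rule tendsto_sandwich[of "\<lambda>n. v - inverse (real (Suc n))" _ _ "\<lambda>_. v"])
    have "v - inverse (real (Suc n)) \<le> q n v \<and> q n v \<le> v" for n
    proof -
      have "real (Suc n) * v - 1 \<le> real_of_int \<lfloor>real (Suc n) * v\<rfloor>" "real_of_int \<lfloor>real (Suc n) * v\<rfloor> \<le> real (Suc n) * v"
        by linarith+
      then have "(real (Suc n) * v - 1) / real (Suc n) \<le> q n v" "q n v \<le> (real (Suc n) * v) / real (Suc n)"
        unfolding q_def by (intro divide_right_mono; simp)+
      then show ?thesis by (simp add: diff_divide_distrib inverse_eq_divide)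
    qed
    then show "\<forall>\<^sub>F n in sequentially. v - inverse (real (Suc n)) \<le> q n v"
      "\<forall>\<^sub>F n in sequentially. q n v \<le> v" by auto
    show "(\<lambda>n. v - inverse (real (Suc n))) \<longlonglongrightarrow> v"
      using tendsto_diff[OF tendsto_const LIMSEQ_inverse_real_of_nat, of v] by simp
  qed simp
  show ?thesis
  proof (rule borel_measurable_LIMSEQ_real)
    fix p :: "real \<times> 'a" assume "p \<in> space (borel \<Otimes>\<^sub>M N)"
    then have "snd p \<in> space N" by (auto simp: space_pair_measure)
    then have "(\<lambda>n. g (q n (fst p)) (snd p)) \<longlonglongrightarrow> g (fst p) (snd p)"
      using cont q by (intro continuous_on_tendsto_compose[of UNIV "\<lambda>v. g v (snd p)"]) auto
    then show "(\<lambda>n. (\<lambda>p. g (q n (fst p)) (snd p)) p) \<longlonglongrightarrow> (case p of (v, \<omega>) \<Rightarrow> g v \<omega>)"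
      by (simp add: case_prod_beta')
  next
    fix n
    show "(\<lambda>p. g (q n (fst p)) (snd p)) \<in> borel_measurable (borel \<Otimes>\<^sub>M N)"
      unfolding q_def
    proof (rule measurable_compose_countable[where g = "\<lambda>p. \<lfloor>real (Suc n) * fst p\<rfloor>"
          and f = "\<lambda>i p. g (real_of_int i / real (Suc n)) (snd p)"])
      show "(\<lambda>p. g (real_of_int i / real (Suc n)) (snd p)) \<in> borel_measurable (borel \<Otimes>\<^sub>M N)" for i
        using meas by measurable
    qed measurable
  qed
qed

lemma measurable_finer:
  assumes "sets A \<subseteq> sets B" "space A = space B" "f \<in> measurable A N"
  shows "f \<in> measurable B N"
  using assms by (auto simp: measurable_def)

locale complete_brownian = prob_space M for M :: "'w measure" +
  fixes W :: "real \<Rightarrow> 'w \<Rightarrow> real"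
  assumes null_complete: "\<And>N A. N \<in> null_sets M \<Longrightarrow> A \<subseteq> N \<Longrightarrow> A \<in> sets M"
    and bm: "brownian_motion M (brownian_filtration M W) W"
begin

sublocale complete_measure M
  by standard (rule null_complete)

sublocale LM: pair_sigma_finite lborel M ..

abbreviation F where "F \<equiv> brownian_filtration M W"

lemma W_measurable[measurable (raw)]: "0 \<le> s \<Longrightarrow> W s \<in> borel_measurable M"
  using bm by (simp add: brownian_motion_def)

lemma filtration_generators: "(\<Union>s\<in>{0..t}. {W s -` A \<inter> space M | A. A \<in> sets borel}) \<union> null_sets M \<subseteq> sets M"
  using measurable_sets[OF W_measurable] by auto

lemma space_F[simp]: "space (F t) = space M"
  using filtration_generators[of t] sets.sets_into_space[of _ M]
  unfolding brownian_filtration_def by (intro space_measure_of) auto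

lemma sets_F: "sets (F t) = sigma_sets (space M)
    ((\<Union>s\<in>{0..t}. {W s -` A \<inter> space M | A. A \<in> sets borel}) \<union> null_sets M)"
  using filtration_generators[of t] sets.sets_into_space[of _ M]
  unfolding brownian_filtration_def by (intro sets_measure_of) auto

lemma sets_F_subset: "sets (F t) \<subseteq> sets M"
  unfolding sets_F by (rule sets.sigma_sets_subset[OF filtration_generators])

lemma sets_F_mono:
  assumes "s \<le> t" shows "sets (F s) \<subseteq> sets (F t)"
proof -
  have "{0..s} \<subseteq> {0..t}" using assms by auto
  then show ?thesis unfolding sets_F by (intro sigma_sets_mono') blast
qed

lemma null_sets_F: "N \<in> null_sets M \<Longrightarrow> N \<in> sets (F t)"
  unfolding sets_F by (auto intro: sigma_sets.Basic)

lemma measurable_F_imp_M: "f \<in> measurable (F s) N \<Longrightarrow> f \<in> measurable M N"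
  by (rule measurable_finer[OF sets_F_subset]) simp

lemma measurable_F_mono: "f \<in> measurable (F s) N \<Longrightarrow> s \<le> t \<Longrightarrow> f \<in> measurable (F t) N"
  by (rule measurable_finer[OF sets_F_mono]) simp_all

lemma W_adapted: "0 \<le> v \<Longrightarrow> v \<le> s \<Longrightarrow> W v \<in> borel_measurable (F s)"
  using bm measurable_F_mono[of "W v" v borel s] by (simp add: brownian_motion_def)

lemma sets_pair_F_subset: "sets (borel \<Otimes>\<^sub>M F s) \<subseteq> sets (borel \<Otimes>\<^sub>M M)"
  unfolding sets_pair_measure space_F
  using sets_F_subset[of s] by (intro sigma_sets_mono') blast

lemma measurable_pair_F_imp_M: "f \<in> measurable (borel \<Otimes>\<^sub>M F s) N \<Longrightarrow> f \<in> measurable (borel \<Otimes>\<^sub>M M) N"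
  by (rule measurable_finer[OF sets_pair_F_subset]) (simp add: space_pair_measure)

text \<open>Completeness of the measure is what makes functionals of an arbitrary strong solution
  measurable: they agree almost surely with functionals of an explicit one.\<close>
lemma measurable_AE_eq:
  fixes f g :: "'w \<Rightarrow> 'b::topological_space"
  assumes f: "f \<in> borel_measurable M" and eq: "AE \<omega> in M. f \<omega> = g \<omega>"
  shows "g \<in> borel_measurable M"
proof (rule measurableI)
  fix A :: "'b set" assume "A \<in> sets borel"
  then have A: "f -` A \<inter> space M \<in> sets M" by (rule measurable_sets[OF f])
  show "g -` A \<inter> space M \<in> sets M"
    by (rule in_sets_AE[OF _ A]) (use eq in \<open>auto elim: eventually_mono\<close>)
qed simp

text \<open>The bound in the third claim comes from \<open>\<bar>y\<bar> \<le> 1 + y\<^sup>2\<close> and the variance.\<close>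
lemma increment:
  assumes "0 \<le> s" "s \<le> v"
  shows "integrable M (\<lambda>\<omega>. W v \<omega> - W s \<omega>)" and "expectation (\<lambda>\<omega>. W v \<omega> - W s \<omega>) = 0"
    and "expectation (\<lambda>\<omega>. \<bar>W v \<omega> - W s \<omega>\<bar>) \<le> 1 + (v - s)"
proof -
  have "integrable M (\<lambda>\<omega>. W v \<omega> - W s \<omega>) \<and> expectation (\<lambda>\<omega>. W v \<omega> - W s \<omega>) = 0
      \<and> expectation (\<lambda>\<omega>. \<bar>W v \<omega> - W s \<omega>\<bar>) \<le> 1 + (v - s)"
  proof (cases "s = v")
    case False
    define X where "X \<omega> = W v \<omega> - W s \<omega>" for \<omega>
    have pos: "0 < sqrt (v - s)" using assms False by simp
    have D: "distributed M lborel X (normal_density 0 (sqrt (v - s)))"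
      using bm assms False unfolding brownian_motion_def X_def by auto
    have i1: "integrable M X"
      using distributed_integrable[OF D, of "\<lambda>x. x"] integrable_normal_moment[OF pos, of 0 1] by simp
    have i2: "integrable M (\<lambda>\<omega>. (X \<omega>)\<^sup>2)"
      using distributed_integrable[OF D, of "\<lambda>x. x\<^sup>2"] integrable_normal_moment[OF pos, of 0 2] by simp
    have e: "expectation X = 0" by (rule normal_distributed_expectation[OF pos D])
    have e2: "expectation (\<lambda>\<omega>. (X \<omega>)\<^sup>2) = v - s"
      using normal_distributed_variance[OF pos D] e assms by simp
    have "\<bar>x\<bar> \<le> 1 + x\<^sup>2" for x :: real
      using zero_le_power2[of "\<bar>x\<bar> - 1/2"] by (simp add: power2_diff power_divide)
    then have "expectation (\<lambda>\<omega>. \<bar>X \<omega>\<bar>) \<le> expectation (\<lambda>\<omega>. 1 + (X \<omega>)\<^sup>2)"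
      using i1 i2 by (intro integral_mono) auto
    also have "\<dots> = 1 + (v - s)" using i2 e2 by (simp add: prob_space)
    finally show ?thesis using i1 e by (simp add: X_def[abs_def])
  qed simp
  then show "integrable M (\<lambda>\<omega>. W v \<omega> - W s \<omega>)" and "expectation (\<lambda>\<omega>. W v \<omega> - W s \<omega>) = 0"
    and "expectation (\<lambda>\<omega>. \<bar>W v \<omega> - W s \<omega>\<bar>) \<le> 1 + (v - s)" by auto
qed

text \<open>The paths of \<open>W\<close> are continuous only almost surely. Redefining \<open>W\<close> on a null set makes all paths
  continuous without spoiling adaptedness, since every \<open>F s\<close> contains the null sets. For negative
  times the path is continued by its value at \<open>0\<close>.\<close>
lemma continuous_version:
  obtains B :: "real \<Rightarrow> 'w \<Rightarrow> real" where
    "\<And>\<omega>. \<omega> \<in> space M \<Longrightarrow> continuous_on UNIV (\<lambda>v. B v \<omega>)"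
    and "AE \<omega> in M. \<forall>v\<ge>0. B v \<omega> = W v \<omega>"
    and "\<And>s v. 0 \<le> s \<Longrightarrow> v \<le> s \<Longrightarrow> B v \<in> borel_measurable (F s)"
proof -
  have "AE \<omega> in M. continuous_on {0..} (\<lambda>s. W s \<omega>)" using bm by (simp add: brownian_motion_def)
  then obtain N where N: "{\<omega>\<in>space M. \<not> continuous_on {0..} (\<lambda>s. W s \<omega>)} \<subseteq> N" "N \<in> null_sets M"
    by (auto elim!: AE_E)
  define B where "B v \<omega> = (if \<omega> \<in> N then 0 else W (max 0 v) \<omega>)" for v \<omega>
  show ?thesis
  proof
    fix \<omega> assume \<omega>: "\<omega> \<in> space M"
    show "continuous_on UNIV (\<lambda>v. B v \<omega>)"
    proof (cases "\<omega> \<in> N")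
      case False
      then have "continuous_on {0..} (\<lambda>s. W s \<omega>)" using N(1) \<omega> by auto
      then have "continuous_on UNIV (\<lambda>v. W (max 0 v) \<omega>)"
        by (rule continuous_on_compose2) (auto intro!: continuous_intros)
      then show ?thesis using False by (simp add: B_def)
    qed (simp add: B_def)
  next
    show "AE \<omega> in M. \<forall>v\<ge>0. B v \<omega> = W v \<omega>"
      using AE_not_in[OF N(2)] by eventually_elim (simp add: B_def max_def)
  next
    fix s v :: real assume "0 \<le> s" "v \<le> s"
    then have [measurable]: "W (max 0 v) \<in> borel_measurable (F s)" "N \<in> sets (F s)"
      using W_adapted[of "max 0 v" s] null_sets_F[OF N(2)] by auto
    show "B v \<in> borel_measurable (F s)" unfolding B_def by measurable
  qed
qed

end

section \<open>The input of the state equation and its mean\<close>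

text \<open>Extending \<open>b\<^sub>1\<close> by zero turns the delay term into a convolution over the whole line, so that
  translation invariance of Lebesgue measure applies.\<close>
definition delay_kernel :: "lq_data \<Rightarrow> real \<Rightarrow> real" where
  "delay_kernel P \<xi> = indicator {-delay P..0} \<xi> * b\<^sub>1 P \<xi>"

text \<open>The part of the drift that the control \<open>U\<close>, defined for all times, contributes.\<close>
definition controlled_input :: "lq_data \<Rightarrow> (real \<Rightarrow> 'w \<Rightarrow> real) \<Rightarrow> real \<Rightarrow> 'w \<Rightarrow> real" where
  "controlled_input P U v \<omega> = b\<^sub>0 P * U v \<omega> + (LINT \<xi>|lborel. delay_kernel P \<xi> * U (v + \<xi>) \<omega>)"

lemma measurable_controlled_input:
  assumes U: "(\<lambda>p. U (fst p) (snd p)) \<in> borel_measurable (borel \<Otimes>\<^sub>M N)"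
    and k: "delay_kernel P \<in> borel_measurable borel"
  shows "(\<lambda>p. controlled_input P U (fst p) (snd p)) \<in> borel_measurable (borel \<Otimes>\<^sub>M N)"
proof -
  note [measurable] = U k
  have "(\<lambda>q. (fst (fst q) + snd q, snd (fst q))) \<in> measurable ((borel \<Otimes>\<^sub>M N) \<Otimes>\<^sub>M lborel) (borel \<Otimes>\<^sub>M N)"
    by measurable
  from measurable_compose[OF this U]
  have [measurable]: "(\<lambda>q. U (fst (fst q) + snd q) (snd (fst q))) \<in> borel_measurable ((borel \<Otimes>\<^sub>M N) \<Otimes>\<^sub>M lborel)"
    by simp
  show ?thesis unfolding controlled_input_def by measurable
qed

context complete_brownian begin

text \<open>Lebesgue measure is translation invariant, hence so is its product with \<open>M\<close>.\<close>
lemma pair_translation: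
  assumes U: "integrable (lborel \<Otimes>\<^sub>M M) (\<lambda>(v, \<omega>). U v \<omega> :: real)"
  shows "integrable (lborel \<Otimes>\<^sub>M M) (\<lambda>(v, \<omega>). U (v + \<xi>) \<omega>)"
    and "(LINT p|(lborel \<Otimes>\<^sub>M M). \<bar>U (fst p + \<xi>) (snd p)\<bar>) = (LINT p|(lborel \<Otimes>\<^sub>M M). \<bar>U (fst p) (snd p)\<bar>)"
proof -
  let ?S = "\<lambda>(v, \<omega>). (\<xi> + v, \<omega>)"
  have "distr lborel borel ((+) \<xi>) \<Otimes>\<^sub>M distr M M (\<lambda>\<omega>. \<omega>) = distr (lborel \<Otimes>\<^sub>M M) (borel \<Otimes>\<^sub>M M) ?S"
    by (rule pair_measure_distr) (simp_all add: distr_id2 sigma_finite_measure_axioms)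
  then have eq: "distr (lborel \<Otimes>\<^sub>M M) (borel \<Otimes>\<^sub>M M) ?S = lborel \<Otimes>\<^sub>M M"
    by (simp add: lborel_distr_plus distr_id2)
  have S: "?S \<in> measurable (lborel \<Otimes>\<^sub>M M) (borel \<Otimes>\<^sub>M M)" by measurable
  have U': "integrable (distr (lborel \<Otimes>\<^sub>M M) (borel \<Otimes>\<^sub>M M) ?S) (\<lambda>(v, \<omega>). U v \<omega>)"
    using U by (simp only: eq)
  have m: "(\<lambda>p. U (fst p) (snd p)) \<in> borel_measurable (borel \<Otimes>\<^sub>M M)"
    using borel_measurable_integrable[OF U] by (simp add: case_prod_beta' cong: measurable_cong_sets)
  show "integrable (lborel \<Otimes>\<^sub>M M) (\<lambda>(v, \<omega>). U (v + \<xi>) \<omega>)"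
    using integrable_distr[OF S U'] by (simp add: case_prod_beta' add.commute)
  have "(LINT p|(lborel \<Otimes>\<^sub>M M). \<bar>U (fst p) (snd p)\<bar>) = (LINT p|(distr (lborel \<Otimes>\<^sub>M M) (borel \<Otimes>\<^sub>M M) ?S). \<bar>U (fst p) (snd p)\<bar>)"
    by (simp only: eq)
  also have "\<dots> = (LINT p|(lborel \<Otimes>\<^sub>M M). \<bar>U (fst (?S p)) (snd (?S p))\<bar>)"
    by (rule integral_distr[OF S]) (use m in measurable)
  finally show "(LINT p|(lborel \<Otimes>\<^sub>M M). \<bar>U (fst p + \<xi>) (snd p)\<bar>) = (LINT p|(lborel \<Otimes>\<^sub>M M). \<bar>U (fst p) (snd p)\<bar>)"
    by (simp add: case_prod_beta' add.commute)
qed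

context
  fixes P :: lq_data and U :: "real \<Rightarrow> 'w \<Rightarrow> real"
  assumes kernel: "integrable lborel (delay_kernel P)"
    and U: "integrable (lborel \<Otimes>\<^sub>M M) (\<lambda>(v, \<omega>). U v \<omega>)"
begin

interpretation LLM: pair_sigma_finite lborel "lborel \<Otimes>\<^sub>M M" ..

text \<open>As for the convolution of two integrable functions, the norm is the product of the norms.\<close>
lemma delayed_integrable:
  "integrable (lborel \<Otimes>\<^sub>M (lborel \<Otimes>\<^sub>M M)) (\<lambda>(\<xi>, v, \<omega>). delay_kernel P \<xi> * U (v + \<xi>) \<omega>)"
proof (rule LLM.Fubini_integrable)
  have [measurable]: "(\<lambda>p. U (fst p) (snd p)) \<in> borel_measurable (borel \<Otimes>\<^sub>M M)"
    using borel_measurable_integrable[OF U] by (simp add: case_prod_beta' cong: measurable_cong_sets)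
  note [measurable] = borel_measurable_integrable[OF kernel]
  have "(\<lambda>p. (\<lambda>p. U (fst p) (snd p)) (fst (snd p) + fst p, snd (snd p))) \<in> borel_measurable (lborel \<Otimes>\<^sub>M (lborel \<Otimes>\<^sub>M M))"
    by measurable
  then have [measurable]: "(\<lambda>p. U (fst (snd p) + fst p) (snd (snd p))) \<in> borel_measurable (lborel \<Otimes>\<^sub>M (lborel \<Otimes>\<^sub>M M))"
    by simp
  show "(\<lambda>(\<xi>, v, \<omega>). delay_kernel P \<xi> * U (v + \<xi>) \<omega>) \<in> borel_measurable (lborel \<Otimes>\<^sub>M (lborel \<Otimes>\<^sub>M M))"
    unfolding case_prod_beta' by measurable
  have "(LINT p|(lborel \<Otimes>\<^sub>M M). norm (case (\<xi>, p) of (\<xi>, v, \<omega>) \<Rightarrow> delay_kernel P \<xi> * U (v + \<xi>) \<omega>))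
      = \<bar>delay_kernel P \<xi>\<bar> * (LINT p|(lborel \<Otimes>\<^sub>M M). \<bar>U (fst p) (snd p)\<bar>)" for \<xi>
    by (simp add: case_prod_beta' abs_mult pair_translation(2)[OF U])
  then show "integrable lborel (\<lambda>\<xi>. LINT p|(lborel \<Otimes>\<^sub>M M). norm (case (\<xi>, p) of (\<xi>, v, \<omega>) \<Rightarrow> delay_kernel P \<xi> * U (v + \<xi>) \<omega>))"
    using kernel by simp
  show "AE \<xi> in lborel. integrable (lborel \<Otimes>\<^sub>M M) (\<lambda>p. case (\<xi>, p) of (\<xi>, v, \<omega>) \<Rightarrow> delay_kernel P \<xi> * U (v + \<xi>) \<omega>)"
    using pair_translation(1)[OF U] by (simp add: case_prod_beta')
qed

lemma delayed_integral_integrable: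
  "integrable (lborel \<Otimes>\<^sub>M M) (\<lambda>(v, \<omega>). LINT \<xi>|lborel. delay_kernel P \<xi> * U (v + \<xi>) \<omega>)"
  using LLM.integrable_snd[of "\<lambda>\<xi> (v, \<omega>). delay_kernel P \<xi> * U (v + \<xi>) \<omega>"] delayed_integrable
  by (simp add: case_prod_beta')

lemma controlled_input_integrable:
  "integrable (lborel \<Otimes>\<^sub>M M) (\<lambda>(v, \<omega>). controlled_input P U v \<omega>)"
  using delayed_integral_integrable U
  by (simp add: controlled_input_def case_prod_beta')

text \<open>Expectation and delay integral commute only for almost every \<open>v\<close>. Testing against a weight \<open>g\<close>
  states this without exceptional sets.\<close>
lemma mean_controlled_input:
  assumes g: "g \<in> borel_measurable borel" and C: "\<And>v. \<bar>g v\<bar> \<le> C"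
  shows "(LINT v|lborel. g v * expectation (controlled_input P U v))
    = b\<^sub>0 P * (LINT v|lborel. g v * expectation (U v))
      + (LINT \<xi>|lborel. delay_kernel P \<xi> * (LINT v|lborel. g v * expectation (U (v + \<xi>))))"
proof -
  let ?D = "\<lambda>v \<omega>. LINT \<xi>|lborel. delay_kernel P \<xi> * U (v + \<xi>) \<omega>"
  have gM: "(\<lambda>p. g (fst p)) \<in> borel_measurable (lborel \<Otimes>\<^sub>M M)" using g by measurable
  have gMM: "(\<lambda>p. g (fst (snd p))) \<in> borel_measurable (lborel \<Otimes>\<^sub>M (lborel \<Otimes>\<^sub>M M))" using g by measurable
  have gL: "g \<in> borel_measurable lborel" using g by simp
  have iU: "integrable lborel (\<lambda>v. g v * expectation (U v))"
    by (rule integrable_bounded_mult[OF LM.integrable_fst[OF U] gL C])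
  have iD: "integrable lborel (\<lambda>v. g v * expectation (?D v))"
    by (rule integrable_bounded_mult[OF LM.integrable_fst[OF delayed_integral_integrable] gL C])
  have "AE v in lborel. g v * expectation (controlled_input P U v)
      = b\<^sub>0 P * (g v * expectation (U v)) + g v * expectation (?D v)"
    using LM.AE_integrable_fst[OF U] LM.AE_integrable_fst[OF delayed_integral_integrable]
    by eventually_elim (simp add: controlled_input_def[abs_def] algebra_simps)
  then have "(LINT v|lborel. g v * expectation (controlled_input P U v))
      = (LINT v|lborel. b\<^sub>0 P * (g v * expectation (U v)) + g v * expectation (?D v))"
    using borel_measurable_integrable[OF LM.integrable_fst[OF controlled_input_integrable]]
      borel_measurable_integrable[OF iU] borel_measurable_integrable[OF iD] g
    by (intro integral_cong_AE) (auto intro!: borel_measurable_times borel_measurable_add)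
  also have "\<dots> = b\<^sub>0 P * (LINT v|lborel. g v * expectation (U v)) + (LINT v|lborel. g v * expectation (?D v))"
    using iU iD by simp
  also have "(LINT v|lborel. g v * expectation (?D v)) = (LINT v|lborel. expectation (\<lambda>\<omega>. g v * ?D v \<omega>))"
    by simp
  also have "\<dots> = (LINT p|(lborel \<Otimes>\<^sub>M M). g (fst p) * ?D (fst p) (snd p))"
    using LM.integral_fst[of "\<lambda>v \<omega>. g v * ?D v \<omega>"]
      integrable_bounded_mult[OF delayed_integral_integrable gM C]
    by (simp add: case_prod_beta')
  also have "\<dots> = (LINT p|(lborel \<Otimes>\<^sub>M M). LINT \<xi>|lborel. g (fst p) * (delay_kernel P \<xi> * U (fst p + \<xi>) (snd p)))"
    by simp
  also have "\<dots> = (LINT \<xi>|lborel. LINT p|(lborel \<Otimes>\<^sub>M M). g (fst p) * (delay_kernel P \<xi> * U (fst p + \<xi>) (snd p)))"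
    using LLM.Fubini_integral[of "\<lambda>\<xi> p. g (fst p) * (delay_kernel P \<xi> * U (fst p + \<xi>) (snd p))"]
      integrable_bounded_mult[OF delayed_integrable gMM C]
    by (simp add: case_prod_beta')
  also have "\<dots> = (LINT \<xi>|lborel. delay_kernel P \<xi> * (LINT p|(lborel \<Otimes>\<^sub>M M). g (fst p) * U (fst p + \<xi>) (snd p)))"
    by (simp add: mult.left_commute)
  also have "\<dots> = (LINT \<xi>|lborel. delay_kernel P \<xi> * (LINT v|lborel. g v * expectation (U (v + \<xi>))))"
  proof -
    have "(LINT p|(lborel \<Otimes>\<^sub>M M). g (fst p) * U (fst p + \<xi>) (snd p)) = (LINT v|lborel. g v * expectation (U (v + \<xi>)))" for \<xi>
      using LM.integral_fst[of "\<lambda>v \<omega>. g v * U (v + \<xi>) \<omega>"]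
        integrable_bounded_mult[OF pair_translation(1)[OF U, of \<xi>] gM C]
      by (simp add: case_prod_beta')
    then show ?thesis by simp
  qed
  finally show ?thesis .
qed

end

end

section \<open>Admissible controls\<close>

text \<open>The control together with its past, extended by zero outside \<open>[t - d, T]\<close>. With this
  extension the delay term becomes a convolution (lemma \<open>delayed_control\<close>).\<close>
definition full_control :: "lq_data \<Rightarrow> real \<Rightarrow> (real \<Rightarrow> 'w \<Rightarrow> real) \<Rightarrow> real \<Rightarrow> 'w \<Rightarrow> real" where
  "full_control P t u s \<omega> = indicator {t - delay P..<t} s * \<delta> P (s - t) + indicator {t..horizon P} s * u s \<omega>"

locale lq_problem = complete_brownian M W for M :: "'w measure" and W :: "real \<Rightarrow> 'w \<Rightarrow> real" +
  fixes P :: lq_data and t x :: real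
  assumes b1: "L2_delay (delay P) (b\<^sub>1 P)"
    and past: "L2_delay (delay P) (\<delta> P)"
    and time: "0 \<le> t" "t \<le> horizon P"
begin

lemma kernel_integrable: "integrable lborel (delay_kernel P)"
  using L2_delay_set_integrable[OF b1] by (simp add: delay_kernel_def[abs_def] set_integrable_def)

lemma kernel_measurable: "delay_kernel P \<in> borel_measurable borel"
  using borel_measurable_integrable[OF kernel_integrable] by simp

lemma past_integrable: "integrable lborel (\<lambda>s. indicator {t - delay P..<t} s * \<delta> P (s - t))"
proof -
  have "integrable lborel (\<lambda>s. indicator {-delay P..0} s * \<delta> P s)"
    using L2_delay_set_integrable[OF past] by (simp add: set_integrable_def)
  from lborel_integrable_real_affine[OF this, of 1 "- t"]
  have "integrable lborel (\<lambda>s. indicator {-delay P..0} (- t + 1 * s) * \<delta> P (- t + 1 * s))" by simp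
  from integrable_bounded_mult[OF this, of "indicator {..<t}" 1]
  have "integrable lborel (\<lambda>s. indicator {..<t} s * (indicator {-delay P..0} (- t + 1 * s) * \<delta> P (- t + 1 * s)))"
    by simp
  moreover have "indicator {..<t} s * (indicator {-delay P..0} (- t + 1 * s) * \<delta> P (- t + 1 * s))
     = indicator {t - delay P..<t} s * \<delta> P (s - t)" for s
    by (auto simp: indicator_def)
  ultimately show ?thesis by (simp only:)
qed

lemma finite_restrict: "finite_measure (restrict_space lborel {0..T::real})"
  by (rule finite_measureI) (simp add: emeasure_restrict_space space_restrict_space emeasure_lborel_Icc_eq)

text \<open>Progressive measurability speaks about the product with the restricted line; precomposing with
  the clipping of time to \<open>[0, s]\<close> transports it to the whole line.\<close>
lemma progressive_truncated:
  assumes u: "progressively_measurable F (horizon P) u" and s: "0 \<le> s" "s \<le> horizon P"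
  shows "(\<lambda>p. indicator {0..s} (fst p) * u (fst p) (snd p)) \<in> borel_measurable (borel \<Otimes>\<^sub>M F s)"
proof -
  have "(\<lambda>p. max 0 (min (fst p) s)) \<in> measurable (borel \<Otimes>\<^sub>M F s) (restrict_space borel {0..s})"
    using s by (intro measurable_restrict_space2) auto
  then have c: "(\<lambda>p. (max 0 (min (fst p) s), snd p)) \<in> measurable (borel \<Otimes>\<^sub>M F s) (restrict_space borel {0..s} \<Otimes>\<^sub>M F s)"
    by measurable
  have "(\<lambda>(v, \<omega>). u v \<omega>) \<in> borel_measurable (restrict_space borel {0..s} \<Otimes>\<^sub>M F s)"
    using u s by (auto simp: progressively_measurable_def)
  from measurable_compose[OF c this]
  have [measurable]: "(\<lambda>p. u (max 0 (min (fst p) s)) (snd p)) \<in> borel_measurable (borel \<Otimes>\<^sub>M F s)" by simp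
  have "(\<lambda>p. indicator {0..s} (fst p) * u (max 0 (min (fst p) s)) (snd p)) \<in> borel_measurable (borel \<Otimes>\<^sub>M F s)"
    by measurable
  also have "(\<lambda>p. indicator {0..s} (fst p) * u (max 0 (min (fst p) s)) (snd p)) = (\<lambda>p. indicator {0..s} (fst p) * u (fst p) (snd p))"
    by (auto simp: indicator_def)
  finally show ?thesis .
qed

text \<open>Cutting off at \<open>s\<close> expresses that the control up to time \<open>s\<close> is known at time \<open>s\<close> as
  joint measurability on the whole line.\<close>
lemma full_control_adapted:
  assumes u: "progressively_measurable F (horizon P) u" and s: "t \<le> s" "s \<le> horizon P"
  shows "(\<lambda>p. indicator {..s} (fst p) * full_control P t u (fst p) (snd p)) \<in> borel_measurable (borel \<Otimes>\<^sub>M F s)"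
proof -
  have [measurable]: "(\<lambda>s. indicator {t - delay P..<t} s * \<delta> P (s - t)) \<in> borel_measurable borel"
    using borel_measurable_integrable[OF past_integrable] by simp
  note [measurable] = progressive_truncated[OF u order_trans[OF time(1) s(1)] s(2)]
  have "(\<lambda>p. indicator {..s} (fst p) * (indicator {t - delay P..<t} (fst p) * \<delta> P (fst p - t))
      + indicator {t..s} (fst p) * (indicator {0..s} (fst p) * u (fst p) (snd p))) \<in> borel_measurable (borel \<Otimes>\<^sub>M F s)"
    by measurable
  also have "(\<lambda>p. indicator {..s} (fst p) * (indicator {t - delay P..<t} (fst p) * \<delta> P (fst p - t))
      + indicator {t..s} (fst p) * (indicator {0..s} (fst p) * u (fst p) (snd p)))
    = (\<lambda>p. indicator {..s} (fst p) * full_control P t u (fst p) (snd p))"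
    using s time by (auto simp: full_control_def indicator_def)
  finally show ?thesis .
qed

lemma control_square_integrable:
  assumes u: "u \<in> controls M W P"
  shows "integrable (lborel \<Otimes>\<^sub>M M) (\<lambda>(v, \<omega>). indicator {t..horizon P} v * (u v \<omega>)\<^sup>2)"
proof (rule LM.Fubini_integrable)
  let ?T = "horizon P" and ?R = "restrict_space lborel {0..horizon P}"
  interpret R: finite_measure ?R by (rule finite_restrict)
  interpret RM: pair_sigma_finite ?R M ..
  have i: "integrable (?R \<Otimes>\<^sub>M M) (\<lambda>(v, \<omega>). (u v \<omega>)\<^sup>2)" using u by (simp add: controls_def)
  have "progressively_measurable F ?T u" using u by (simp add: controls_def)
  from measurable_pair_F_imp_M[OF progressive_truncated[OF this order_trans[OF time] order_refl]]
  have [measurable]: "(\<lambda>p. indicator {0..?T} (fst p) * u (fst p) (snd p)) \<in> borel_measurable (borel \<Otimes>\<^sub>M M)" .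
  have "(\<lambda>p. indicator {t..?T} (fst p) * (indicator {0..?T} (fst p) * u (fst p) (snd p))\<^sup>2) \<in> borel_measurable (lborel \<Otimes>\<^sub>M M)"
    by measurable
  also have "(\<lambda>p. indicator {t..?T} (fst p) * (indicator {0..?T} (fst p) * u (fst p) (snd p))\<^sup>2)
      = (\<lambda>(v, \<omega>). indicator {t..?T} v * (u v \<omega>)\<^sup>2)"
    using time by (auto simp: indicator_def)
  finally show "(\<lambda>(v, \<omega>). indicator {t..?T} v * (u v \<omega>)\<^sup>2) \<in> borel_measurable (lborel \<Otimes>\<^sub>M M)" .
  have "integrable lborel (\<lambda>v. indicator {0..?T} v *\<^sub>R expectation (\<lambda>\<omega>. (u v \<omega>)\<^sup>2))"
    using RM.integrable_fst[OF i] by (subst (asm) integrable_restrict_space) auto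
  from integrable_bounded_mult[OF this, of "indicator {t..?T}" 1]
  have "integrable lborel (\<lambda>v. indicator {t..?T} v * (indicator {0..?T} v * expectation (\<lambda>\<omega>. (u v \<omega>)\<^sup>2)))"
    by (simp add: indicator_def)
  also have "(\<lambda>v. indicator {t..?T} v * (indicator {0..?T} v * expectation (\<lambda>\<omega>. (u v \<omega>)\<^sup>2)))
     = (\<lambda>v. expectation (\<lambda>\<omega>. norm (case (v, \<omega>) of (v, \<omega>) \<Rightarrow> indicator {t..?T} v * (u v \<omega>)\<^sup>2)))"
    using time by (auto simp: indicator_def)
  finally show "integrable lborel (\<lambda>v. expectation (\<lambda>\<omega>. norm (case (v, \<omega>) of (v, \<omega>) \<Rightarrow> indicator {t..?T} v * (u v \<omega>)\<^sup>2)))" .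
  have "AE v in lborel. v \<in> {0..?T} \<longrightarrow> integrable M (\<lambda>\<omega>. (u v \<omega>)\<^sup>2)"
    using RM.AE_integrable_fst[OF i] by (subst (asm) AE_restrict_space_iff) auto
  then show "AE v in lborel. integrable M (\<lambda>\<omega>. case (v, \<omega>) of (v, \<omega>) \<Rightarrow> indicator {t..?T} v * (u v \<omega>)\<^sup>2)"
    by eventually_elim (use time in \<open>auto simp: indicator_def\<close>)
qed

lemma control_integrable:
  assumes u: "u \<in> controls M W P"
  shows "integrable (lborel \<Otimes>\<^sub>M M) (\<lambda>(v, \<omega>). indicator {t..horizon P} v * u v \<omega>)"
proof (rule Bochner_Integration.integrable_bound)
  let ?T = "horizon P"
  have "integrable (lborel \<Otimes>\<^sub>M M) (\<lambda>(v, \<omega>). indicator {t..?T} v * (1 :: real))"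
    by (rule LM.integrable_mult_pair) (auto intro!: integrable_real_indicator simp: emeasure_lborel_Icc_eq)
  from Bochner_Integration.integrable_add[OF this control_square_integrable[OF u]]
  show "integrable (lborel \<Otimes>\<^sub>M M) (\<lambda>p. indicator {t..?T} (fst p) + indicator {t..?T} (fst p) * (u (fst p) (snd p))\<^sup>2)"
    by (simp add: case_prod_beta')
  have "progressively_measurable F ?T u" using u by (simp add: controls_def)
  from measurable_pair_F_imp_M[OF progressive_truncated[OF this order_trans[OF time] order_refl]]
  have [measurable]: "(\<lambda>p. indicator {0..?T} (fst p) * u (fst p) (snd p)) \<in> borel_measurable (borel \<Otimes>\<^sub>M M)" .
  have "(\<lambda>p. indicator {t..?T} (fst p) * (indicator {0..?T} (fst p) * u (fst p) (snd p))) \<in> borel_measurable (lborel \<Otimes>\<^sub>M M)"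
    by measurable
  also have "(\<lambda>p. indicator {t..?T} (fst p) * (indicator {0..?T} (fst p) * u (fst p) (snd p)))
      = (\<lambda>(v, \<omega>). indicator {t..?T} v * u v \<omega>)"
    using time by (auto simp: indicator_def)
  finally show "(\<lambda>(v, \<omega>). indicator {t..?T} v * u v \<omega>) \<in> borel_measurable (lborel \<Otimes>\<^sub>M M)" .
  have "\<bar>y\<bar> \<le> 1 + y\<^sup>2" for y :: real
    using zero_le_power2[of "\<bar>y\<bar> - 1/2"] by (simp add: power2_diff power_divide)
  then show "AE p in lborel \<Otimes>\<^sub>M M. norm (case p of (v, \<omega>) \<Rightarrow> indicator {t..?T} v * u v \<omega>)
    \<le> norm (indicator {t..?T} (fst p) + indicator {t..?T} (fst p) * (u (fst p) (snd p))\<^sup>2)"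
    by (auto simp: indicator_def)
qed

lemma full_control_integrable:
  assumes u: "u \<in> controls M W P"
  shows "integrable (lborel \<Otimes>\<^sub>M M) (\<lambda>(v, \<omega>). full_control P t u v \<omega>)"
proof -
  have "integrable (lborel \<Otimes>\<^sub>M M) (\<lambda>(v, \<omega>). (indicator {t - delay P..<t} v * \<delta> P (v - t)) * (1 :: real))"
    by (rule LM.integrable_mult_pair[OF past_integrable]) simp
  from Bochner_Integration.integrable_add[OF this control_integrable[OF u]]
  show ?thesis by (simp add: full_control_def case_prod_beta')
qed

lemma delayed_control:
  assumes v: "v \<in> {t..horizon P}"
  shows "(LINT \<xi>:{-delay P..0}|lborel. b\<^sub>1 P \<xi> * with_past P t u (v + \<xi>) \<omega>)
    = (LINT \<xi>|lborel. delay_kernel P \<xi> * full_control P t u (v + \<xi>) \<omega>)"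
  unfolding set_lebesgue_integral_def
  by (rule Bochner_Integration.integral_cong)
     (use v in \<open>auto simp: delay_kernel_def full_control_def with_past_def indicator_def\<close>)

definition mean_input :: "(real \<Rightarrow> 'w \<Rightarrow> real) \<Rightarrow> real \<Rightarrow> real" where
  "mean_input u v = expectation (controlled_input P (full_control P t u) v)"

text \<open>The expectation of the state, written down before any state is constructed.\<close>
definition mean_state :: "(real \<Rightarrow> 'w \<Rightarrow> real) \<Rightarrow> real \<Rightarrow> real" where
  "mean_state u = linear_flow (a\<^sub>0 P + a\<^sub>1 P) t x (mean_input u)"

lemma input_integrable:
  "u \<in> controls M W P \<Longrightarrow>
    integrable (lborel \<Otimes>\<^sub>M M) (\<lambda>(v, \<omega>). controlled_input P (full_control P t u) v \<omega>)"
  by (intro controlled_input_integrable kernel_integrable full_control_integrable)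

lemma mean_input_integrable: "u \<in> controls M W P \<Longrightarrow> integrable lborel (mean_input u)"
  using LM.integrable_fst[OF input_integrable] by (simp add: mean_input_def[abs_def])

lemma mean_input_set_integrable: "u \<in> controls M W P \<Longrightarrow> A \<in> sets borel \<Longrightarrow> set_integrable lborel A (mean_input u)"
  using integrable_mult_indicator[OF _ mean_input_integrable, of A] by (simp add: set_integrable_def)

lemma mean_state_set_integrable:
  assumes u: "u \<in> controls M W P" shows "set_integrable lborel {t..horizon P} (mean_state u)"
  unfolding set_integrable_def mean_state_def
  by (intro borel_integrable_compact continuous_on_linear_flow mean_input_set_integrable u) auto

lemma mean_state_measurable:
  assumes u: "u \<in> controls M W P" shows "mean_state u \<in> borel_measurable borel"
proof -
  have [measurable]: "mean_input u \<in> borel_measurable borel"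
    using borel_measurable_integrable[OF mean_input_integrable[OF u]] by simp
  have "(\<lambda>y. linear_flow (a\<^sub>0 P + a\<^sub>1 P) t x (mean_input u) y) \<in> borel_measurable borel"
    by (rule measurable_linear_flow[of "\<lambda>v _. mean_input u v"]) measurable
  then show ?thesis by (simp add: mean_state_def)
qed

end

section \<open>Existence and uniqueness of the state\<close>

context complete_brownian begin

definition brownian_path :: "real \<Rightarrow> 'w \<Rightarrow> real" where
  "brownian_path = (SOME B. (\<forall>\<omega>\<in>space M. continuous_on UNIV (\<lambda>v. B v \<omega>))
     \<and> (AE \<omega> in M. \<forall>v\<ge>0. B v \<omega> = W v \<omega>)
     \<and> (\<forall>s v. 0 \<le> s \<longrightarrow> v \<le> s \<longrightarrow> B v \<in> borel_measurable (F s)))"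

lemma brownian_path:
  shows brownian_path_continuous: "\<omega> \<in> space M \<Longrightarrow> continuous_on UNIV (\<lambda>v. brownian_path v \<omega>)"
    and brownian_path_AE: "AE \<omega> in M. \<forall>v\<ge>0. brownian_path v \<omega> = W v \<omega>"
    and brownian_path_adapted: "0 \<le> s \<Longrightarrow> v \<le> s \<Longrightarrow> brownian_path v \<in> borel_measurable (F s)"
proof -
  have "\<exists>B. (\<forall>\<omega>\<in>space M. continuous_on UNIV (\<lambda>v. B v \<omega>))
     \<and> (AE \<omega> in M. \<forall>v\<ge>0. B v \<omega> = W v \<omega>)
     \<and> (\<forall>s v. 0 \<le> s \<longrightarrow> v \<le> s \<longrightarrow> B v \<in> borel_measurable (F s))"
    by (rule continuous_version) blast
  from someI_ex[OF this, folded brownian_path_def]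
  show "\<omega> \<in> space M \<Longrightarrow> continuous_on UNIV (\<lambda>v. brownian_path v \<omega>)"
    and "AE \<omega> in M. \<forall>v\<ge>0. brownian_path v \<omega> = W v \<omega>"
    and "0 \<le> s \<Longrightarrow> v \<le> s \<Longrightarrow> brownian_path v \<in> borel_measurable (F s)" by auto
qed

lemma brownian_path_progressive:
  assumes "0 \<le> s"
  shows "(\<lambda>p. brownian_path (min (fst p) s) (snd p)) \<in> borel_measurable (borel \<Otimes>\<^sub>M F s)"
proof -
  have "(\<lambda>(v, \<omega>). brownian_path (min v s) \<omega>) \<in> borel_measurable (borel \<Otimes>\<^sub>M F s)"
  proof (rule borel_measurable_continuous_in_first)
    show "continuous_on UNIV (\<lambda>v. brownian_path (min v s) \<omega>)" if "\<omega> \<in> space (F s)" for \<omega>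
      by (rule continuous_on_compose2[OF brownian_path_continuous]) (use that in \<open>auto intro!: continuous_intros\<close>)
  qed (use assms in \<open>auto intro: brownian_path_adapted\<close>)
  then show ?thesis by (simp add: case_prod_beta')
qed

lemma brownian_path_increment:
  assumes "0 \<le> s" "s \<le> v"
  shows "integrable M (\<lambda>\<omega>. brownian_path v \<omega> - brownian_path s \<omega>)"
    and "expectation (\<lambda>\<omega>. brownian_path v \<omega> - brownian_path s \<omega>) = 0"
    and "expectation (\<lambda>\<omega>. \<bar>brownian_path v \<omega> - brownian_path s \<omega>\<bar>) \<le> 1 + (v - s)"
proof -
  have [measurable]: "brownian_path v \<in> borel_measurable M" "brownian_path s \<in> borel_measurable M"
    using brownian_path_adapted[of v v] brownian_path_adapted[of s s] assms by (auto intro: measurable_F_imp_M)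
  have [measurable]: "W v \<in> borel_measurable M" "W s \<in> borel_measurable M"
    using assms by (auto intro: W_measurable)
  have eq: "AE \<omega> in M. brownian_path v \<omega> - brownian_path s \<omega> = W v \<omega> - W s \<omega>"
    using brownian_path_AE by eventually_elim (use assms in auto)
  show "integrable M (\<lambda>\<omega>. brownian_path v \<omega> - brownian_path s \<omega>)"
    using increment(1)[OF assms] eq by (subst integrable_cong_AE) auto
  show "expectation (\<lambda>\<omega>. brownian_path v \<omega> - brownian_path s \<omega>) = 0"
    using increment(2)[OF assms] eq by (subst integral_cong_AE[OF _ _ eq]) auto
  have "expectation (\<lambda>\<omega>. \<bar>brownian_path v \<omega> - brownian_path s \<omega>\<bar>) = expectation (\<lambda>\<omega>. \<bar>W v \<omega> - W s \<omega>\<bar>)"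
    using eq by (intro integral_cong_AE) auto
  then show "expectation (\<lambda>\<omega>. \<bar>brownian_path v \<omega> - brownian_path s \<omega>\<bar>) \<le> 1 + (v - s)"
    using increment(3)[OF assms] by simp
qed

end

context lq_problem begin

abbreviation noise :: "real \<Rightarrow> 'w \<Rightarrow> real" where
  "noise s \<omega> \<equiv> \<sigma> P * (brownian_path s \<omega> - brownian_path t \<omega>)"

lemma noise_progressive:
  assumes s: "t \<le> s"
  shows "(\<lambda>p. indicator {t..s} (fst p) * noise (fst p) (snd p)) \<in> borel_measurable (borel \<Otimes>\<^sub>M F s)"
proof -
  have [measurable]: "brownian_path t \<in> borel_measurable (F s)" using s time by (intro brownian_path_adapted) auto
  have [measurable]: "(\<lambda>p. brownian_path (min (fst p) s) (snd p)) \<in> borel_measurable (borel \<Otimes>\<^sub>M F s)"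
    using s time by (intro brownian_path_progressive) auto
  have "(\<lambda>p. indicator {t..s} (fst p) * (\<sigma> P * (brownian_path (min (fst p) s) (snd p) - brownian_path t (snd p)))) \<in> borel_measurable (borel \<Otimes>\<^sub>M F s)"
    by measurable
  also have "(\<lambda>p. indicator {t..s} (fst p) * (\<sigma> P * (brownian_path (min (fst p) s) (snd p) - brownian_path t (snd p))))
     = (\<lambda>p. indicator {t..s} (fst p) * noise (fst p) (snd p))"
    by (auto simp: indicator_def min_def)
  finally show ?thesis .
qed

lemma noise_integrable: "integrable (lborel \<Otimes>\<^sub>M M) (\<lambda>(v, \<omega>). indicator {t..horizon P} v * noise v \<omega>)"
proof (rule LM.Fubini_integrable)
  let ?T = "horizon P"
  have m: "(\<lambda>p. indicator {t..?T} (fst p) * noise (fst p) (snd p)) \<in> borel_measurable (borel \<Otimes>\<^sub>M M)"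
    by (rule measurable_pair_F_imp_M[OF noise_progressive[OF time(2)]])
  then show m': "(\<lambda>(v, \<omega>). indicator {t..?T} v * noise v \<omega>) \<in> borel_measurable (lborel \<Otimes>\<^sub>M M)"
    by (simp add: case_prod_beta' cong: measurable_cong_sets)
  show "AE v in lborel. integrable M (\<lambda>\<omega>. case (v, \<omega>) of (v, \<omega>) \<Rightarrow> indicator {t..?T} v * noise v \<omega>)"
    using brownian_path_increment(1)[OF time(1)] by (auto simp: indicator_def)
  show "integrable lborel (\<lambda>v. expectation (\<lambda>\<omega>. norm (case (v, \<omega>) of (v, \<omega>) \<Rightarrow> indicator {t..?T} v * noise v \<omega>)))"
  proof (rule Bochner_Integration.integrable_bound)
    show "integrable lborel (\<lambda>v. \<bar>\<sigma> P\<bar> * (1 + (?T - t)) * indicator {t..?T} v)"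
      by (intro integrable_mult_right integrable_real_indicator) (auto simp: emeasure_lborel_Icc_eq)
    show "(\<lambda>v. expectation (\<lambda>\<omega>. norm (case (v, \<omega>) of (v, \<omega>) \<Rightarrow> indicator {t..?T} v * noise v \<omega>))) \<in> borel_measurable lborel"
      using m by measurable
    have "\<bar>expectation (\<lambda>\<omega>. \<bar>\<sigma> P\<bar> * \<bar>brownian_path v \<omega> - brownian_path t \<omega>\<bar>)\<bar> \<le> \<bar>\<sigma> P\<bar> * (1 + (?T - t))" if "v \<in> {t..?T}" for v
    proof -
      have "expectation (\<lambda>\<omega>. \<bar>brownian_path v \<omega> - brownian_path t \<omega>\<bar>) \<le> 1 + (?T - t)"
        using brownian_path_increment(3)[OF time(1), of v] that by auto
      then show ?thesis by (auto simp: abs_mult intro!: mult_left_mono)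
    qed
    then show "AE v in lborel. norm (expectation (\<lambda>\<omega>. norm (case (v, \<omega>) of (v, \<omega>) \<Rightarrow> indicator {t..?T} v * noise v \<omega>)))
      \<le> norm (\<bar>\<sigma> P\<bar> * (1 + (?T - t)) * indicator {t..?T} v)"
      using time by (auto simp: indicator_def abs_mult)
  qed
qed

text \<open>The mean field term uses \<open>mean_state\<close>, so the state equation becomes a pathwise linear equation
  with known input. The summand \<open>a\<^sub>0\<close> times the noise appears because it is \<open>X\<close> minus the noise that
  has absolutely continuous paths.\<close>
definition forcing :: "(real \<Rightarrow> 'w \<Rightarrow> real) \<Rightarrow> real \<Rightarrow> 'w \<Rightarrow> real" where
  "forcing u v \<omega> = indicator {t..horizon P} v *
     (controlled_input P (full_control P t u) v \<omega> + a\<^sub>1 P * mean_state u v + a\<^sub>0 P * noise v \<omega>)"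

definition closed_state :: "(real \<Rightarrow> 'w \<Rightarrow> real) \<Rightarrow> real \<Rightarrow> 'w \<Rightarrow> real" where
  "closed_state u s \<omega> = linear_flow (a\<^sub>0 P) t x (\<lambda>v. forcing u v \<omega>) s + noise s \<omega>"

context
  fixes u :: "real \<Rightarrow> 'w \<Rightarrow> real"
  assumes u: "u \<in> controls M W P"
begin

lemma u_progressive: "progressively_measurable F (horizon P) u"
  using u by (simp add: controls_def)

text \<open>\<open>delay_kernel\<close> vanishes for positive \<open>\<xi>\<close>, so the input at times up to \<open>s\<close> uses the control only
  up to \<open>s\<close>.\<close>
lemma forcing_progressive:
  assumes s: "t \<le> s" "s \<le> horizon P"
  shows "(\<lambda>p. indicator {t..s} (fst p) * forcing u (fst p) (snd p)) \<in> borel_measurable (borel \<Otimes>\<^sub>M F s)"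
proof -
  let ?U = "\<lambda>v \<omega>. indicator {..s} v * full_control P t u v \<omega>"
  have [measurable]: "(\<lambda>p. controlled_input P ?U (fst p) (snd p)) \<in> borel_measurable (borel \<Otimes>\<^sub>M F s)"
    by (rule measurable_controlled_input[OF full_control_adapted[OF u_progressive s] kernel_measurable])
  note [measurable] = noise_progressive[OF s(1)] mean_state_measurable[OF u]
  have "(\<lambda>p. indicator {t..s} (fst p) * (controlled_input P ?U (fst p) (snd p) + a\<^sub>1 P * mean_state u (fst p))
     + a\<^sub>0 P * (indicator {t..s} (fst p) * noise (fst p) (snd p))) \<in> borel_measurable (borel \<Otimes>\<^sub>M F s)"
    by measurable
  also have "(\<lambda>p. indicator {t..s} (fst p) * (controlled_input P ?U (fst p) (snd p) + a\<^sub>1 P * mean_state u (fst p))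
     + a\<^sub>0 P * (indicator {t..s} (fst p) * noise (fst p) (snd p)))
     = (\<lambda>p. indicator {t..s} (fst p) * forcing u (fst p) (snd p))"
  proof
    fix p :: "real \<times> 'w"
    have "controlled_input P ?U v \<omega> = controlled_input P (full_control P t u) v \<omega>" if "v \<le> s" for v \<omega>
    proof -
      have "delay_kernel P \<xi> * ?U (v + \<xi>) \<omega> = delay_kernel P \<xi> * full_control P t u (v + \<xi>) \<omega>" for \<xi>
        using that by (auto simp: delay_kernel_def indicator_def)
      then have "(LINT \<xi>|lborel. delay_kernel P \<xi> * ?U (v + \<xi>) \<omega>) = (LINT \<xi>|lborel. delay_kernel P \<xi> * full_control P t u (v + \<xi>) \<omega>)"
        by (simp only:)
      then show ?thesis using that by (simp add: controlled_input_def)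
    qed
    then show "indicator {t..s} (fst p) * (controlled_input P ?U (fst p) (snd p) + a\<^sub>1 P * mean_state u (fst p))
     + a\<^sub>0 P * (indicator {t..s} (fst p) * noise (fst p) (snd p))
     = indicator {t..s} (fst p) * forcing u (fst p) (snd p)"
      using s by (auto simp: forcing_def indicator_def)
  qed
  finally show ?thesis .
qed

lemma forcing_integrable: "integrable (lborel \<Otimes>\<^sub>M M) (\<lambda>(v, \<omega>). forcing u v \<omega>)"
proof -
  let ?T = "horizon P"
  have "integrable (lborel \<Otimes>\<^sub>M M) (\<lambda>(v, \<omega>). (indicator {t..?T} v * mean_state u v) * (1 :: real))"
    by (rule LM.integrable_mult_pair) (use mean_state_set_integrable[OF u] in \<open>simp_all add: set_integrable_def\<close>)
  moreover have "integrable (lborel \<Otimes>\<^sub>M M) (\<lambda>p. indicator {t..?T} (fst p) * (case p of (v, \<omega>) \<Rightarrow> controlled_input P (full_control P t u) v \<omega>))"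
    by (rule integrable_bounded_mult[OF input_integrable[OF u], of _ 1]) auto
  ultimately have "integrable (lborel \<Otimes>\<^sub>M M) (\<lambda>p. indicator {t..?T} (fst p) * (case p of (v, \<omega>) \<Rightarrow> controlled_input P (full_control P t u) v \<omega>)
     + a\<^sub>1 P * (case p of (v, \<omega>) \<Rightarrow> (indicator {t..?T} v * mean_state u v) * (1 :: real))
     + a\<^sub>0 P * (case p of (v, \<omega>) \<Rightarrow> indicator {t..?T} v * noise v \<omega>))"
    using noise_integrable by (intro Bochner_Integration.integrable_add integrable_mult_right)
  then show ?thesis
    by (simp add: forcing_def case_prod_beta' algebra_simps)
qed

lemma forcing_AE_integrable: "AE \<omega> in M. integrable lborel (\<lambda>v. forcing u v \<omega>)"
  using LM.AE_integrable_snd[of "\<lambda>v \<omega>. forcing u v \<omega>"] forcing_integrable by simp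

lemma mean_forcing:
  "AE v in lborel. v \<in> {t..horizon P} \<longrightarrow> expectation (forcing u v) = mean_input u v + a\<^sub>1 P * mean_state u v"
  using LM.AE_integrable_fst[OF input_integrable[OF u]]
proof eventually_elim
  case (elim v)
  show ?case
  proof
    assume v: "v \<in> {t..horizon P}"
    have n: "integrable M (noise v)" "expectation (noise v) = 0"
      using brownian_path_increment(1,2)[OF time(1), of v] v by auto
    have "expectation (forcing u v) = expectation (\<lambda>\<omega>. controlled_input P (full_control P t u) v \<omega> + a\<^sub>1 P * mean_state u v + a\<^sub>0 P * noise v \<omega>)"
      using v by (simp add: forcing_def[abs_def])
    also have "\<dots> = mean_input u v + a\<^sub>1 P * mean_state u v"
      using elim n by (simp add: mean_input_def prob_space)
    finally show "expectation (forcing u v) = mean_input u v + a\<^sub>1 P * mean_state u v" .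
  qed
qed

lemma flow_as_integral:
  "linear_flow (a\<^sub>0 P) t x \<psi> s = exp (a\<^sub>0 P * (s - t)) * x
     + (LINT v|lborel. (indicator {t..s} v * exp (a\<^sub>0 P * (s - v))) * \<psi> v)"
  by (simp add: linear_flow_def set_lebesgue_integral_def mult.assoc)

lemma flow_weight_bound:
  assumes "s \<le> horizon P"
  shows "\<bar>indicator {t..s} v * exp (a\<^sub>0 P * (s - v))\<bar> \<le> exp (\<bar>a\<^sub>0 P\<bar> * (horizon P - t))"
proof -
  have "a\<^sub>0 P * (s - v) \<le> \<bar>a\<^sub>0 P\<bar> * (horizon P - t)" if "v \<in> {t..s}"
    using that assms by (intro mult_mono) auto
  then show ?thesis by (auto simp: indicator_def)
qed

lemma flow_integrable:
  assumes s: "s \<le> horizon P"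
  shows "integrable M (\<lambda>\<omega>. linear_flow (a\<^sub>0 P) t x (\<lambda>v. forcing u v \<omega>) s)"
    and "expectation (\<lambda>\<omega>. linear_flow (a\<^sub>0 P) t x (\<lambda>v. forcing u v \<omega>) s)
      = linear_flow (a\<^sub>0 P) t x (\<lambda>v. expectation (forcing u v)) s"
proof -
  have "integrable (lborel \<Otimes>\<^sub>M M) (\<lambda>p. (indicator {t..s} (fst p) * exp (a\<^sub>0 P * (s - fst p))) * (case p of (v, \<omega>) \<Rightarrow> forcing u v \<omega>))"
    by (rule integrable_bounded_mult[OF forcing_integrable _ flow_weight_bound[OF s]]) measurable
  then have i: "integrable (lborel \<Otimes>\<^sub>M M) (\<lambda>(v, \<omega>). (indicator {t..s} v * exp (a\<^sub>0 P * (s - v))) * forcing u v \<omega>)"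
    by (simp add: case_prod_beta')
  show "integrable M (\<lambda>\<omega>. linear_flow (a\<^sub>0 P) t x (\<lambda>v. forcing u v \<omega>) s)"
    unfolding flow_as_integral using LM.integrable_snd[OF i] by simp
  show "expectation (\<lambda>\<omega>. linear_flow (a\<^sub>0 P) t x (\<lambda>v. forcing u v \<omega>) s)
      = linear_flow (a\<^sub>0 P) t x (\<lambda>v. expectation (forcing u v)) s"
    unfolding flow_as_integral using LM.integrable_snd[OF i] LM.Fubini_integral[OF i]
    by (simp add: prob_space)
qed

text \<open>The construction is consistent: \<open>mean_state\<close>, which solves an equation with rate \<open>a\<^sub>0 + a\<^sub>1\<close>,
  and the mean of the constructed process, which solves one with rate \<open>a\<^sub>0\<close> and input
  \<open>a\<^sub>1 mean_state\<close>, differ by a solution of the homogeneous equation with rate \<open>a\<^sub>0\<close>.\<close>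
lemma mean_flow:
  assumes s: "s \<in> {t..horizon P}"
  shows "linear_flow (a\<^sub>0 P) t x (\<lambda>v. expectation (forcing u v)) s = mean_state u s"
proof -
  let ?T = "horizon P" and ?\<psi> = "\<lambda>v. mean_input u v + a\<^sub>1 P * mean_state u v"
  let ?n = "linear_flow (a\<^sub>0 P) t x ?\<psi>"
  have mi: "set_integrable lborel {t..?T} (mean_input u)" by (rule mean_input_set_integrable[OF u]) simp
  have \<psi>: "set_integrable lborel {t..?T} ?\<psi>"
    using mi mean_state_set_integrable[OF u] by (intro set_integral_add) auto
  have m: "mean_input u \<in> borel_measurable borel" 
    using borel_measurable_integrable[OF mean_input_integrable[OF u]] by simp
  note [measurable] = m mean_state_measurable[OF u] borel_measurable_integrable[OF LM.integrable_fst[OF forcing_integrable]]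
  have "linear_flow (a\<^sub>0 P) t x (\<lambda>v. expectation (forcing u v)) s = ?n s"
    unfolding flow_as_integral
    using mean_forcing s by (intro arg_cong2[where f = "(+)"] refl integral_cong_AE) (auto simp: indicator_def elim!: eventually_mono)
  moreover have "mean_state u s - ?n s = 0"
  proof (rule linear_integral_equation_zero[where k = "a\<^sub>0 P", OF _ _ s])
    have c: "continuous_on {t..?T} (mean_state u)" "continuous_on {t..?T} ?n"
      unfolding mean_state_def by (intro continuous_on_linear_flow mi, intro continuous_on_linear_flow \<psi>[unfolded mean_state_def])
    then show "continuous_on {t..?T} (\<lambda>s. mean_state u s - ?n s)" by (rule continuous_on_diff)
    fix s assume s: "s \<in> {t..?T}"
    have sub: "set_integrable lborel {t..s} f" if "set_integrable lborel {t..?T} f" for f :: "real \<Rightarrow> real"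
      by (rule set_integrable_subset[OF that]) (use s in auto)
    have cs: "set_integrable lborel {t..s} f" if "continuous_on {t..?T} f" for f :: "real \<Rightarrow> real"
      unfolding set_integrable_def
      by (intro borel_integrable_compact continuous_on_subset[OF that]) (use s in auto)
    have "mean_state u s - ?n s
      = (LINT v:{t..s}|lborel. (a\<^sub>0 P + a\<^sub>1 P) * mean_state u v + mean_input u v) - (LINT v:{t..s}|lborel. a\<^sub>0 P * ?n v + ?\<psi> v)"
      using linear_flow_equation[OF mi s, of "a\<^sub>0 P + a\<^sub>1 P" x] linear_flow_equation[OF \<psi> s, of "a\<^sub>0 P" x]
      by (simp add: mean_state_def)
    also have "\<dots> = (LINT v:{t..s}|lborel. ((a\<^sub>0 P + a\<^sub>1 P) * mean_state u v + mean_input u v) - (a\<^sub>0 P * ?n v + ?\<psi> v))"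
      by (rule set_integral_diff(2)[symmetric])
         (intro set_integral_add set_integrable_mult_right cs[OF c(1)] cs[OF c(2)] sub[OF mi] impI)+
    also have "\<dots> = (LINT v:{t..s}|lborel. a\<^sub>0 P * (mean_state u v - ?n v))"
      by (simp add: algebra_simps)
    finally show "mean_state u s - ?n s = (LINT v:{t..s}|lborel. a\<^sub>0 P * (mean_state u v - ?n v))" .
  qed
  ultimately show ?thesis by simp
qed

lemma closed_state_mean:
  assumes s: "s \<in> {t..horizon P}"
  shows "integrable M (closed_state u s)" and "expectation (closed_state u s) = mean_state u s"
proof -
  have n: "integrable M (noise s)" "expectation (noise s) = 0"
    using brownian_path_increment(1,2)[OF time(1), of s] s by auto
  show "integrable M (closed_state u s)"
    unfolding closed_state_def[abs_def] using flow_integrable(1)[of s] n s by simp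
  show "expectation (closed_state u s) = mean_state u s"
    unfolding closed_state_def[abs_def] using flow_integrable[of s] n s mean_flow[OF s] by simp
qed

lemma closed_state_adapted:
  assumes s: "s \<in> {t..horizon P}"
  shows "closed_state u s \<in> borel_measurable (F s)"
proof -
  have s': "t \<le> s" "s \<le> horizon P" using s by auto
  have [measurable]: "brownian_path s \<in> borel_measurable (F s)" "brownian_path t \<in> borel_measurable (F s)"
    using s time by (auto intro!: brownian_path_adapted)
  let ?f = "\<lambda>v \<omega>. indicator {t..s} v * forcing u v \<omega>"
  have "(\<lambda>p. ?f (snd p) (fst p)) \<in> borel_measurable (F s \<Otimes>\<^sub>M borel)"
    using measurable_compose[OF measurable_pair_swap' forcing_progressive[OF s']] by (simp add: case_prod_beta')
  then have "(\<lambda>\<omega>. linear_flow (a\<^sub>0 P) t x (\<lambda>v. ?f v \<omega>) s) \<in> borel_measurable (F s)"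
    by (rule measurable_linear_flow) simp
  moreover have "linear_flow (a\<^sub>0 P) t x (\<lambda>v. ?f v \<omega>) s = linear_flow (a\<^sub>0 P) t x (\<lambda>v. forcing u v \<omega>) s" for \<omega>
    by (rule linear_flow_cong) simp
  ultimately have [measurable]: "(\<lambda>\<omega>. linear_flow (a\<^sub>0 P) t x (\<lambda>v. forcing u v \<omega>) s) \<in> borel_measurable (F s)"
    by simp
  show ?thesis unfolding closed_state_def[abs_def] by measurable
qed

lemma closed_state_strong_solution: "strong_solution M W P t x u (closed_state u)"
  unfolding strong_solution_def
proof safe
  let ?T = "horizon P"
  show "closed_state u s \<in> borel_measurable (F s)" "integrable M (closed_state u s)" if "s \<in> {t..?T}" for s
    using closed_state_adapted[OF that] closed_state_mean(1)[OF that] by auto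
  show "AE \<omega> in M. continuous_on {t..?T} (\<lambda>s. closed_state u s \<omega>)
        \<and> set_integrable lborel {t..?T} (\<lambda>s. drift M P t u (closed_state u) s \<omega>)
        \<and> (\<forall>s\<in>{t..?T}. closed_state u s \<omega> =
             x + (LINT v:{t..s}|lborel. drift M P t u (closed_state u) v \<omega>) + \<sigma> P * (W s \<omega> - W t \<omega>))"
    using forcing_AE_integrable brownian_path_AE AE_space
  proof eventually_elim
    case (elim \<omega>)
    let ?Y = "linear_flow (a\<^sub>0 P) t x (\<lambda>v. forcing u v \<omega>)"
    have f: "set_integrable lborel {t..?T} (\<lambda>v. forcing u v \<omega>)"
      using integrable_mult_indicator[OF _ elim(1), of "{t..?T}"] by (simp add: set_integrable_def)
    have Y: "continuous_on {t..?T} ?Y" by (rule continuous_on_linear_flow[OF f])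
    have B: "continuous_on {t..?T} (\<lambda>v. brownian_path v \<omega>)"
      using brownian_path_continuous[OF elim(3)] by (rule continuous_on_subset) simp
    have drift: "drift M P t u (closed_state u) v \<omega> = a\<^sub>0 P * ?Y v + forcing u v \<omega>" if v: "v \<in> {t..?T}" for v
    proof -
      have "full_control P t u v \<omega> = u v \<omega>" using v by (simp add: full_control_def indicator_def)
      then have "drift M P t u (closed_state u) v \<omega> = a\<^sub>0 P * closed_state u v \<omega> + a\<^sub>1 P * mean_state u v
          + controlled_input P (full_control P t u) v \<omega>"
        by (simp add: drift_def closed_state_mean(2)[OF v] delayed_control[OF v] controlled_input_def)
      then show ?thesis using v by (simp add: forcing_def closed_state_def algebra_simps)
    qed
    have iY: "set_integrable lborel {t..?T} ?Y"
      unfolding set_integrable_def by (intro borel_integrable_compact Y) simp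
    have "set_integrable lborel {t..?T} (\<lambda>v. a\<^sub>0 P * ?Y v + forcing u v \<omega>)"
      by (intro set_integral_add set_integrable_mult_right iY f impI)
    moreover have "set_integrable lborel {t..?T} (\<lambda>v. a\<^sub>0 P * ?Y v + forcing u v \<omega>)
      \<longleftrightarrow> set_integrable lborel {t..?T} (\<lambda>v. drift M P t u (closed_state u) v \<omega>)"
      by (rule set_integrable_cong) (simp_all add: drift)
    ultimately have "set_integrable lborel {t..?T} (\<lambda>v. drift M P t u (closed_state u) v \<omega>)" by simp
    moreover have "closed_state u s \<omega> =
             x + (LINT v:{t..s}|lborel. drift M P t u (closed_state u) v \<omega>) + \<sigma> P * (W s \<omega> - W t \<omega>)"
      if s: "s \<in> {t..?T}" for s
    proof -
      have "(LINT v:{t..s}|lborel. drift M P t u (closed_state u) v \<omega>) = (LINT v:{t..s}|lborel. a\<^sub>0 P * ?Y v + forcing u v \<omega>)"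
        by (rule set_lebesgue_integral_cong) (use s in \<open>auto intro!: drift\<close>)
      moreover have "brownian_path s \<omega> = W s \<omega>" "brownian_path t \<omega> = W t \<omega>" using elim(2) s time by auto
      ultimately show ?thesis
        using linear_flow_equation[OF f s, of "a\<^sub>0 P" x] by (simp add: closed_state_def)
    qed
    moreover have "continuous_on {t..?T} (\<lambda>s. closed_state u s \<omega>)"
      unfolding closed_state_def by (intro continuous_intros Y B)
    ultimately show ?case by blast
  qed
qed

end

text \<open>The difference \<open>Z\<close> of two solutions satisfies, path by path, a linear equation with rate \<open>a\<^sub>0\<close> and
  deterministic input \<open>a\<^sub>1 E Z\<close>. So any two of its paths coincide: \<open>Z\<close> is almost surely a
  deterministic function, equal to its own mean, and as such solves the homogeneous equation with
  rate \<open>a\<^sub>0 + a\<^sub>1\<close>.\<close>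
lemma strong_solution_unique:
  assumes X: "strong_solution M W P t x u X" and Y: "strong_solution M W P t x u Y"
  shows "AE \<omega> in M. \<forall>s\<in>{t..horizon P}. X s \<omega> = Y s \<omega>"
proof -
  let ?T = "horizon P"
  \<comment> \<open>noise, control and delay terms cancel in the difference of the two equations\<close>
  define Z where "Z s \<omega> = X s \<omega> - Y s \<omega>" for s \<omega>
  define n where "n s = expectation (X s) - expectation (Y s)" for s
  define good where "good \<omega> \<longleftrightarrow> continuous_on {t..?T} (\<lambda>s. Z s \<omega>) \<and>
     (\<forall>s\<in>{t..?T}. set_integrable lborel {t..s} (\<lambda>v. a\<^sub>0 P * Z v \<omega> + a\<^sub>1 P * n v) \<and>
       Z s \<omega> = (LINT v:{t..s}|lborel. a\<^sub>0 P * Z v \<omega> + a\<^sub>1 P * n v))" for \<omega>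
  have "AE \<omega> in M. continuous_on {t..?T} (\<lambda>s. X s \<omega>)
        \<and> set_integrable lborel {t..?T} (\<lambda>s. drift M P t u X s \<omega>)
        \<and> (\<forall>s\<in>{t..?T}. X s \<omega> =
             x + (LINT v:{t..s}|lborel. drift M P t u X v \<omega>) + \<sigma> P * (W s \<omega> - W t \<omega>))"
    "AE \<omega> in M. continuous_on {t..?T} (\<lambda>s. Y s \<omega>)
        \<and> set_integrable lborel {t..?T} (\<lambda>s. drift M P t u Y s \<omega>)
        \<and> (\<forall>s\<in>{t..?T}. Y s \<omega> =
             x + (LINT v:{t..s}|lborel. drift M P t u Y v \<omega>) + \<sigma> P * (W s \<omega> - W t \<omega>))"
    using X Y unfolding strong_solution_def by blast+
  then have good: "AE \<omega> in M. good \<omega>"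
  proof eventually_elim
    case (elim \<omega>)
    have "set_integrable lborel {t..s} (\<lambda>v. a\<^sub>0 P * Z v \<omega> + a\<^sub>1 P * n v) \<and>
       Z s \<omega> = (LINT v:{t..s}|lborel. a\<^sub>0 P * Z v \<omega> + a\<^sub>1 P * n v)" if s: "s \<in> {t..?T}" for s
    proof -
      have d: "(\<lambda>v. drift M P t u X v \<omega> - drift M P t u Y v \<omega>) = (\<lambda>v. a\<^sub>0 P * Z v \<omega> + a\<^sub>1 P * n v)"
        by (simp add: drift_def Z_def n_def algebra_simps)
      have "set_integrable lborel {t..s} (\<lambda>v. drift M P t u X v \<omega>)"
        "set_integrable lborel {t..s} (\<lambda>v. drift M P t u Y v \<omega>)"
        using elim s by (auto intro: set_integrable_subset)
      from set_integral_diff[OF this, unfolded d]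
      have "set_integrable lborel {t..s} (\<lambda>v. a\<^sub>0 P * Z v \<omega> + a\<^sub>1 P * n v)"
        "(LINT v:{t..s}|lborel. a\<^sub>0 P * Z v \<omega> + a\<^sub>1 P * n v)
         = (LINT v:{t..s}|lborel. drift M P t u X v \<omega>) - (LINT v:{t..s}|lborel. drift M P t u Y v \<omega>)" .
      moreover have "Z s \<omega> = (LINT v:{t..s}|lborel. drift M P t u X v \<omega>) - (LINT v:{t..s}|lborel. drift M P t u Y v \<omega>)"
        using elim s by (simp add: Z_def)
      ultimately show ?thesis by simp
    qed
    then show ?case using elim by (auto simp: good_def Z_def intro!: continuous_on_diff)
  qed
  have same: "Z s \<omega> = Z s \<omega>'" if \<omega>: "good \<omega>" "good \<omega>'" and s: "s \<in> {t..?T}" for \<omega> \<omega>' s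
  proof -
    have "Z s \<omega> - Z s \<omega>' = 0"
    proof (rule linear_integral_equation_zero[where k = "a\<^sub>0 P", OF _ _ s])
      show "continuous_on {t..?T} (\<lambda>s. Z s \<omega> - Z s \<omega>')"
        using \<omega> by (auto simp: good_def intro!: continuous_on_diff)
      fix s assume s: "s \<in> {t..?T}"
      have "Z s \<omega> - Z s \<omega>' = (LINT v:{t..s}|lborel. (a\<^sub>0 P * Z v \<omega> + a\<^sub>1 P * n v) - (a\<^sub>0 P * Z v \<omega>' + a\<^sub>1 P * n v))"
        using \<omega> s by (subst set_integral_diff(2)) (auto simp: good_def)
      then show "Z s \<omega> - Z s \<omega>' = (LINT v:{t..s}|lborel. a\<^sub>0 P * (Z v \<omega> - Z v \<omega>'))"
        by (simp add: right_diff_distrib)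
    qed
    then show ?thesis by simp
  qed
  obtain \<omega>0 where \<omega>0: "good \<omega>0"
    using eventually_happens[OF good] by (auto simp: trivial_limit_def AE_False prob_space)
  have n: "n s = Z s \<omega>0" if s: "s \<in> {t..?T}" for s
  proof -
    have i: "integrable M (X s)" "integrable M (Y s)" using X Y s by (auto simp: strong_solution_def)
    have "n s = expectation (\<lambda>\<omega>. Z s \<omega>)" using i by (simp add: n_def Z_def)
    also have "\<dots> = expectation (\<lambda>_. Z s \<omega>0)"
    proof (rule integral_cong_AE)
      show "(\<lambda>\<omega>. Z s \<omega>) \<in> borel_measurable M" using i by (simp add: Z_def)
      show "AE \<omega> in M. Z s \<omega> = Z s \<omega>0" using good by eventually_elim (rule same[OF _ \<omega>0 s])
    qed simp
    finally show ?thesis by (simp add: prob_space)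
  qed
  have zero: "Z s \<omega>0 = 0" if s: "s \<in> {t..?T}" for s
  proof (rule linear_integral_equation_zero[where k = "a\<^sub>0 P + a\<^sub>1 P", OF _ _ s])
    show "continuous_on {t..?T} (\<lambda>s. Z s \<omega>0)" using \<omega>0 by (simp add: good_def)
    fix s assume s: "s \<in> {t..?T}"
    have "Z s \<omega>0 = (LINT v:{t..s}|lborel. a\<^sub>0 P * Z v \<omega>0 + a\<^sub>1 P * n v)" using \<omega>0 s by (auto simp: good_def)
    also have "\<dots> = (LINT v:{t..s}|lborel. (a\<^sub>0 P + a\<^sub>1 P) * Z v \<omega>0)"
      by (rule set_lebesgue_integral_cong) (use s in \<open>auto simp: n algebra_simps\<close>)
    finally show "Z s \<omega>0 = (LINT v:{t..s}|lborel. (a\<^sub>0 P + a\<^sub>1 P) * Z v \<omega>0)" .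
  qed
  show ?thesis
    using good
  proof eventually_elim
    case (elim \<omega>)
    show ?case using same[OF elim \<omega>0] zero by (auto simp: Z_def)
  qed
qed

lemma
  assumes u: "u \<in> controls M W P"
  shows state_strong_solution: "strong_solution M W P t x u (state M W P t x u)"
    and state_indistinguishable: "AE \<omega> in M. \<forall>s\<in>{t..horizon P}. state M W P t x u s \<omega> = closed_state u s \<omega>"
proof -
  show s: "strong_solution M W P t x u (state M W P t x u)"
    unfolding state_def using closed_state_strong_solution[OF u] by (rule someI[of "strong_solution M W P t x u"])
  show "AE \<omega> in M. \<forall>s\<in>{t..horizon P}. state M W P t x u s \<omega> = closed_state u s \<omega>"
    by (rule strong_solution_unique[OF s closed_state_strong_solution[OF u]])
qed

end

section \<open>Duality between mean state and control\<close>

text \<open>The adjoint of the map from the mean of the control to the mean of the input: substitute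
  \<open>v + \<xi>\<close> by \<open>v\<close>, then exchange the integrals.\<close>
lemma (in complete_brownian) mean_controlled_input_adjoint:
  assumes kernel: "integrable lborel (delay_kernel P)"
    and U: "integrable (lborel \<Otimes>\<^sub>M M) (\<lambda>(v, \<omega>). U v \<omega>)"
    and g: "g \<in> borel_measurable borel" and C: "\<And>v. \<bar>g v\<bar> \<le> C"
  shows "integrable lborel (\<lambda>v. (b\<^sub>0 P * g v + (LINT \<xi>|lborel. delay_kernel P \<xi> * g (v - \<xi>))) * expectation (U v))"
    and "(LINT v|lborel. g v * expectation (controlled_input P U v))
     = (LINT v|lborel. (b\<^sub>0 P * g v + (LINT \<xi>|lborel. delay_kernel P \<xi> * g (v - \<xi>))) * expectation (U v))"
proof -
  let ?u = "\<lambda>v. expectation (U v)"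
  have u: "integrable lborel ?u" by (rule LM.integrable_fst[OF U])
  note [measurable] = g
  have gL: "g \<in> borel_measurable lborel" using g by simp
  have gu: "integrable lborel (\<lambda>v. g v * ?u v)" by (rule integrable_bounded_mult[OF u gL C])
  have ku: "integrable (lborel \<Otimes>\<^sub>M lborel) (\<lambda>(\<xi>, v). delay_kernel P \<xi> * ?u v)"
    by (rule lborel_pair.integrable_mult_pair[OF kernel u])
  have "integrable (lborel \<Otimes>\<^sub>M lborel) (\<lambda>p. g (snd p - fst p) * (case p of (\<xi>, v) \<Rightarrow> delay_kernel P \<xi> * ?u v))"
    by (rule integrable_bounded_mult[OF ku _ C]) measurable
  then have gku: "integrable (lborel \<Otimes>\<^sub>M lborel) (\<lambda>(\<xi>, v). g (v - \<xi>) * (delay_kernel P \<xi> * ?u v))"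
    by (simp add: case_prod_beta')
  have in2: "(LINT \<xi>|lborel. g (v - \<xi>) * (delay_kernel P \<xi> * ?u v)) = (LINT \<xi>|lborel. delay_kernel P \<xi> * g (v - \<xi>)) * ?u v" for v
    by (simp add: mult.assoc[symmetric] mult.commute[of "g _"])
  have in1: "(LINT v|lborel. g (v - \<xi>) * (delay_kernel P \<xi> * ?u v)) = delay_kernel P \<xi> * (LINT v|lborel. g v * expectation (U (v + \<xi>)))" for \<xi>
  proof -
    have "(LINT v|lborel. g (v - \<xi>) * (delay_kernel P \<xi> * ?u v)) = (LINT v|lborel. delay_kernel P \<xi> * (g (v - \<xi>) * ?u v))"
      by (simp add: mult.left_commute)
    also have "\<dots> = delay_kernel P \<xi> * (LINT v|lborel. g (v - \<xi>) * ?u v)" by simp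
    also have "(LINT v|lborel. g (v - \<xi>) * ?u v) = (LINT v|lborel. g v * expectation (U (v + \<xi>)))"
      using lborel_integral_real_affine[of 1 "\<lambda>v. g (v - \<xi>) * ?u v" \<xi>] by (simp add: add.commute)
    finally show ?thesis .
  qed
  have d: "integrable lborel (\<lambda>v. (LINT \<xi>|lborel. delay_kernel P \<xi> * g (v - \<xi>)) * ?u v)"
    using lborel_pair.integrable_snd[OF gku] by (simp only: in2)
  have split: "(b\<^sub>0 P * g v + (LINT \<xi>|lborel. delay_kernel P \<xi> * g (v - \<xi>))) * ?u v
     = b\<^sub>0 P * (g v * ?u v) + (LINT \<xi>|lborel. delay_kernel P \<xi> * g (v - \<xi>)) * ?u v" for v
    by (simp add: distrib_right)
  show "integrable lborel (\<lambda>v. (b\<^sub>0 P * g v + (LINT \<xi>|lborel. delay_kernel P \<xi> * g (v - \<xi>))) * ?u v)"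
    unfolding split using gu d by simp
  have "(LINT \<xi>|lborel. delay_kernel P \<xi> * (LINT v|lborel. g v * expectation (U (v + \<xi>))))
      = (LINT v|lborel. (LINT \<xi>|lborel. delay_kernel P \<xi> * g (v - \<xi>)) * ?u v)"
    using lborel_pair.Fubini_integral[OF gku] by (simp only: in1 in2)
  then show "(LINT v|lborel. g v * expectation (controlled_input P U v))
     = (LINT v|lborel. (b\<^sub>0 P * g v + (LINT \<xi>|lborel. delay_kernel P \<xi> * g (v - \<xi>))) * ?u v)"
    unfolding mean_controlled_input[OF kernel U g C] split
    using gu d by simp
qed

lemma measurable_fundamental[measurable]: "fundamental P \<in> borel_measurable borel"
  unfolding fundamental_def[abs_def] by measurable

context lq_problem begin

lemma response_kernel:
  "response P \<tau> = b\<^sub>0 P * fundamental P \<tau> + (LINT \<xi>|lborel. delay_kernel P \<xi> * fundamental P (\<tau> + \<xi>))"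
  by (simp add: response_def set_lebesgue_integral_def delay_kernel_def mult.assoc)

lemma response_neg: "\<tau> < 0 \<Longrightarrow> response P \<tau> = 0"
proof -
  assume "\<tau> < 0"
  then have "delay_kernel P \<xi> * fundamental P (\<tau> + \<xi>) = 0" for \<xi>
    by (auto simp: delay_kernel_def fundamental_def indicator_def)
  then have "(LINT \<xi>|lborel. delay_kernel P \<xi> * fundamental P (\<tau> + \<xi>)) = 0" by (simp only: integral_zero)
  moreover have "fundamental P \<tau> = 0" using \<open>\<tau> < 0\<close> by (simp add: fundamental_def)
  ultimately show ?thesis by (simp add: response_kernel)
qed

lemma response_measurable[measurable]: "response P \<in> borel_measurable borel"
proof -
  note [measurable] = kernel_measurable
  show ?thesis unfolding response_kernel[abs_def] by measurable
qed

lemma response_bounded: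
  obtains C where "0 \<le> C" "\<And>\<tau>. \<tau> \<le> horizon P \<Longrightarrow> \<bar>response P \<tau>\<bar> \<le> C"
proof
  let ?e = "exp (\<bar>a\<^sub>0 P + a\<^sub>1 P\<bar> * horizon P)" and ?k = "LINT \<xi>|lborel. \<bar>delay_kernel P \<xi>\<bar>"
  show "0 \<le> \<bar>b\<^sub>0 P\<bar> * ?e + ?k * ?e" by simp
  fix \<tau> assume \<tau>: "\<tau> \<le> horizon P"
  have f: "\<bar>fundamental P \<rho>\<bar> \<le> ?e" if "\<rho> \<le> horizon P" for \<rho>
  proof -
    have "(a\<^sub>0 P + a\<^sub>1 P) * \<rho> \<le> \<bar>a\<^sub>0 P + a\<^sub>1 P\<bar> * horizon P" if "0 \<le> \<rho>"
      using that \<open>\<rho> \<le> horizon P\<close> by (intro mult_mono) auto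
    then show ?thesis by (simp add: fundamental_def indicator_def)
  qed
  have k: "\<bar>delay_kernel P \<xi> * fundamental P (\<tau> + \<xi>)\<bar> \<le> \<bar>delay_kernel P \<xi>\<bar> * ?e" for \<xi>
  proof (cases "\<xi> \<le> 0")
    case True
    then show ?thesis using f[of "\<tau> + \<xi>"] \<tau> by (auto simp: abs_mult intro!: mult_left_mono)
  qed (simp add: delay_kernel_def)
  have "\<bar>LINT \<xi>|lborel. delay_kernel P \<xi> * fundamental P (\<tau> + \<xi>)\<bar> \<le> (LINT \<xi>|lborel. \<bar>delay_kernel P \<xi>\<bar> * ?e)"
  proof (rule integral_abs_bound[THEN order_trans], rule integral_mono)
    note [measurable] = kernel_measurable
    show i: "integrable lborel (\<lambda>\<xi>. \<bar>delay_kernel P \<xi>\<bar> * ?e)" using kernel_integrable by simp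
    show "integrable lborel (\<lambda>\<xi>. \<bar>delay_kernel P \<xi> * fundamental P (\<tau> + \<xi>)\<bar>)"
      by (rule Bochner_Integration.integrable_bound[OF i]) (use k in \<open>auto intro: order_trans[OF _ abs_ge_self]\<close>)
  qed (rule k)
  then have "\<bar>LINT \<xi>|lborel. delay_kernel P \<xi> * fundamental P (\<tau> + \<xi>)\<bar> \<le> ?k * ?e" by simp
  moreover have "\<bar>b\<^sub>0 P * fundamental P \<tau>\<bar> \<le> \<bar>b\<^sub>0 P\<bar> * ?e"
    using f[OF \<tau>] by (auto simp: abs_mult intro!: mult_left_mono)
  ultimately show "\<bar>response P \<tau>\<bar> \<le> \<bar>b\<^sub>0 P\<bar> * ?e + ?k * ?e"
    unfolding response_kernel by (intro order_trans[OF abs_triangle_ineq] add_mono)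
qed

text \<open>Apply \<open>mean_controlled_input_adjoint\<close> to the Duhamel weight. On \<open>[t, T]\<close> its adjoint is
  \<open>response P (s - w)\<close>; before \<open>t\<close> both controls equal the prescribed past and cancel.\<close>
lemma mean_state_difference:
  assumes u: "u \<in> controls M W P" and v: "v \<in> controls M W P" and s: "s \<in> {t..horizon P}"
  shows "mean_state u s - mean_state v s
    = (LINT w:{t..s}|lborel. response P (s - w) * (indicator {t..horizon P} w * (expectation (u w) - expectation (v w))))"
proof -
  let ?T = "horizon P" and ?c = "a\<^sub>0 P + a\<^sub>1 P"
  define g where "g w = indicator {t..s} w * exp (?c * (s - w))" for w
  define \<rho> where "\<rho> w = b\<^sub>0 P * g w + (LINT \<xi>|lborel. delay_kernel P \<xi> * g (w - \<xi>))" for w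
  have g: "g \<in> borel_measurable borel" unfolding g_def[abs_def] by measurable
  have C: "\<bar>g w\<bar> \<le> exp (\<bar>?c\<bar> * (?T - t))" for w
  proof -
    have "?c * (s - w) \<le> \<bar>?c\<bar> * (?T - t)" if "w \<in> {t..s}"
      using that s by (intro mult_mono) auto
    then show ?thesis by (auto simp: g_def indicator_def)
  qed
  note adj = mean_controlled_input_adjoint[OF kernel_integrable full_control_integrable g C, folded \<rho>_def]
  have m: "mean_state y s = exp (?c * (s - t)) * x + (LINT w|lborel. g w * mean_input y w)" for y
    by (simp add: mean_state_def linear_flow_def set_lebesgue_integral_def g_def mult.assoc)
  have "mean_state u s - mean_state v s = (LINT w|lborel. \<rho> w * expectation (full_control P t u w)) - (LINT w|lborel. \<rho> w * expectation (full_control P t v w))"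
    using adj(2)[OF u] adj(2)[OF v] by (simp add: m mean_input_def)
  also have "\<dots> = (LINT w|lborel. \<rho> w * expectation (full_control P t u w) - \<rho> w * expectation (full_control P t v w))"
    using adj(1)[OF u] adj(1)[OF v] by simp
  also have "\<dots> = (LINT w|lborel. indicator {t..s} w * (response P (s - w) * (indicator {t..?T} w * (expectation (u w) - expectation (v w)))))"
  proof (rule Bochner_Integration.integral_cong[OF refl])
    fix w
    show "\<rho> w * expectation (full_control P t u w) - \<rho> w * expectation (full_control P t v w)
      = indicator {t..s} w * (response P (s - w) * (indicator {t..?T} w * (expectation (u w) - expectation (v w))))"
    proof (cases "w \<in> {t..?T}")
      case True
      then have full: "full_control P t y w = y w" for y :: "real \<Rightarrow> 'w \<Rightarrow> real"
        by (auto simp: full_control_def)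
      have "delay_kernel P \<xi> * g (w - \<xi>) = delay_kernel P \<xi> * fundamental P (s - w + \<xi>)" for \<xi>
        using True by (auto simp: delay_kernel_def g_def fundamental_def indicator_def algebra_simps)
      then have "(LINT \<xi>|lborel. delay_kernel P \<xi> * g (w - \<xi>)) = (LINT \<xi>|lborel. delay_kernel P \<xi> * fundamental P (s - w + \<xi>))"
        by (simp only:)
      moreover have "g w = fundamental P (s - w)"
        using True by (auto simp: g_def fundamental_def indicator_def)
      ultimately have "\<rho> w = response P (s - w)"
        by (simp add: \<rho>_def response_kernel)
      moreover have "response P (s - w) = 0" if "w \<notin> {t..s}"
        using that True by (intro response_neg) auto
      ultimately show ?thesis using True by (cases "w \<in> {t..s}") (auto simp: full right_diff_distrib)
    next
      case False
      then have "full_control P t u w = full_control P t v w" by (auto simp: full_control_def)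
      then show ?thesis using False by simp
    qed
  qed
  finally show ?thesis by (simp add: set_lebesgue_integral_def)
qed

lemma mean_control_integrable:
  assumes u: "u \<in> controls M W P"
  shows "integrable lborel (\<lambda>s. indicator {t..horizon P} s * expectation (u s))"
  using LM.integrable_fst[OF control_integrable[OF u]] by simp

lemma costate_measurable[measurable]: "costate P \<in> borel_measurable borel"
proof -
  have [measurable]: "(\<lambda>p. indicator {fst p..horizon P} (snd p) :: real) \<in> borel_measurable (borel \<Otimes>\<^sub>M lborel)"
    unfolding indicator_def atLeastAtMost_iff by measurable
  show ?thesis unfolding costate_def[abs_def] set_lebesgue_integral_def by measurable
qed

lemma costate_bounded: obtains C where "\<And>s. s \<in> {0..horizon P} \<Longrightarrow> \<bar>costate P s\<bar> \<le> C"
proof -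
  let ?T = "horizon P"
  obtain R where R: "0 \<le> R" "\<And>\<tau>. \<tau> \<le> ?T \<Longrightarrow> \<bar>response P \<tau>\<bar> \<le> R" by (rule response_bounded) blast
  define K where "K = exp (\<bar>rate P\<bar> * ?T) * R"
  have K: "\<bar>exp (- rate P * \<tau>) * response P \<tau>\<bar> \<le> K" if "\<tau> \<in> {0..?T}" for \<tau>
  proof -
    have "- rate P * \<tau> \<le> \<bar>rate P\<bar> * ?T" using that by (intro mult_mono) auto
    then show ?thesis using R(2)[of \<tau>] R(1) that by (auto simp: abs_mult K_def intro!: mult_mono)
  qed
  have "0 \<le> K" using R(1) by (simp add: K_def)
  show ?thesis
  proof
    fix s assume s: "s \<in> {0..?T}"
    have fin: "integrable lborel (\<lambda>v. K * indicator {0..?T} v)"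
      by (intro integrable_mult_right integrable_real_indicator) (auto simp: emeasure_lborel_Icc_eq)
    have b: "\<bar>indicator {s..?T} v * (exp (- rate P * (v - s)) * response P (v - s))\<bar> \<le> K * indicator {0..?T} v" for v
      using K[of "v - s"] s \<open>0 \<le> K\<close> by (auto simp: indicator_def)
    have "\<bar>LINT v:{s..?T}|lborel. exp (- rate P * (v - s)) * response P (v - s)\<bar> \<le> (LINT v|lborel. K * indicator {0..?T} v)"
      unfolding set_lebesgue_integral_def real_scaleR_def
    proof (rule integral_abs_bound[THEN order_trans], rule integral_mono[OF _ fin b])
      show "integrable lborel (\<lambda>v. \<bar>indicator {s..?T} v * (exp (- rate P * (v - s)) * response P (v - s))\<bar>)"
        by (rule Bochner_Integration.integrable_bound[OF fin]) (use b in \<open>auto intro: order_trans[OF _ abs_ge_self]\<close>)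
    qed
    also have "\<dots> = K * ?T" using s by simp
    finally have running: "\<bar>LINT v:{s..?T}|lborel. exp (- rate P * (v - s)) * response P (v - s)\<bar> \<le> K * ?T" .
    have terminal: "\<bar>exp (- rate P * (?T - s)) * response P (?T - s)\<bar> \<le> K" using s by (intro K) auto
    show "\<bar>costate P s\<bar> \<le> \<bar>l\<^sub>0 P - l\<^sub>1 P\<bar> * K + \<bar>\<alpha>\<^sub>0 P - \<alpha>\<^sub>1 P\<bar> * (K * ?T)"
      unfolding costate_def abs_mult[of "l\<^sub>0 P - l\<^sub>1 P"] abs_mult[of "\<alpha>\<^sub>0 P - \<alpha>\<^sub>1 P"]
      by (rule order_trans[OF abs_triangle_ineq])
         (unfold abs_mult[of "l\<^sub>0 P - l\<^sub>1 P"] abs_mult[of "\<alpha>\<^sub>0 P - \<alpha>\<^sub>1 P"],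
          intro add_mono mult_left_mono running terminal abs_ge_zero)
  qed
qed

text \<open>\<open>triangle_fubini\<close> with the kernel \<open>e\<^bsup>-r(s-t)\<^esup> R(s - w)\<close>: the inner integral over \<open>s\<close>, together
  with the terminal value of the kernel, is by definition \<open>e\<^bsup>-r(w-t)\<^esup>\<close> times the costate at \<open>w\<close>.\<close>
lemma duality:
  assumes u: "u \<in> controls M W P" and v: "v \<in> controls M W P"
  shows "(\<alpha>\<^sub>0 P - \<alpha>\<^sub>1 P) * (LINT s:{t..horizon P}|lborel. exp (- rate P * (s - t)) * (mean_state u s - mean_state v s))
     + exp (- rate P * (horizon P - t)) * ((l\<^sub>0 P - l\<^sub>1 P) * (mean_state u (horizon P) - mean_state v (horizon P)))
    = (LINT s:{t..horizon P}|lborel. exp (- rate P * (s - t)) * (costate P s * (expectation (u s) - expectation (v s))))"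
    (is ?eq)
    and "set_integrable lborel {t..horizon P} (\<lambda>s. exp (- rate P * (s - t)) * (costate P s * (expectation (u s) - expectation (v s))))"
proof -
  let ?T = "horizon P" and ?r = "rate P"
  define h where "h w = indicator {t..?T} w * (expectation (u w) - expectation (v w))" for w
  define G where "G s w = exp (- ?r * (s - t)) * response P (s - w)" for s w
  have "integrable lborel h"
    using Bochner_Integration.integrable_diff[OF mean_control_integrable[OF u] mean_control_integrable[OF v]]
    by (simp add: h_def[abs_def] right_diff_distrib)
  then have h: "set_integrable lborel {t..?T} h"
    using integrable_mult_indicator[of "{t..?T}" lborel h] by (simp add: set_integrable_def)
  obtain R where R: "0 \<le> R" "\<And>\<tau>. \<tau> \<le> ?T \<Longrightarrow> \<bar>response P \<tau>\<bar> \<le> R" by (rule response_bounded) blast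
  have exp_bound: "exp (- ?r * (s - t)) \<le> exp (\<bar>?r\<bar> * (?T - t))" if "s \<in> {t..?T}" for s
  proof -
    have "- ?r * (s - t) \<le> \<bar>?r\<bar> * (?T - t)" using that by (intro mult_mono) auto
    then show ?thesis by simp
  qed
  have Gm: "(\<lambda>(s, w). G s w) \<in> borel_measurable (borel \<Otimes>\<^sub>M borel)"
    unfolding G_def[abs_def] by measurable
  have Gb: "\<bar>G s w\<bar> \<le> exp (\<bar>?r\<bar> * (?T - t)) * R" if "t \<le> w" "w \<le> s" "s \<le> ?T" for s w
    using exp_bound[of s] R(2)[of "s - w"] R(1) that time by (auto simp: G_def abs_mult intro!: mult_mono)
  note tri = triangle_fubini[OF h Gm Gb]
  have dm: "mean_state u s - mean_state v s = (LINT w:{t..s}|lborel. response P (s - w) * h w)" if "s \<in> {t..?T}" for s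
    using mean_state_difference[OF u v that] by (simp add: h_def)
  have "(LINT s:{t..?T}|lborel. exp (- ?r * (s - t)) * (mean_state u s - mean_state v s))
      = (LINT s:{t..?T}|lborel. LINT w:{t..s}|lborel. G s w * h w)"
  proof (rule set_lebesgue_integral_cong)
    show "\<forall>s. s \<in> {t..?T} \<longrightarrow> exp (- ?r * (s - t)) * (mean_state u s - mean_state v s) = (LINT w:{t..s}|lborel. G s w * h w)"
    proof (intro allI impI)
      fix s assume s: "s \<in> {t..?T}"
      show "exp (- ?r * (s - t)) * (mean_state u s - mean_state v s) = (LINT w:{t..s}|lborel. G s w * h w)"
        unfolding dm[OF s] set_integral_mult_right[symmetric] G_def by (simp only: mult.assoc)
    qed
  qed simp
  also have "\<dots> = (LINT w:{t..?T}|lborel. (LINT s:{w..?T}|lborel. G s w) * h w)" by (rule tri(2))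
  finally have running: "(LINT s:{t..?T}|lborel. exp (- ?r * (s - t)) * (mean_state u s - mean_state v s))
      = (LINT w:{t..?T}|lborel. (LINT s:{w..?T}|lborel. G s w) * h w)" .
  have terminal: "exp (- ?r * (?T - t)) * (mean_state u ?T - mean_state v ?T) = (LINT w:{t..?T}|lborel. G ?T w * h w)"
  proof -
    have T: "?T \<in> {t..?T}" using time by simp
    show ?thesis unfolding dm[OF T] set_integral_mult_right[symmetric] G_def by (simp only: mult.assoc)
  qed
  have co: "exp (- ?r * (w - t)) * costate P w = (\<alpha>\<^sub>0 P - \<alpha>\<^sub>1 P) * (LINT s:{w..?T}|lborel. G s w) + (l\<^sub>0 P - l\<^sub>1 P) * G ?T w" for w
  proof -
    have e: "exp (- ?r * (w - t)) * (exp (- ?r * (s - w)) * y) = exp (- ?r * (s - t)) * y" for s y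
      by (simp add: mult.assoc[symmetric] mult_exp_exp right_diff_distrib)
    have "exp (- ?r * (w - t)) * (LINT s:{w..?T}|lborel. exp (- ?r * (s - w)) * response P (s - w)) = (LINT s:{w..?T}|lborel. G s w)"
      unfolding set_integral_mult_right[symmetric] G_def e ..
    moreover have "c * (b * y + d * z) = d * (c * z) + b * (c * y)" for b c d y z :: real
      by (simp add: algebra_simps)
    ultimately show ?thesis unfolding costate_def by (simp only: G_def e)
  qed
  have pointwise: "exp (- ?r * (w - t)) * (costate P w * (expectation (u w) - expectation (v w)))
      = (\<alpha>\<^sub>0 P - \<alpha>\<^sub>1 P) * ((LINT s:{w..?T}|lborel. G s w) * h w) + (l\<^sub>0 P - l\<^sub>1 P) * (G ?T w * h w)" if "w \<in> {t..?T}" for w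
  proof -
    have "exp (- ?r * (w - t)) * (costate P w * (expectation (u w) - expectation (v w))) = (exp (- ?r * (w - t)) * costate P w) * h w"
      using that by (simp add: h_def)
    then show ?thesis by (simp only: co distrib_right mult.assoc)
  qed
  obtain K where K: "\<And>s. s \<in> {0..?T} \<Longrightarrow> \<bar>costate P s\<bar> \<le> K" by (rule costate_bounded) blast
  show si: "set_integrable lborel {t..?T} (\<lambda>s. exp (- ?r * (s - t)) * (costate P s * (expectation (u s) - expectation (v s))))"
  proof -
    have "set_integrable lborel {t..?T} (\<lambda>s. (exp (- ?r * (s - t)) * costate P s) * h s)"
    proof (rule set_integrable_bounded_mult[OF h, where C = "exp (\<bar>?r\<bar> * (?T - t)) * K"])
      fix s assume s: "s \<in> {t..?T}"
      then show "\<bar>exp (- ?r * (s - t)) * costate P s\<bar> \<le> exp (\<bar>?r\<bar> * (?T - t)) * K"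
        using exp_bound[OF s] K[of s] time unfolding abs_mult by (intro mult_mono) auto
    qed (auto intro: costate_measurable)
    moreover have "set_integrable lborel {t..?T} (\<lambda>s. (exp (- ?r * (s - t)) * costate P s) * h s)
      \<longleftrightarrow> set_integrable lborel {t..?T} (\<lambda>s. exp (- ?r * (s - t)) * (costate P s * (expectation (u s) - expectation (v s))))"
      by (rule set_integrable_cong) (simp_all add: h_def mult.assoc)
    ultimately show ?thesis by simp
  qed
  have Gint: "set_integrable lborel {t..?T} (\<lambda>w. G ?T w * h w)"
  proof (rule set_integrable_bounded_mult[OF h, where C = "exp (\<bar>?r\<bar> * (?T - t)) * R"])
    show "G ?T \<in> borel_measurable borel" unfolding G_def[abs_def] by measurable
  qed (use time in \<open>auto intro: Gb\<close>)
  have Sint: "set_integrable lborel {t..?T} (\<lambda>w. (\<alpha>\<^sub>0 P - \<alpha>\<^sub>1 P) * ((LINT s:{w..?T}|lborel. G s w) * h w))"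
  proof -
    have "set_integrable lborel {t..?T} (\<lambda>s. exp (- ?r * (s - t)) * (costate P s * (expectation (u s) - expectation (v s)))
        - (l\<^sub>0 P - l\<^sub>1 P) * (G ?T s * h s))"
      by (intro set_integral_diff(1) si set_integrable_mult_right Gint impI)
    moreover have "set_integrable lborel {t..?T} (\<lambda>s. exp (- ?r * (s - t)) * (costate P s * (expectation (u s) - expectation (v s)))
        - (l\<^sub>0 P - l\<^sub>1 P) * (G ?T s * h s))
      \<longleftrightarrow> set_integrable lborel {t..?T} (\<lambda>w. (\<alpha>\<^sub>0 P - \<alpha>\<^sub>1 P) * ((LINT s:{w..?T}|lborel. G s w) * h w))"
      by (rule set_integrable_cong) (simp_all only: pointwise add_diff_cancel_right')
    ultimately show ?thesis by simp
  qed
  have "(\<alpha>\<^sub>0 P - \<alpha>\<^sub>1 P) * (LINT s:{t..?T}|lborel. exp (- ?r * (s - t)) * (mean_state u s - mean_state v s))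
     + exp (- ?r * (?T - t)) * ((l\<^sub>0 P - l\<^sub>1 P) * (mean_state u ?T - mean_state v ?T))
    = (LINT w:{t..?T}|lborel. (\<alpha>\<^sub>0 P - \<alpha>\<^sub>1 P) * ((LINT s:{w..?T}|lborel. G s w) * h w)) + (LINT w:{t..?T}|lborel. (l\<^sub>0 P - l\<^sub>1 P) * (G ?T w * h w))"
    unfolding running set_integral_mult_right terminal[symmetric] by (simp only: mult.left_commute)
  also have "\<dots> = (LINT w:{t..?T}|lborel. (\<alpha>\<^sub>0 P - \<alpha>\<^sub>1 P) * ((LINT s:{w..?T}|lborel. G s w) * h w) + (l\<^sub>0 P - l\<^sub>1 P) * (G ?T w * h w))"
    by (rule set_integral_add(2)[symmetric]) (intro Sint set_integrable_mult_right Gint impI)+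
  also have "\<dots> = (LINT s:{t..?T}|lborel. exp (- ?r * (s - t)) * (costate P s * (expectation (u s) - expectation (v s))))"
    by (rule set_lebesgue_integral_cong) (simp, intro allI impI, rule pointwise[symmetric])
  finally show ?eq .
qed

end

section \<open>The gain in terms of moments, and its maximiser\<close>

context lq_problem begin

definition mean_gain :: "(real \<Rightarrow> 'w \<Rightarrow> real) \<Rightarrow> real \<Rightarrow> real" where
  "mean_gain u s = (\<alpha>\<^sub>0 P - \<alpha>\<^sub>1 P) * mean_state u s - (\<beta>\<^sub>0 P + \<beta>\<^sub>1 P) * expectation (u s)
     - \<gamma>\<^sub>0 P * expectation (\<lambda>\<omega>. (u s \<omega>)\<^sup>2) - \<gamma>\<^sub>1 P * (expectation (u s))\<^sup>2"

context
  fixes u :: "real \<Rightarrow> 'w \<Rightarrow> real"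
  assumes u: "u \<in> controls M W P"
begin

lemma flow_pair_measurable:
  "(\<lambda>p. linear_flow (a\<^sub>0 P) t x (\<lambda>v. forcing u v (snd p)) (fst p)) \<in> borel_measurable (borel \<Otimes>\<^sub>M M)"
proof (rule measurable_linear_flow)
  have f: "(\<lambda>p. forcing u (fst p) (snd p)) \<in> borel_measurable (borel \<Otimes>\<^sub>M M)"
    using borel_measurable_integrable[OF forcing_integrable[OF u]] by (simp add: case_prod_beta' cong: measurable_cong_sets)
  have "(\<lambda>q. (snd q, snd (fst q))) \<in> measurable ((borel \<Otimes>\<^sub>M M) \<Otimes>\<^sub>M borel) (borel \<Otimes>\<^sub>M M)" by measurable
  from measurable_compose[OF this f]
  show "(\<lambda>q. forcing u (snd q) (snd (fst q))) \<in> borel_measurable ((borel \<Otimes>\<^sub>M M) \<Otimes>\<^sub>M borel)" by simp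
qed measurable

text \<open>The bound uniform in \<open>s\<close> is what allows the expectation and the time integral in \<open>J\<close> to be
  exchanged.\<close>
lemma flow_abs_mean_bounded:
  obtains K where "0 \<le> K"
    "\<And>s. s \<in> {t..horizon P} \<Longrightarrow> expectation (\<lambda>\<omega>. \<bar>linear_flow (a\<^sub>0 P) t x (\<lambda>v. forcing u v \<omega>) s\<bar>) \<le> K"
proof
  let ?T = "horizon P" and ?C = "exp (\<bar>a\<^sub>0 P\<bar> * (horizon P - t))"
  let ?\<Phi> = "\<lambda>\<omega>. LINT v|lborel. \<bar>forcing u v \<omega>\<bar>"
  have "integrable (lborel \<Otimes>\<^sub>M M) (\<lambda>(v, \<omega>). \<bar>forcing u v \<omega>\<bar>)"
    using integrable_abs[OF forcing_integrable[OF u]] by (simp add: case_prod_beta')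
  then have \<Phi>: "integrable M ?\<Phi>" by (rule LM.integrable_snd)
  have "0 \<le> expectation ?\<Phi>" by (intro integral_nonneg_AE) auto
  then show "0 \<le> ?C * \<bar>x\<bar> + ?C * expectation ?\<Phi>" by simp
  fix s assume s: "s \<in> {t..?T}"
  have "expectation (\<lambda>\<omega>. \<bar>linear_flow (a\<^sub>0 P) t x (\<lambda>v. forcing u v \<omega>) s\<bar>) \<le> expectation (\<lambda>\<omega>. ?C * \<bar>x\<bar> + ?C * ?\<Phi> \<omega>)"
  proof (rule integral_mono_AE)
    show "integrable M (\<lambda>\<omega>. \<bar>linear_flow (a\<^sub>0 P) t x (\<lambda>v. forcing u v \<omega>) s\<bar>)"
      using flow_integrable(1)[OF u, of s] s by simp
    show "integrable M (\<lambda>\<omega>. ?C * \<bar>x\<bar> + ?C * ?\<Phi> \<omega>)" using \<Phi> by simp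
    show "AE \<omega> in M. \<bar>linear_flow (a\<^sub>0 P) t x (\<lambda>v. forcing u v \<omega>) s\<bar> \<le> ?C * \<bar>x\<bar> + ?C * ?\<Phi> \<omega>"
      using forcing_AE_integrable[OF u]
    proof eventually_elim
      case (elim \<omega>)
      let ?w = "\<lambda>v. indicator {t..s} v * exp (a\<^sub>0 P * (s - v))"
      have w: "\<bar>?w v\<bar> \<le> ?C" for v by (rule flow_weight_bound[OF u]) (use s in auto)
      have "\<bar>LINT v|lborel. ?w v * forcing u v \<omega>\<bar> \<le> (LINT v|lborel. ?C * \<bar>forcing u v \<omega>\<bar>)"
      proof (rule integral_abs_bound[THEN order_trans], rule integral_mono)
        show "integrable lborel (\<lambda>v. \<bar>?w v * forcing u v \<omega>\<bar>)"
          by (intro integrable_abs integrable_bounded_mult[OF elim _ w]) measurable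
        show "integrable lborel (\<lambda>v. ?C * \<bar>forcing u v \<omega>\<bar>)" using elim by simp
        show "\<bar>?w v * forcing u v \<omega>\<bar> \<le> ?C * \<bar>forcing u v \<omega>\<bar>" for v
          unfolding abs_mult[of "?w v"] by (rule mult_right_mono[OF w abs_ge_zero])
      qed
      moreover have "\<bar>exp (a\<^sub>0 P * (s - t)) * x\<bar> \<le> ?C * \<bar>x\<bar>"
        using w[of t] s unfolding abs_mult by (intro mult_right_mono) auto
      ultimately show ?case
        unfolding flow_as_integral[OF u] by (intro order_trans[OF abs_triangle_ineq] add_mono) auto
    qed
  qed
  then show "expectation (\<lambda>\<omega>. \<bar>linear_flow (a\<^sub>0 P) t x (\<lambda>v. forcing u v \<omega>) s\<bar>) \<le> ?C * \<bar>x\<bar> + ?C * expectation ?\<Phi>"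
    using \<Phi> by (simp add: prob_space)
qed

lemma closed_state_integrable:
  "integrable (lborel \<Otimes>\<^sub>M M) (\<lambda>(s, \<omega>). indicator {t..horizon P} s * closed_state u s \<omega>)"
proof -
  let ?T = "horizon P" and ?f = "\<lambda>s \<omega>. linear_flow (a\<^sub>0 P) t x (\<lambda>v. forcing u v \<omega>) s"
  note [measurable] = flow_pair_measurable
  have "integrable (lborel \<Otimes>\<^sub>M M) (\<lambda>(s, \<omega>). indicator {t..?T} s * ?f s \<omega>)"
  proof (rule LM.Fubini_integrable)
    show "(\<lambda>(s, \<omega>). indicator {t..?T} s * ?f s \<omega>) \<in> borel_measurable (lborel \<Otimes>\<^sub>M M)"
      unfolding case_prod_beta' by measurable
    show "AE s in lborel. integrable M (\<lambda>\<omega>. case (s, \<omega>) of (s, \<omega>) \<Rightarrow> indicator {t..?T} s * ?f s \<omega>)"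
      using flow_integrable(1)[OF u] by (auto simp: indicator_def)
    obtain K where K: "0 \<le> K" "\<And>s. s \<in> {t..?T} \<Longrightarrow> expectation (\<lambda>\<omega>. \<bar>?f s \<omega>\<bar>) \<le> K"
      by (rule flow_abs_mean_bounded) blast
    show "integrable lborel (\<lambda>s. expectation (\<lambda>\<omega>. norm (case (s, \<omega>) of (s, \<omega>) \<Rightarrow> indicator {t..?T} s * ?f s \<omega>)))"
    proof (rule Bochner_Integration.integrable_bound)
      show "integrable lborel (\<lambda>s. K * indicator {t..?T} s)"
        by (intro integrable_mult_right integrable_real_indicator) (auto simp: emeasure_lborel_Icc_eq)
      show "(\<lambda>s. expectation (\<lambda>\<omega>. norm (case (s, \<omega>) of (s, \<omega>) \<Rightarrow> indicator {t..?T} s * ?f s \<omega>))) \<in> borel_measurable lborel"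
        unfolding prod.case by measurable
      have "0 \<le> expectation (\<lambda>\<omega>. \<bar>?f s \<omega>\<bar>)" for s by (intro integral_nonneg_AE) auto
      then show "AE s in lborel. norm (expectation (\<lambda>\<omega>. norm (case (s, \<omega>) of (s, \<omega>) \<Rightarrow> indicator {t..?T} s * ?f s \<omega>)))
          \<le> norm (K * indicator {t..?T} s)"
        using K by (auto simp: indicator_def)
    qed
  qed
  from Bochner_Integration.integrable_add[OF this noise_integrable]
  show ?thesis by (simp add: closed_state_def case_prod_beta' distrib_left)
qed

lemma control_moments_AE:
  "AE s in lborel. s \<in> {t..horizon P} \<longrightarrow> integrable M (u s) \<and> integrable M (\<lambda>\<omega>. (u s \<omega>)\<^sup>2)"
  using LM.AE_integrable_fst[OF control_integrable[OF u]] LM.AE_integrable_fst[OF control_square_integrable[OF u]]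
  by eventually_elim auto

lemma mean_square_le:
  "AE s in lborel. s \<in> {t..horizon P} \<longrightarrow> (expectation (u s))\<^sup>2 \<le> expectation (\<lambda>\<omega>. (u s \<omega>)\<^sup>2)"
  using control_moments_AE
proof eventually_elim
  case (elim s)
  show ?case
  proof
    assume "s \<in> {t..horizon P}"
    with elim have i: "integrable M (u s)" "integrable M (\<lambda>\<omega>. (u s \<omega>)\<^sup>2)" by auto
    show "(expectation (u s))\<^sup>2 \<le> expectation (\<lambda>\<omega>. (u s \<omega>)\<^sup>2)"
      using variance_eq[OF i] variance_positive[of "u s"] by simp
  qed
qed

lemma mean_control_square_integrable:
  "integrable lborel (\<lambda>s. indicator {t..horizon P} s * (expectation (u s))\<^sup>2)"
proof (rule Bochner_Integration.integrable_bound)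
  show "integrable lborel (\<lambda>s. indicator {t..horizon P} s * expectation (\<lambda>\<omega>. (u s \<omega>)\<^sup>2))"
    using LM.integrable_fst[OF control_square_integrable[OF u]] by simp
  have "(\<lambda>s. (indicator {t..horizon P} s * expectation (u s))\<^sup>2) \<in> borel_measurable lborel"
    using borel_measurable_integrable[OF mean_control_integrable[OF u]] by measurable
  also have "(\<lambda>s. (indicator {t..horizon P} s * expectation (u s))\<^sup>2) = (\<lambda>s. indicator {t..horizon P} s * (expectation (u s))\<^sup>2)"
    by (auto simp: indicator_def)
  finally show "(\<lambda>s. indicator {t..horizon P} s * (expectation (u s))\<^sup>2) \<in> borel_measurable lborel" .
  show "AE s in lborel. norm (indicator {t..horizon P} s * (expectation (u s))\<^sup>2)
      \<le> norm (indicator {t..horizon P} s * expectation (\<lambda>\<omega>. (u s \<omega>)\<^sup>2))"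
    using mean_square_le by eventually_elim (auto simp: indicator_def intro: order_trans[OF _ abs_ge_self])
qed

text \<open>Replace the chosen state by the explicit one, to which it is equal almost surely, and exchange
  expectation and time integral.\<close>
lemma J_eq:
  shows "set_integrable lborel {t..horizon P} (\<lambda>s. exp (- rate P * (s - t)) * mean_gain u s)"
    and "J M W P t x u = (LINT s:{t..horizon P}|lborel. exp (- rate P * (s - t)) * mean_gain u s)
      + exp (- rate P * (horizon P - t)) * ((l\<^sub>0 P - l\<^sub>1 P) * mean_state u (horizon P))"
proof -
  let ?T = "horizon P" and ?X = "closed_state u" and ?S = "state M W P t x u"
  let ?e = "\<lambda>s. exp (- rate P * (s - t))" and ?I = "\<lambda>s. indicator {t..?T} s :: real"
  have T: "?T \<in> {t..?T}" using time by simp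
  \<comment> \<open>the terms of the running gain that do not depend on \<open>\<omega>\<close>\<close>
  define D where "D s = ?I s * (- \<alpha>\<^sub>1 P * mean_state u s - \<beta>\<^sub>1 P * expectation (u s) - \<gamma>\<^sub>1 P * (expectation (u s))\<^sup>2)" for s
  define G where "G s \<omega> = \<alpha>\<^sub>0 P * (?I s * ?X s \<omega>) - \<beta>\<^sub>0 P * (?I s * u s \<omega>) - \<gamma>\<^sub>0 P * (?I s * (u s \<omega>)\<^sup>2) + D s" for s \<omega>
  have G_eq: "G s \<omega> = ?I s * running_gain P s (?X s \<omega>) (mean_state u s) (u s \<omega>) (expectation (u s))" for s \<omega>
    by (simp add: G_def D_def running_gain_def algebra_simps)
  have "integrable lborel (\<lambda>s. - \<alpha>\<^sub>1 P * (?I s * mean_state u s) - \<beta>\<^sub>1 P * (?I s * expectation (u s)) - \<gamma>\<^sub>1 P * (?I s * (expectation (u s))\<^sup>2))"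
    using mean_state_set_integrable[OF u] mean_control_integrable[OF u] mean_control_square_integrable
    by (intro Bochner_Integration.integrable_diff integrable_mult_right) (simp_all add: set_integrable_def)
  then have "integrable lborel D" by (simp add: D_def[abs_def] algebra_simps)
  then have "integrable (lborel \<Otimes>\<^sub>M M) (\<lambda>(s, \<omega>). D s * (1 :: real))" by (rule LM.integrable_mult_pair) simp
  then have G: "integrable (lborel \<Otimes>\<^sub>M M) (\<lambda>(s, \<omega>). G s \<omega>)"
    using closed_state_integrable control_integrable[OF u] control_square_integrable[OF u]
    unfolding G_def case_prod_beta'
    by (intro Bochner_Integration.integrable_add Bochner_Integration.integrable_diff integrable_mult_right) simp_all
  have eb: "\<bar>?I s * ?e s\<bar> \<le> exp (\<bar>rate P\<bar> * (?T - t))" for s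
  proof -
    have "- rate P * (s - t) \<le> \<bar>rate P\<bar> * (?T - t)" if "s \<in> {t..?T}"
      using that by (intro mult_mono) auto
    then show ?thesis by (auto simp: indicator_def)
  qed
  have "integrable (lborel \<Otimes>\<^sub>M M) (\<lambda>p. (?I (fst p) * ?e (fst p)) * (case p of (s, \<omega>) \<Rightarrow> G s \<omega>))"
    by (rule integrable_bounded_mult[OF G _ eb]) measurable
  then have eG: "integrable (lborel \<Otimes>\<^sub>M M) (\<lambda>(s, \<omega>). ?I s * ?e s * G s \<omega>)"
    by (simp add: case_prod_beta')
  have mean_G: "AE s in lborel. expectation (\<lambda>\<omega>. ?I s * ?e s * G s \<omega>) = ?I s * (?e s * mean_gain u s)"
    using control_moments_AE
  proof eventually_elim
    case (elim s)
    show ?case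
    proof (cases "s \<in> {t..?T}")
      case True
      then have i: "integrable M (u s)" "integrable M (\<lambda>\<omega>. (u s \<omega>)\<^sup>2)" using elim by auto
      note X = closed_state_mean[OF u True]
      have "expectation (G s) = \<alpha>\<^sub>0 P * mean_state u s - \<beta>\<^sub>0 P * expectation (u s) - \<gamma>\<^sub>0 P * expectation (\<lambda>\<omega>. (u s \<omega>)\<^sup>2) + D s"
        unfolding G_def[abs_def] using True i X by (simp add: prob_space)
      also have "\<dots> = mean_gain u s"
        using True by (simp add: D_def mean_gain_def algebra_simps)
      finally show ?thesis using True by simp
    qed simp
  qed
  have mG: "(\<lambda>s. ?I s * (?e s * mean_gain u s)) \<in> borel_measurable lborel"
  proof -
    have "(\<lambda>s. - \<beta>\<^sub>0 P * (?I s * expectation (u s)) - \<gamma>\<^sub>0 P * (?I s * expectation (\<lambda>\<omega>. (u s \<omega>)\<^sup>2)) + D s + \<alpha>\<^sub>0 P * (?I s * mean_state u s)) \<in> borel_measurable lborel"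
      using borel_measurable_integrable[OF \<open>integrable lborel D\<close>] borel_measurable_integrable[OF mean_control_integrable[OF u]]
        borel_measurable_integrable[OF LM.integrable_fst[OF control_square_integrable[OF u]]] mean_state_measurable[OF u]
      by simp
    also have "(\<lambda>s. - \<beta>\<^sub>0 P * (?I s * expectation (u s)) - \<gamma>\<^sub>0 P * (?I s * expectation (\<lambda>\<omega>. (u s \<omega>)\<^sup>2)) + D s + \<alpha>\<^sub>0 P * (?I s * mean_state u s))
       = (\<lambda>s. ?I s * mean_gain u s)"
      by (auto simp: D_def mean_gain_def algebra_simps)
    finally have [measurable]: "(\<lambda>s. ?I s * mean_gain u s) \<in> borel_measurable lborel" .
    have "(\<lambda>s. ?e s * (?I s * mean_gain u s)) \<in> borel_measurable lborel" by measurable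
    then show ?thesis by (simp add: mult.left_commute)
  qed
  note mEG = borel_measurable_integrable[OF LM.integrable_fst[OF eG]]
  show si: "set_integrable lborel {t..?T} (\<lambda>s. ?e s * mean_gain u s)"
    unfolding set_integrable_def real_scaleR_def
    by (rule integrable_cong_AE[THEN iffD1, OF mEG mG mean_G LM.integrable_fst[OF eG]])
  define R where "R \<omega> = (LINT s|lborel. ?I s * ?e s * G s \<omega>) + ?e ?T * terminal_gain P (?X ?T \<omega>) (mean_state u ?T)" for \<omega>
  have tg: "integrable M (\<lambda>\<omega>. terminal_gain P (?X ?T \<omega>) (mean_state u ?T))"
    "expectation (\<lambda>\<omega>. terminal_gain P (?X ?T \<omega>) (mean_state u ?T)) = (l\<^sub>0 P - l\<^sub>1 P) * mean_state u ?T"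
    using closed_state_mean[OF u T] by (simp_all add: terminal_gain_def prob_space left_diff_distrib)
  have R: "integrable M R" unfolding R_def[abs_def] using LM.integrable_snd[OF eG] tg(1) by simp
  have mean_S: "expectation (?S s) = mean_state u s" if s: "s \<in> {t..?T}" for s
  proof -
    have "integrable M (?S s)" using state_strong_solution[OF u] s by (auto simp: strong_solution_def)
    then have "expectation (?S s) = expectation (?X s)"
      using closed_state_mean(1)[OF u s] state_indistinguishable[OF u] s by (intro integral_cong_AE) auto
    then show ?thesis using closed_state_mean(2)[OF u s] by simp
  qed
  let ?J = "\<lambda>\<omega>. (LINT s:{t..?T}|lborel. ?e s *
          running_gain P s (?S s \<omega>) (expectation (?S s)) (u s \<omega>) (expectation (u s)))
       + ?e ?T * terminal_gain P (?S ?T \<omega>) (expectation (?S ?T))"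
  have "AE \<omega> in M. R \<omega> = ?J \<omega>"
    using state_indistinguishable[OF u]
  proof eventually_elim
    case (elim \<omega>)
    have "(LINT s|lborel. ?I s * ?e s * G s \<omega>) = (LINT s:{t..?T}|lborel. ?e s *
          running_gain P s (?S s \<omega>) (expectation (?S s)) (u s \<omega>) (expectation (u s)))"
      unfolding set_lebesgue_integral_def
      by (rule Bochner_Integration.integral_cong) (use elim mean_S in \<open>auto simp: G_eq indicator_def\<close>)
    then show ?case using elim mean_S[OF T] T by (simp add: R_def)
  qed
  then have "expectation ?J = expectation R"
    using measurable_AE_eq[OF borel_measurable_integrable[OF R]] R
    by (intro integral_cong_AE) auto
  also have "\<dots> = (LINT s|lborel. expectation (\<lambda>\<omega>. ?I s * ?e s * G s \<omega>)) + ?e ?T * ((l\<^sub>0 P - l\<^sub>1 P) * mean_state u ?T)"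
    unfolding R_def[abs_def] using LM.integrable_snd[OF eG] tg LM.Fubini_integral[OF eG] by simp
  also have "(LINT s|lborel. expectation (\<lambda>\<omega>. ?I s * ?e s * G s \<omega>)) = (LINT s|lborel. ?I s * (?e s * mean_gain u s))"
    by (rule integral_cong_AE[OF mEG mG mean_G])
  finally show "J M W P t x u = (LINT s:{t..?T}|lborel. ?e s * mean_gain u s) + ?e ?T * ((l\<^sub>0 P - l\<^sub>1 P) * mean_state u ?T)"
    by (simp add: J_def Let_def set_lebesgue_integral_def)
qed

end

lemma deterministic_control:
  assumes c: "c \<in> borel_measurable borel" and C: "\<And>s. s \<in> {0..horizon P} \<Longrightarrow> \<bar>c s\<bar> \<le> C"
    and eq: "\<And>s. s \<in> {0..horizon P} \<Longrightarrow> k s = c s"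
  shows "(\<lambda>s \<omega>. k s) \<in> controls M W P"
proof -
  let ?T = "horizon P" and ?R = "restrict_space lborel {0..horizon P}"
  interpret R: finite_measure ?R by (rule finite_restrict)
  interpret RM: pair_sigma_finite ?R M ..
  have k: "k \<in> borel_measurable (restrict_space borel {0..s})" if "s \<le> ?T" for s
  proof -
    have "c \<in> borel_measurable (restrict_space borel {0..s})" by (rule measurable_restrict_space1[OF c])
    moreover have "k \<in> borel_measurable (restrict_space borel {0..s}) \<longleftrightarrow> c \<in> borel_measurable (restrict_space borel {0..s})"
      by (rule measurable_cong) (use that in \<open>auto simp: space_restrict_space eq\<close>)
    ultimately show ?thesis by simp
  qed
  have "progressively_measurable F ?T (\<lambda>s \<omega>. k s)"
    unfolding progressively_measurable_def case_prod_beta'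
    using k by (auto intro: measurable_compose[OF measurable_fst])
  moreover have "integrable (?R \<Otimes>\<^sub>M M) (\<lambda>(s, \<omega>). (k s)\<^sup>2 * (1 :: real))"
  proof (rule RM.integrable_mult_pair)
    have "k \<in> borel_measurable ?R" using k[of ?T] by (simp cong: measurable_cong_sets sets_restrict_space_cong)
    moreover have "(k s)\<^sup>2 \<le> C\<^sup>2" if "s \<in> {0..?T}" for s
      using C[OF that] eq[OF that] by (metis abs_ge_zero power2_abs power_mono)
    ultimately show "integrable ?R (\<lambda>s. (k s)\<^sup>2)"
      by (intro R.integrable_const_bound[where B = "C\<^sup>2"]) (auto simp: AE_restrict_space_iff)
  qed simp
  ultimately show ?thesis by (simp add: controls_def)
qed

text \<open>By \<open>duality\<close> the difference of the two gains is the integral of \<open>e\<^bsup>-r(s-t)\<^esup>\<close> times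
  \<open>(\<gamma>\<^sub>0 + \<gamma>\<^sub>1) (k - E u)\<^sup>2 + \<gamma>\<^sub>0 (E u\<^sup>2 - (E u)\<^sup>2)\<close>: the distance of the mean to the optimum plus the cost
  of the variance.\<close>
lemma J_le_maximiser:
  assumes \<gamma>: "0 < \<gamma>\<^sub>0 P" "0 < \<gamma>\<^sub>1 P" and u: "u \<in> controls M W P" and k: "(\<lambda>s \<omega>. k s) \<in> controls M W P"
    and k_eq: "\<And>s. s \<in> {t..horizon P} \<Longrightarrow> k s = (costate P s - (\<beta>\<^sub>0 P + \<beta>\<^sub>1 P)) / (2 * (\<gamma>\<^sub>0 P + \<gamma>\<^sub>1 P))"
  shows "J M W P t x u \<le> J M W P t x (\<lambda>s \<omega>. k s)"
proof -
  let ?T = "horizon P" and ?e = "\<lambda>s. exp (- rate P * (s - t))" and ?k = "\<lambda>s (\<omega> :: 'w). k s"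
  \<comment> \<open>\<open>?Q\<close> is the part of the gain difference that does not involve the mean states; \<open>?D\<close> replaces the part that does\<close>
  let ?dm = "\<lambda>s. mean_state ?k s - mean_state u s"
  let ?D = "\<lambda>s. ?e s * (costate P s * (k s - expectation (u s)))"
  let ?Q = "\<lambda>s. ?e s * mean_gain ?k s - ?e s * mean_gain u s - (\<alpha>\<^sub>0 P - \<alpha>\<^sub>1 P) * (?e s * ?dm s)"
  have Ek: "expectation (?k s) = k s" for s by (simp add: prob_space)
  have c: "continuous_on {t..?T} (\<lambda>s. ?e s * ?dm s)"
    unfolding mean_state_def
    by (intro continuous_intros continuous_on_linear_flow mean_input_set_integrable u k) auto
  have idm: "set_integrable lborel {t..?T} (\<lambda>s. ?e s * ?dm s)"
    unfolding set_integrable_def by (intro borel_integrable_compact c) simp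
  note iu = J_eq(1)[OF u] and ik = J_eq(1)[OF k]
  have iQ: "set_integrable lborel {t..?T} ?Q"
    by (intro set_integral_diff(1) ik iu set_integrable_mult_right idm impI)
  note dual = duality[OF k u, unfolded Ek]
  have "J M W P t x ?k - J M W P t x u
      = (LINT s:{t..?T}|lborel. ?e s * mean_gain ?k s) - (LINT s:{t..?T}|lborel. ?e s * mean_gain u s)
        + ?e ?T * ((l\<^sub>0 P - l\<^sub>1 P) * ?dm ?T)"
    by (simp add: J_eq(2)[OF u] J_eq(2)[OF k] right_diff_distrib)
  also have "\<dots> = (LINT s:{t..?T}|lborel. ?Q s) + (LINT s:{t..?T}|lborel. ?D s)"
    using dual(1) set_integral_diff[OF ik iu]
      set_integral_diff(2)[OF set_integral_diff(1)[OF ik iu] set_integrable_mult_right[of "\<alpha>\<^sub>0 P - \<alpha>\<^sub>1 P", OF idm]]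
    by (simp only: set_integral_mult_right)
  also have "\<dots> = (LINT s:{t..?T}|lborel. ?Q s + ?D s)"
    by (rule set_integral_add(2)[OF iQ dual(2), symmetric])
  also have "0 \<le> \<dots>"
    unfolding set_lebesgue_integral_def
  proof (rule integral_nonneg_AE)
    show "AE s in lborel. 0 \<le> indicator {t..?T} s *\<^sub>R (?Q s + ?D s)"
      using mean_square_le[OF u]
    proof eventually_elim
      case (elim s)
      show ?case
      proof (cases "s \<in> {t..?T}")
        case True
        define m m2 where "m = expectation (u s)" and "m2 = expectation (\<lambda>\<omega>. (u s \<omega>)\<^sup>2)"
        have m2: "m\<^sup>2 \<le> m2" using elim True by (simp add: m_def m2_def)
        have q: "costate P s = (\<beta>\<^sub>0 P + \<beta>\<^sub>1 P) + 2 * (\<gamma>\<^sub>0 P + \<gamma>\<^sub>1 P) * k s"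
          using k_eq[OF True] \<gamma> by (simp add: field_simps)
        have "?Q s + ?D s = ?e s * (costate P s * (k s - m) - (\<beta>\<^sub>0 P + \<beta>\<^sub>1 P) * (k s - m)
            - \<gamma>\<^sub>0 P * ((k s)\<^sup>2 - m2) - \<gamma>\<^sub>1 P * ((k s)\<^sup>2 - m\<^sup>2))"
          by (simp add: mean_gain_def Ek prob_space m_def m2_def algebra_simps)
        also have "\<dots> = ?e s * ((\<gamma>\<^sub>0 P + \<gamma>\<^sub>1 P) * (k s - m)\<^sup>2 + \<gamma>\<^sub>0 P * (m2 - m\<^sup>2))"
          unfolding q by (simp add: power2_eq_square algebra_simps)
        also have "0 \<le> \<dots>" using \<gamma> m2 by simp
        finally show ?thesis by simp
      qed simp
    qed
  qed
  finally show ?thesis by simp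
qed

lemma optimal_control_a_curve:
  assumes \<gamma>: "0 < \<gamma>\<^sub>0 P" "0 < \<gamma>\<^sub>1 P"
  shows "optimal_control M W P t x (\<lambda>s \<omega>. u_star P (B_adj P (a_curve P s)))"
proof -
  let ?T = "horizon P" and ?k = "\<lambda>s. u_star P (B_adj P (a_curve P s))"
  let ?c = "\<lambda>s. (costate P s - (\<beta>\<^sub>0 P + \<beta>\<^sub>1 P)) / (2 * (\<gamma>\<^sub>0 P + \<gamma>\<^sub>1 P))"
  have eq: "?k s = ?c s" if "s \<le> ?T" for s by (rule u_star_a_curve[OF b1 that])
  obtain K where K: "\<And>s. s \<in> {0..?T} \<Longrightarrow> \<bar>costate P s\<bar> \<le> K" by (rule costate_bounded) blast
  have k: "(\<lambda>s \<omega>. ?k s) \<in> controls M W P"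
  proof (rule deterministic_control)
    show "?c \<in> borel_measurable borel" by measurable
    fix s assume s: "s \<in> {0..?T}"
    have "\<bar>costate P s - (\<beta>\<^sub>0 P + \<beta>\<^sub>1 P)\<bar> \<le> K + \<bar>\<beta>\<^sub>0 P + \<beta>\<^sub>1 P\<bar>" using K[OF s] by linarith
    then show "\<bar>?c s\<bar> \<le> (K + \<bar>\<beta>\<^sub>0 P + \<beta>\<^sub>1 P\<bar>) / (2 * (\<gamma>\<^sub>0 P + \<gamma>\<^sub>1 P))"
      using \<gamma> by (simp add: abs_divide divide_right_mono)
    show "?k s = ?c s" using s by (intro eq) simp
  qed
  have "V M W P t x = ereal (J M W P t x (\<lambda>s \<omega>. ?k s))"
    unfolding V_def
  proof (rule SUP_eqI)
    fix u assume "u \<in> controls M W P"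
    then show "ereal (J M W P t x u) \<le> ereal (J M W P t x (\<lambda>s \<omega>. ?k s))"
      using J_le_maximiser[OF \<gamma> _ k] eq by simp
  qed (use k in auto)
  with k show ?thesis by (simp add: optimal_control_def)
qed

end

theorem corollary4p5:
  fixes M :: "'w measure" and W :: "real \<Rightarrow> 'w \<Rightarrow> real"
    and P :: lq_data and t x :: real
  assumes "prob_space M"
    and "\<And>N A. N \<in> null_sets M \<Longrightarrow> A \<subseteq> N \<Longrightarrow> A \<in> sets M"
    and "brownian_motion M (brownian_filtration M W) W"
    and "0 < horizon P" and "0 < delay P"
    and "0 \<le> b\<^sub>0 P"
    and "L2_delay (delay P) (b\<^sub>1 P)"
    and "AE \<xi> in lborel. \<xi> \<in> {-delay P..0} \<longrightarrow> 0 \<le> b\<^sub>1 P \<xi>"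
    and "L2_delay (delay P) (\<delta> P)"
    and "0 < \<gamma>\<^sub>0 P" and "0 < \<gamma>\<^sub>1 P"
    and "t \<in> {0..horizon P}"
  shows "optimal_control M W P t x (\<lambda>s \<omega>. u_star P (B_adj P (a_curve P s)))"
proof -
  interpret prob_space M by fact
  interpret lq_problem M W P t x
    by unfold_locales (use assms in auto)
  show ?thesis using assms by (intro optimal_control_a_curve)
qed

end
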